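(* Fix $k\in\mathbb{N}$, and consider the two-level mixed model of the context with $m=n_{\min}^q$ for any $q>0$. Let $\widetilde\pi^{AQ}(y;\theta)$ be the adaptive quadrature approximation to the marginal likelihood $\pi(y;\theta)$ based on a quadrature rule satisfying property $\mathscr{P}(k,d)$. Assume the regularity conditions (Deriv), (Hess), (Far), (FarOut), (Cons) and (Prior) of the context hold. Then there exists $C>0$ not depending on $m$ such that $$\lim_{n_{\min}\to\infty}P_N^*\left(\sup_{\theta\in B_{\theta_*}(\zeta_N)}\left|\log\widetilde\pi^{AQ}(y;\theta)-\log\pi(y;\theta)\right|<C\sum_{i=1}^m n_i^{-\lfloor(k+2)/3\rfloor+\varepsilon}\right)=1$$ for every $\varepsilon>0$.
   Context: **Setting.** Data consist of $m$ groups of sizes $n_1,\dots,n_m$; $N=\sum_i n_i$, $n_{\min}=\min_i n_i$, and $m=n_{\min}^q$ for some $q>0$; limits are as $n_{\min}\to\infty$. The observations are $y_i=(y_{ij})_{j\le n_i}$, $y=(y_1,\dots,y_m)$, with true joint distribution $P_N^*$ (not assumed to belong to the model). Covariates $x_{ij}$ are conditioned upon. The model is $y_{ij}\mid x_{ij},u_i\sim F(x_{ij},u_i;\beta,\phi)$ independently, with density $f(y_{ij}\mid u_i;\beta,\phi)$, and random effects $u_i\in\mathbb{R}^d$ independent with distribution $G(\sigma)$, of known mean, and density $g(u;\sigma)$. Parameter: $\theta=(\beta,\phi,\sigma)\in\Theta\subseteq\mathbb{R}^p$. Write $\pi_i(y_i\mid u;\theta)=\prod_{j=1}^{n_i}f(y_{ij}\mid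 u;\beta,\phi)$, $\pi(y_i,u;\theta)=\pi_i(y_i\mid u;\theta)g(u;\sigma)$, $\ell_i^\theta(u)=\log\pi(y_i,u;\theta)$, $\pi(y_i;\theta)=\int_{\mathbb{R}^d}\pi(y_i,u;\theta)\,du$, $\pi(y;\theta)=\prod_{i=1}^m\pi(y_i;\theta)$, and $\widehat u_i^\theta=\arg\max_{u\in\mathbb{R}^d}\ell_i^\theta(u)$. $B_z(r)$ is the open Euclidean ball of radius $r$ centred at $z$. **Quadrature.** A quadrature rule is a finite set $\mathcal{Q}\subset\mathbb{R}^d$ with weights $\omega:\mathcal{Q}\to\mathbb{R}$. It satisfies $\mathscr{P}(k,d)$ if for every real polynomial $P$ on $\mathbb{R}^d$ of total degree at most $2k-1$, $\int_{\mathbb{R}^d}\varphi(u)P(u)\,du=\sum_{z\in\mathcal{Q}}\varphi(z)P(z)\omega(z)$, where $\varphi$ is the standard $d$-dimensional Gaussian density. With $H_i^\theta=-\partial_u^2\ell_i^\theta(\widehat u_i^\theta)$ and $L_i^\theta$ the lower Cholesky factor, $(H_i^\theta)^{-1}=L_i^\theta(L_i^\theta)^\top$, the adaptive quadrature (AQ) approximation is $\widetilde\pi^{AQ}(y_i;\theta)=\det(L_i^\theta)\sum_{z\in\mathcal{Q}}\pi(y_i,L_i^\theta z+\widehat u_i^\theta;\theta)\,\omega(z)$ and $\widetilde\pi^{AQ}(y;\theta)=\prod_{i=1}^m\widetilde\pi^{AQ}(y_i;\theta)$. **Regularity conditions.** There exist $\delta>0$, $0<\alpha<1/4$, $\theta_*\in\Theta$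 and $u_{*,i}\in\mathbb{R}^d$ ($i=1,\dots,m$) such that, with $\zeta_N=n_{\min}^{-\alpha}$, each of the following holds for all $\varepsilon>0$ ($\lambda_1\ge\lambda_2\ge\cdots$ denote the ordered eigenvalues of a matrix; $\|\cdot\|_{op}$ is the operator norm; "$\forall i$" means for all $i=1,\dots,m$; limits are as $n_{\min}\to\infty$). - (Deriv) There exist $t,D>0$ such that for all multi-indices $a\in\mathbb{N}^d$ with $0\le|a|\le t$: $\lim P_N^*[\forall i:\ \sup_{\theta\in B_{\theta_*}(\delta)}\sup_{u\in B_{u_{*,i}}(\delta)}|\partial_u^a\ell_i^\theta(u)|<n_i^{1+\varepsilon}D]=1$. - (Hess) There exist $0<\underline\eta\le\overline\eta<\infty$ such that $\lim P_N^*[\forall i:\ n_i^{1-\varepsilon}\underline\eta\le\inf_{\theta\in B_{\theta_*}(\delta)}\inf_{u\in B_{u_{*,i}}(\delta)}\lambda_d(-\partial^2_{(\theta,u)}\ell_i^\theta(u))\le\sup_{\theta\in B_{\theta_*}(\delta)}\sup_{u\in B_{u_{*,i}}(\delta)}\lambda_1(-\partial^2_{(\theta,u)}\ell_i^\theta(u))\le n_i^{1+\varepsilon}\overline\eta]=1$. - (Far) There exists $b>0$ such that $\lim P_N^*[\forall i:\ \sup_{\theta\in B_{\theta_*}(\zeta_N)}\sup_{u\in B_{u_{*,i}}(\delta)^c}\{\log\pi_i(y_i\mid u;\theta)-\log\pi_i(y_i\mid u_{*,i};\theta)\}\le-n_i^{1-\varepsilon}b]=1$. - (FarOut) There exists $b'>0$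 such that $\lim P_N^*[\forall i:\ \sup_{\theta\in B_{\theta_*}(\delta)^c}\sup_{u\in B_{u_{*,i}}(\delta)^c}\{\log\pi_i(y_i\mid u;\theta)-\log\pi_i(y_i\mid u_{*,i};\theta)\}\le-n_i^{1-\varepsilon}b']=1$. - (Cons) There exists $\beta_0>0$ such that $\lim P_N^*[\forall i:\ \sup_{\theta\in B_{\theta_*}(\zeta_N)}\zeta_N^{-1}\|\widehat u_i^\theta-u_{*,i}\|_2\le\beta_0n_i^\varepsilon]=1$; and for every $\beta'>0$ and every function $G'$ with $G'(n)\to\infty$ as $n\to\infty$, $\lim P_N^*[\forall i:\ n_i^{1/2}G'(n_i)^{-1}\|\widehat u_i^{\theta_*}-u_{*,i}\|_2>\beta'n_i^\varepsilon]=0$. - (Prior) There exist $0<c_1<c_2<\infty$ such that $c_1\le\inf_{\theta\in B_{\theta_*}(\zeta_N)}\inf_{u\in B_{u_{*,i}}(\delta)}g(u;\sigma)\le\sup_{\theta\in B_{\theta_*}(\zeta_N)}\sup_{u\in B_{u_{*,i}}(\delta)}g(u;\sigma)\le c_2$ for all $i$; and, uniformly in $i=1,\dots,m$, for some $a\in\mathbb{R}$ and all $\theta\in B_{\theta_*}(\zeta_N)$, $\int_{\mathbb{R}^d}\|\partial_\theta\log\pi_i(y_i\mid u;\theta)\|_2\,g(u;\sigma)\,du=O(n_i^a)$ and $\int_{\mathbb{R}^d}\|\partial_\theta^2\log\pi_i(y_i\mid u;\theta)\|_{op}\,g(u;\sigma)\,du=O(n_i^a)$.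
   Formalization: Added: k≥1; symmetric rule if k≡1 mod 3; t≥2⌊(k+2)/3⌋+2 in (Deriv); the lower bound of (Hess) also for the Hessian in u alone; with probability →1 the modes exist and lie in B_{u_*,i}(δ/2) for θ in B_{θ_*}(ζ_N). Otherwise the claim can fail. *)

theory Defs
  imports "HOL-Probability.Probability"
begin

section \<open>Probability of possibly non-measurable events\<close>

text \<open>
  The events below involve suprema over uncountable sets and need not be measurable. Their
  probability is read as inner probability; this is the ordinary probability for measurable
  events, and a probability tends to 0 when that of the complementary event tends to 1.
\<close>

definition inner_prob :: "'a measure \<Rightarrow> 'a set \<Rightarrow> real" where
  "inner_prob M A = 1 - enn2real (outer_measure_of M (space M - A))"

lemma inner_prob_eq_prob:
  assumes "prob_space M" "A \<in> sets M"
  shows "inner_prob M A = measure M A"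
proof -
  interpret prob_space M by fact
  have "outer_measure_of M (space M - A) = emeasure M (space M - A)"
    using assms(2) by (intro outer_measure_of_eq) auto
  then show ?thesis
    using prob_compl[OF assms(2)] by (simp add: inner_prob_def measure_def)
qed

section \<open>Logarithms, derivatives and eigenvalues\<close>

text \<open>\<^const>\<open>ln\<close> is 0 at 0; the extended logarithm keeps zeros of densities out of maxima.\<close>

definition eln :: "real \<Rightarrow> ereal" where
  "eln x = (if 0 < x then ereal (ln x) else - \<infinity>)"

type_synonym 'd rvec = "(real, 'd) vec"
type_synonym 'd rmat = "('d rvec, 'd) vec"

definition dir_deriv :: "'e::euclidean_space \<Rightarrow> ('e \<Rightarrow> real) \<Rightarrow> 'e \<Rightarrow> real" where
  "dir_deriv b f x = deriv (\<lambda>h. f (x + h *\<^sub>R b)) 0"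

primrec iter_deriv :: "'e::euclidean_space list \<Rightarrow> ('e \<Rightarrow> real) \<Rightarrow> 'e \<Rightarrow> real" where
  "iter_deriv [] f = f"
| "iter_deriv (b # bs) f = dir_deriv b (iter_deriv bs f)"

text \<open>\<open>t\<close>-fold continuous differentiability, meaningful for open \<open>S\<close>.\<close>

definition Ck_on :: "nat \<Rightarrow> 'e::euclidean_space set \<Rightarrow> ('e \<Rightarrow> real) \<Rightarrow> bool" where
  "Ck_on t S f \<longleftrightarrow>
     (\<forall>bs. set bs \<subseteq> Basis \<and> length bs \<le> t \<longrightarrow> continuous_on S (iter_deriv bs f)) \<and>
     (\<forall>bs. set bs \<subseteq> Basis \<and> length bs < t \<longrightarrow>
        (\<forall>x\<in>S. \<forall>b\<in>Basis. (\<lambda>h::real. iter_deriv bs f (x + h *\<^sub>R b)) differentiable at 0))"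

definition multi_deriv :: "('d::{finite,linorder} \<Rightarrow> nat) \<Rightarrow> ('d rvec \<Rightarrow> real) \<Rightarrow> 'd rvec \<Rightarrow> real" where
  "multi_deriv a =
     iter_deriv (concat (map (\<lambda>j. replicate (a j) (axis j 1)) (sorted_list_of_set UNIV)))"

definition grad :: "('e::euclidean_space \<Rightarrow> real) \<Rightarrow> 'e \<Rightarrow> 'e" where
  "grad f x = (\<Sum>b\<in>Basis. dir_deriv b f x *\<^sub>R b)"

definition hess :: "('e::euclidean_space \<Rightarrow> real) \<Rightarrow> 'e \<Rightarrow> 'e \<Rightarrow> 'e" where
  "hess f x v = (\<Sum>b\<in>Basis. (\<Sum>c\<in>Basis. (v \<bullet> c) * iter_deriv [b, c] f x) *\<^sub>R b)"

definition eigenvals :: "('e::euclidean_space \<Rightarrow> 'e) \<Rightarrow> real set" where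
  "eigenvals A = {l. \<exists>v. v \<noteq> 0 \<and> A v = l *\<^sub>R v}"

text \<open>
  The \<open>r\<close>-th largest eigenvalue of a self-adjoint operator, counted with multiplicity
  (\<open>1 \<le> r \<le> DIM('e)\<close>).
\<close>

definition ord_eigenval :: "nat \<Rightarrow> ('e::euclidean_space \<Rightarrow> 'e) \<Rightarrow> real" where
  "ord_eigenval r A =
     Max {l \<in> eigenvals A. r \<le> (\<Sum>\<mu> | \<mu> \<in> eigenvals A \<and> l \<le> \<mu>. dim {v. A v = \<mu> *\<^sub>R v})}"

text \<open>For positive definite \<open>A\<close> the factor exists and is unique.\<close>

definition cholesky :: "'d::{finite,linorder} rmat \<Rightarrow> 'd rmat" where
  "cholesky A = (SOME L. (\<forall>i j. i < j \<longrightarrow> L $ i $ j = 0) \<and> (\<forall>i. 0 < L $ i $ i) \<and>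
                         L ** transpose L = A)"

section \<open>Quadrature rules\<close>

definition gauss_dens :: "'d::finite rvec \<Rightarrow> real" where
  "gauss_dens u = (\<Prod>j\<in>UNIV. std_normal_density (u $ j))"

definition poly_fun :: "nat \<Rightarrow> ('d::finite rvec \<Rightarrow> real) \<Rightarrow> bool" where
  "poly_fun r P \<longleftrightarrow>
     (\<exists>c. P = (\<lambda>u. \<Sum>a | (\<Sum>j\<in>UNIV. a j) \<le> r. c a * (\<Prod>j\<in>UNIV. (u $ j) ^ a j)))"

definition quad_exact :: "nat \<Rightarrow> ('d::finite rvec) set \<Rightarrow> ('d rvec \<Rightarrow> real) \<Rightarrow> bool" where
  "quad_exact k Q \<omega> \<longleftrightarrow>
     (\<forall>P. poly_fun (2 * k - 1) P \<longrightarrow>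
        (\<integral>u. gauss_dens u * P u \<partial>lborel) = (\<Sum>z\<in>Q. gauss_dens z * P z * \<omega> z))"

text \<open>
  When \<open>k mod 3 = 1\<close>, exactness up to degree \<open>2 * k - 1\<close> alone does not give the rate
  \<open>(k + 2) div 3\<close>: an error term of degree \<open>2 * k + 1\<close> has order \<open>(k + 2) div 3 - 1 / 2\<close> and only
  vanishes for symmetric rules such as products of Gauss-Hermite rules.
\<close>

definition quad_symmetric :: "('d::finite rvec) set \<Rightarrow> ('d rvec \<Rightarrow> real) \<Rightarrow> bool" where
  "quad_symmetric Q \<omega> \<longleftrightarrow> (\<forall>z\<in>Q. - z \<in> Q \<and> \<omega> (- z) = \<omega> z)"

section \<open>The two-level mixed model\<close>

text \<open>
  A parameter is a triple \<open>\<theta> = (\<beta>, \<phi>, \<sigma>)\<close>. The density \<open>f\<close> of the responses is taken with respect to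
  the \<open>\<sigma>\<close>-finite measure \<open>resp_space\<close>, so that discrete responses are covered as well.
\<close>

record ('x, 'y, 'd::finite, 'b, 'f, 's) mixed_model =
  resp_space :: "'y measure"
  cond_dens :: "'x \<Rightarrow> 'd rvec \<Rightarrow> 'b \<Rightarrow> 'f \<Rightarrow> 'y \<Rightarrow> real"
  re_dens :: "'s \<Rightarrow> 'd rvec \<Rightarrow> real"
  re_mean :: "'d rvec"
  params :: "('b \<times> 'f \<times> 's) set"

definition is_mixed_model ::
    "('x, 'y, 'd::finite, 'b, 'f, 's) mixed_model \<Rightarrow> bool" where
  "is_mixed_model M \<longleftrightarrow>
     sigma_finite_measure (resp_space M) \<and>
     (\<forall>(\<beta>, \<phi>, \<sigma>) \<in> params M.
        (\<forall>x. (\<lambda>(u, y). cond_dens M x u \<beta> \<phi> y) \<in> borel_measurable (borel \<Otimes>\<^sub>M resp_space M) \<and>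
             (\<forall>u. \<forall>y\<in>space (resp_space M). 0 \<le> cond_dens M x u \<beta> \<phi> y) \<and>
             (\<forall>u. (\<integral>\<^sup>+y. ennreal (cond_dens M x u \<beta> \<phi> y) \<partial>resp_space M) = 1)) \<and>
        re_dens M \<sigma> \<in> borel_measurable borel \<and>
        (\<forall>u. 0 \<le> re_dens M \<sigma> u) \<and>
        (\<integral>\<^sup>+u. ennreal (re_dens M \<sigma> u) \<partial>lborel) = 1 \<and>
        integrable lborel (\<lambda>u. re_dens M \<sigma> u *\<^sub>R u) \<and>
        (\<integral>u. re_dens M \<sigma> u *\<^sub>R u \<partial>lborel) = re_mean M)"

text \<open>
  A data set: the number of groups, the group sizes, the covariates and the true law of the
  responses. Groups and units are numbered from 0.
\<close>

record ('x, 'y) dataset =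
  groups :: nat
  gsize :: "nat \<Rightarrow> nat"
  covar :: "nat \<Rightarrow> nat \<Rightarrow> 'x"
  law :: "(nat \<Rightarrow> nat \<Rightarrow> 'y) measure"

definition n_min :: "('x, 'y) dataset \<Rightarrow> nat" where
  "n_min D = Min (gsize D ` {..<groups D})"

text \<open>
  As \<open>n_min ^ q\<close> is in general not an integer, \<open>m = n_min ^ q\<close> is understood up to rounding
  (in either direction).
\<close>

definition is_dataset ::
    "('x, 'y, 'd::finite, 'b, 'f, 's) mixed_model \<Rightarrow> real \<Rightarrow> ('x, 'y) dataset \<Rightarrow> bool" where
  "is_dataset M q D \<longleftrightarrow>
     1 \<le> groups D \<and> (\<forall>i<groups D. 1 \<le> gsize D i) \<and>
     \<bar>real (groups D) - real (n_min D) powr q\<bar> < 1 \<and>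
     prob_space (law D) \<and>
     sets (law D) = sets (\<Pi>\<^sub>M i\<in>{..<groups D}. \<Pi>\<^sub>M j\<in>{..<gsize D i}. resp_space M)"

definition zeta :: "real \<Rightarrow> ('x, 'y) dataset \<Rightarrow> real" where
  "zeta \<alpha> D = real (n_min D) powr (- \<alpha>)"

context
  fixes M :: "('x, 'y, 'd::{finite,linorder}, 'b::euclidean_space, 'f::euclidean_space,
               's::euclidean_space) mixed_model"
    and D :: "('x, 'y) dataset"
    and y :: "nat \<Rightarrow> nat \<Rightarrow> 'y"
begin

definition lik :: "nat \<Rightarrow> 'b \<times> 'f \<times> 's \<Rightarrow> 'd rvec \<Rightarrow> real" where
  "lik i \<theta> u =
     (case \<theta> of (\<beta>, \<phi>, \<sigma>) \<Rightarrow> \<Prod>j<gsize D i. cond_dens M (covar D i j) u \<beta> \<phi> (y i j))"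

definition joint :: "nat \<Rightarrow> 'b \<times> 'f \<times> 's \<Rightarrow> 'd rvec \<Rightarrow> real" where
  "joint i \<theta> u = lik i \<theta> u * re_dens M (snd (snd \<theta>)) u"

definition marginal_group :: "nat \<Rightarrow> 'b \<times> 'f \<times> 's \<Rightarrow> real" where
  "marginal_group i \<theta> = (\<integral>u. joint i \<theta> u \<partial>lborel)"

definition marginal :: "'b \<times> 'f \<times> 's \<Rightarrow> real" where
  "marginal \<theta> = (\<Prod>i<groups D. marginal_group i \<theta>)"

definition u_hat :: "nat \<Rightarrow> 'b \<times> 'f \<times> 's \<Rightarrow> 'd rvec" where
  "u_hat i \<theta> = arg_max (\<lambda>u. eln (joint i \<theta> u)) (\<lambda>u. True)"

definition H_mat :: "nat \<Rightarrow> 'b \<times> 'f \<times> 's \<Rightarrow> 'd rmat" where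
  "H_mat i \<theta> = - matrix (hess (\<lambda>u. ln (joint i \<theta> u)) (u_hat i \<theta>))"

definition L_mat :: "nat \<Rightarrow> 'b \<times> 'f \<times> 's \<Rightarrow> 'd rmat" where
  "L_mat i \<theta> = cholesky (matrix_inv (H_mat i \<theta>))"

definition aq_group ::
    "('d rvec) set \<Rightarrow> ('d rvec \<Rightarrow> real) \<Rightarrow> nat \<Rightarrow> 'b \<times> 'f \<times> 's \<Rightarrow> real" where
  "aq_group Q \<omega> i \<theta> =
     det (L_mat i \<theta>) * (\<Sum>z\<in>Q. joint i \<theta> (L_mat i \<theta> *v z + u_hat i \<theta>) * \<omega> z)"

definition aq ::
    "('d rvec) set \<Rightarrow> ('d rvec \<Rightarrow> real) \<Rightarrow> 'b \<times> 'f \<times> 's \<Rightarrow> real" where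
  "aq Q \<omega> \<theta> = (\<Prod>i<groups D. aq_group Q \<omega> i \<theta>)"

end

section \<open>Regularity conditions\<close>

text \<open>
  The limit \<open>n_min \<longlonglongrightarrow> \<infinity>\<close> is taken along a sequence \<open>D\<close> of data sets. The constants of the conditions
  are chosen after \<open>\<epsilon>\<close>, which is the weakest reading. Non-strict bounds on suprema and infima are
  written pointwise.
\<close>

definition whp ::
    "(nat \<Rightarrow> ('x, 'y) dataset) \<Rightarrow> (nat \<Rightarrow> (nat \<Rightarrow> nat \<Rightarrow> 'y) \<Rightarrow> bool) \<Rightarrow> bool" where
  "whp D A \<longleftrightarrow>
     (\<lambda>s. inner_prob (law (D s)) {y \<in> space (law (D s)). A s y}) \<longlonglongrightarrow> 1"

context
  fixes M :: "('x, 'y, 'd::{finite,linorder}, 'b::euclidean_space, 'f::euclidean_space,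
               's::euclidean_space) mixed_model"
    and D :: "nat \<Rightarrow> ('x, 'y) dataset"
    and \<alpha> \<delta> :: real
    and \<theta>s :: "'b \<times> 'f \<times> 's"
    and us :: "nat \<Rightarrow> nat \<Rightarrow> 'd rvec"
begin

text \<open>
  The argument \<open>t\<^sub>0\<close> is a lower bound on the order of differentiation \<open>t\<close>. Without one (e.g. with
  \<open>t = 1\<close>) no rate can be inferred; the Taylor remainder of order \<open>t\<close> is of order \<open>1 - t / 2\<close> in the
  group size, so that the rate \<open>- r\<close> needs \<open>t \<ge> 2 * r + 2\<close>.
\<close>

definition cond_Deriv :: "nat \<Rightarrow> bool" where
  "cond_Deriv t\<^sub>0 \<longleftrightarrow>
     (\<forall>\<epsilon>>0. \<exists>t>0. \<exists>K>0. t\<^sub>0 \<le> t \<and>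
       (\<forall>a. (\<Sum>j\<in>UNIV. a j) \<le> t \<longrightarrow>
         whp D (\<lambda>s y. \<forall>i<groups (D s).
           (\<forall>\<theta>\<in>ball \<theta>s \<delta>. (\<forall>u\<in>ball (us s i) \<delta>. 0 < joint M (D s) y i \<theta> u) \<and>
              Ck_on t (ball (us s i) \<delta>) (\<lambda>u. ln (joint M (D s) y i \<theta> u))) \<and>
           (SUP \<theta>\<in>ball \<theta>s \<delta>. SUP u\<in>ball (us s i) \<delta>.
              ereal \<bar>multi_deriv a (\<lambda>u. ln (joint M (D s) y i \<theta> u)) u\<bar>)
             < ereal (real (gsize (D s) i) powr (1 + \<epsilon>) * K))))"

definition cond_Hess :: bool where
  "cond_Hess \<longleftrightarrow>
     (\<forall>\<epsilon>>0. \<exists>\<eta>\<^sub>1 \<eta>\<^sub>2. 0 < \<eta>\<^sub>1 \<and> \<eta>\<^sub>1 \<le> \<eta>\<^sub>2 \<and>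
       whp D (\<lambda>s y. \<forall>i<groups (D s).
         (\<forall>\<theta>\<in>ball \<theta>s \<delta>. \<forall>u\<in>ball (us s i) \<delta>. 0 < joint M (D s) y i \<theta> u) \<and>
         Ck_on 2 (ball \<theta>s \<delta> \<times> ball (us s i) \<delta>) (\<lambda>(\<theta>, u). ln (joint M (D s) y i \<theta> u)) \<and>
         (\<forall>\<theta>\<in>ball \<theta>s \<delta>. \<forall>u\<in>ball (us s i) \<delta>.
            let A = (\<lambda>v. - hess (\<lambda>(\<theta>, u). ln (joint M (D s) y i \<theta> u)) (\<theta>, u) v)
            in real (gsize (D s) i) powr (1 - \<epsilon>) * \<eta>\<^sub>1 \<le> ord_eigenval CARD('d) A \<and>
               ord_eigenval 1 A \<le> real (gsize (D s) i) powr (1 + \<epsilon>) * \<eta>\<^sub>2)))"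

text \<open>
  The Hessian in \<open>(\<theta>, u)\<close> has more than \<open>d\<close> eigenvalues, so a lower bound on its \<open>d\<close>-th largest one
  leaves \<open>H_mat\<close> uncontrolled. The same bound is therefore imposed on the \<open>d \<times> d\<close> Hessian in \<open>u\<close>,
  whose \<open>d\<close>-th eigenvalue is the least one. The least eigenvalue of the full Hessian is not an
  alternative: its \<open>\<sigma>\<close>-block only involves \<open>re_dens\<close> and does not grow with the group size.
\<close>

definition cond_Hess_u :: bool where
  "cond_Hess_u \<longleftrightarrow>
     (\<forall>\<epsilon>>0. \<exists>\<eta>>0.
       whp D (\<lambda>s y. \<forall>i<groups (D s). \<forall>\<theta>\<in>ball \<theta>s \<delta>. \<forall>u\<in>ball (us s i) \<delta>.
         real (gsize (D s) i) powr (1 - \<epsilon>) * \<eta>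
           \<le> ord_eigenval CARD('d) (\<lambda>v. - hess (\<lambda>u. ln (joint M (D s) y i \<theta> u)) u v)))"

definition cond_Far :: bool where
  "cond_Far \<longleftrightarrow>
     (\<forall>\<epsilon>>0. \<exists>b>0.
       whp D (\<lambda>s y. \<forall>i<groups (D s). \<forall>\<theta>\<in>ball \<theta>s (zeta \<alpha> (D s)). \<forall>u\<in>- ball (us s i) \<delta>.
         eln (lik M (D s) y i \<theta> u) - eln (lik M (D s) y i \<theta> (us s i))
           \<le> ereal (- (real (gsize (D s) i) powr (1 - \<epsilon>) * b))))"

definition cond_FarOut :: bool where
  "cond_FarOut \<longleftrightarrow>
     (\<forall>\<epsilon>>0. \<exists>b>0.
       whp D (\<lambda>s y. \<forall>i<groups (D s). \<forall>\<theta>\<in>params M - ball \<theta>s \<delta>. \<forall>u\<in>- ball (us s i) \<delta>.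
         eln (lik M (D s) y i \<theta> u) - eln (lik M (D s) y i \<theta> (us s i))
           \<le> ereal (- (real (gsize (D s) i) powr (1 - \<epsilon>) * b))))"

definition cond_Cons :: bool where
  "cond_Cons \<longleftrightarrow>
     (\<forall>\<epsilon>>0.
       (\<exists>\<beta>\<^sub>0>0. whp D (\<lambda>s y. \<forall>i<groups (D s). \<forall>\<theta>\<in>ball \<theta>s (zeta \<alpha> (D s)).
          norm (u_hat M (D s) y i \<theta> - us s i) / zeta \<alpha> (D s)
            \<le> \<beta>\<^sub>0 * real (gsize (D s) i) powr \<epsilon>)) \<and>
       (\<forall>\<beta>'>0. \<forall>G. filterlim G at_top sequentially \<longrightarrow>
          whp D (\<lambda>s y. \<not> (\<forall>i<groups (D s).
            \<beta>' * real (gsize (D s) i) powr \<epsilon>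
              < sqrt (real (gsize (D s) i)) / G (gsize (D s) i)
                * norm (u_hat M (D s) y i \<theta>s - us s i)))))"

text \<open>
  Well-definedness of the approximation: the modes exist and lie in the neighbourhoods in which the
  log-likelihood is regular, away from their boundary. As \<open>gsize\<close> may grow arbitrarily fast compared
  with \<open>n_min\<close>, the localisation is not implied by \<open>cond_Cons\<close>.
\<close>

definition modes_exist :: bool where
  "modes_exist \<longleftrightarrow>
     whp D (\<lambda>s y. \<forall>i<groups (D s). \<forall>\<theta>\<in>ball \<theta>s (zeta \<alpha> (D s)).
       (\<exists>u. is_arg_max (\<lambda>u. eln (joint M (D s) y i \<theta> u)) (\<lambda>u. True) u) \<and>
       u_hat M (D s) y i \<theta> \<in> ball (us s i) (\<delta> / 2))"

text \<open>The moment bounds depend on the data and are required with probability tending to one.\<close>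

definition cond_Prior :: bool where
  "cond_Prior \<longleftrightarrow>
     (\<exists>c\<^sub>1 c\<^sub>2. 0 < c\<^sub>1 \<and> c\<^sub>1 < c\<^sub>2 \<and>
       (\<forall>\<^sub>F s in sequentially. \<forall>i<groups (D s).
          \<forall>\<theta>\<in>ball \<theta>s (zeta \<alpha> (D s)). \<forall>u\<in>ball (us s i) \<delta>.
            c\<^sub>1 \<le> re_dens M (snd (snd \<theta>)) u \<and> re_dens M (snd (snd \<theta>)) u \<le> c\<^sub>2)) \<and>
     (\<exists>a K. whp D (\<lambda>s y. \<forall>i<groups (D s). \<forall>\<theta>\<in>ball \<theta>s (zeta \<alpha> (D s)).
        (AE u in lborel. 0 < re_dens M (snd (snd \<theta>)) u \<longrightarrow>
           (\<exists>r>0. (\<forall>\<theta>'\<in>ball \<theta> r. 0 < lik M (D s) y i \<theta>' u) \<and>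
                  Ck_on 2 (ball \<theta> r) (\<lambda>\<theta>'. ln (lik M (D s) y i \<theta>' u)))) \<and>
        (\<integral>\<^sup>+u. ennreal (norm (grad (\<lambda>\<theta>'. ln (lik M (D s) y i \<theta>' u)) \<theta>)
                 * re_dens M (snd (snd \<theta>)) u) \<partial>lborel)
          \<le> ennreal (K * real (gsize (D s) i) powr a) \<and>
        (\<integral>\<^sup>+u. ennreal (onorm (hess (\<lambda>\<theta>'. ln (lik M (D s) y i \<theta>' u)) \<theta>)
                 * re_dens M (snd (snd \<theta>)) u) \<partial>lborel)
          \<le> ennreal (K * real (gsize (D s) i) powr a)))"

end

end

theory Submission
  imports Defs "HOL-Real_Asymp.Real_Asymp"
begin

text \<open>
  For each group, substitute \<open>u = m + L z\<close>, where \<open>m\<close> is the mode. Since \<open>L\<^sup>T H L = 1\<close>, the integrand becomes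
  \<open>exp (- |z|\<^sup>2 / 2) * exp R\<close> up to a constant, where \<open>R\<close> is the part of order at least 3 of the Taylor
  expansion of the log-likelihood; its term of degree \<open>w + 2\<close> in \<open>z\<close> has order \<open>n powr (- w / 2)\<close>.
  Expanding \<open>exp R\<close> by this weight \<open>w\<close>, the part of weight \<open>w\<close> is a polynomial in \<open>z\<close> of degree at most \<open>3 * w\<close>
  and of the parity of \<open>w\<close>. With \<open>r = (k + 2) div 3\<close>, the rule is exact on all parts of weight
  \<open>w < 2 * r\<close>: either \<open>3 * w \<le> 2 * k - 1\<close>, or \<open>k mod 3 = 1\<close>, \<open>w = 2 * r - 1\<close> is odd and both sides vanish by
  symmetry. So integral and quadrature sum differ by the parts of weight at least \<open>2 * r\<close>, of order
  \<open>n powr (- r)\<close>, and by exponentially small tails.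
\<close>

section \<open>Partial derivatives and Taylor expansion along lines\<close>

text \<open>The hypotheses lose factors \<open>n powr \<epsilon>\<close> in the derivatives and in
  the Hessian, so the radius of the Taylor expansion is a compromise:
  \<open>\<rho> = n powr (- 1 / 2 + \<epsilon>)\<close> exceeds the Laplace scale
  \<open>1 / sqrt \<mu>\<close> by a power of \<open>n\<close>, which makes the tails negligible,
  while \<open>\<Lambda> * \<rho> ^ 3\<close> still tends to 0, which makes the expansion of the
  exponential converge. These losses and all constants are absorbed by using the hypotheses with a
  much smaller \<epsilon> than the one in the conclusion; this is why one constant serves every
  \<epsilon>. The analysis of a group is deterministic, with explicit bounds in place of O-terms.
  The growing number of groups then needs no union bound, since each event of high probability
  already covers all groups and all \<theta>. Comparing logarithms needs a lower bound for the
  normalised marginal that is independent of \<open>n\<close>; it is \<open>c0\<close>, the Gaussian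
  mass of the unit ball times \<open>exp (- 1)\<close>.\<close>

lemma Ck_onD_cont: "Ck_on t S f \<Longrightarrow> set bs \<subseteq> Basis \<Longrightarrow> length bs \<le> t \<Longrightarrow> continuous_on S (iter_deriv bs f)"
  by (auto simp: Ck_on_def)

lemma Ck_on_mono: "Ck_on t S f \<Longrightarrow> t' \<le> t \<Longrightarrow> Ck_on t' S f"
  unfolding Ck_on_def by (meson order.trans order.strict_trans2)

lemma Ck_on_DERIV:
  assumes "Ck_on t S f" "set bs \<subseteq> Basis" "length bs < t" "x \<in> S" "b \<in> Basis"
  shows "((\<lambda>h. iter_deriv bs f (x + h *\<^sub>R b)) has_real_derivative iter_deriv (b # bs) f x) (at 0)"
proof -
  have "(\<lambda>h::real. iter_deriv bs f (x + h *\<^sub>R b)) differentiable at 0"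
    using assms by (auto simp: Ck_on_def)
  then show ?thesis
    by (simp add: dir_deriv_def DERIV_deriv_iff_real_differentiable)
qed

lemma Ck_on_DERIV_line:
  assumes "Ck_on t S f" "set bs \<subseteq> Basis" "length bs < t" "x + s *\<^sub>R b \<in> S" "b \<in> Basis"
  shows "((\<lambda>h. iter_deriv bs f (x + h *\<^sub>R b)) has_real_derivative iter_deriv (b # bs) f (x + s *\<^sub>R b)) (at s)"
proof -
  have "((\<lambda>h. iter_deriv bs f ((x + s *\<^sub>R b) + h *\<^sub>R b)) has_real_derivative iter_deriv (b # bs) f (x + s *\<^sub>R b)) (at 0)"
    by (rule Ck_on_DERIV[OF assms(1-4) assms(5)])
  then have "((\<lambda>h. iter_deriv bs f (x + (h + s) *\<^sub>R b)) has_real_derivative iter_deriv (b # bs) f (x + s *\<^sub>R b)) (at 0)"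
    by (simp add: algebra_simps)
  then show ?thesis
    by (subst (asm) DERIV_shift[symmetric]) simp
qed

text \<open>Both signs of \<open>h\<close> are treated together because the increment
  \<open>v \<bullet> b\<close> of a coordinate has no fixed sign.\<close>

lemma MVT_interval_zero:
  fixes p :: "real \<Rightarrow> real"
  assumes "\<And>s. \<bar>s\<bar> \<le> \<bar>h\<bar> \<Longrightarrow> (p has_real_derivative p' s) (at s)"
  shows "\<exists>s. \<bar>s\<bar> \<le> \<bar>h\<bar> \<and> p h - p 0 = h * p' s"
proof (cases "h = 0")
  case False
  have "\<exists>z. (if 0 < h then 0 < z \<and> z < h else h < z \<and> z < 0) \<and> p h - p 0 = h * p' z"
  proof (cases "0 < h")
    case True
    then show ?thesis using MVT2[of 0 h p p'] assms by auto
  next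
    case False
    then have "h < 0" using \<open>h \<noteq> 0\<close> by simp
    then obtain z where "h < z" "z < 0" "p 0 - p h = (0 - h) * p' z" using MVT2[of h 0 p p'] assms by auto
    then show ?thesis using False by (intro exI[of _ z]) (auto simp: algebra_simps)
  qed
  then obtain z where "if 0 < h then 0 < z \<and> z < h else h < z \<and> z < 0" "p h - p 0 = h * p' z" by blast
  then show ?thesis by (intro exI[of _ z]) (auto split: if_splits)
qed auto

text \<open>\<open>Ck_on\<close> only speaks of partial derivatives, but Taylor's formula is needed
  along arbitrary directions. The increment is built up one coordinate at a time: each step costs,
  by the mean value theorem, a partial derivative at an intermediate point, which continuity
  compares with the one at \<open>x\<close>.\<close>

lemma has_derivative_continuous_partials:
  fixes f :: "'e::euclidean_space \<Rightarrow> real"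
  assumes S: "open S" "x \<in> S"
    and d: "\<And>y b. y \<in> S \<Longrightarrow> b \<in> Basis \<Longrightarrow> ((\<lambda>h. f (y + h *\<^sub>R b)) has_real_derivative g b y) (at 0)"
    and c: "\<And>b. b \<in> Basis \<Longrightarrow> continuous_on S (g b)"
  shows "(f has_derivative (\<lambda>v. \<Sum>b\<in>Basis. (v \<bullet> b) * g b x)) (at x)"
proof -
  \<comment> \<open>\<open>B\<close> is the set of coordinates already moved. The error
    \<open>e\<close> is shared equally between the earlier coordinates and the new one.\<close>
  have key: "\<exists>r>0. \<forall>v. norm v < r \<longrightarrow>
      \<bar>f (x + (\<Sum>b\<in>B. (v \<bullet> b) *\<^sub>R b)) - f x - (\<Sum>b\<in>B. (v \<bullet> b) * g b x)\<bar> \<le> e * norm v"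
    if "B \<subseteq> Basis" "0 < e" for B :: "'e set" and e :: real
    using finite_subset[OF that(1) finite_Basis] that
  proof (induction B arbitrary: e rule: finite_induct)
    case empty
    then show ?case by (intro exI[of _ 1]) auto
  next
    case (insert b B)
    then have b: "b \<in> Basis" by auto
    obtain r1 where r1: "0 < r1" "\<And>v. norm v < r1 \<Longrightarrow>
      \<bar>f (x + (\<Sum>b\<in>B. (v \<bullet> b) *\<^sub>R b)) - f x - (\<Sum>b\<in>B. (v \<bullet> b) * g b x)\<bar> \<le> e / 2 * norm v"
      using insert.IH[of "e/2"] insert.prems by auto
    have "continuous (at x) (g b)"
      using c[OF b] S continuous_on_eq_continuous_at by blast
    then obtain r2 where r2: "0 < r2" "\<And>y. dist y x < r2 \<Longrightarrow> \<bar>g b y - g b x\<bar> < e / 2"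
      unfolding continuous_at_eps_delta using insert.prems(2) by (metis dist_real_def half_gt_zero)
    obtain r3 where r3: "0 < r3" "ball x r3 \<subseteq> S" using S openE by blast
    \<comment> \<open>At most \<open>DIM('e)\<close> moved coordinates and the current one
      contribute at most \<open>norm v\<close> each to the distance from \<open>x\<close>.\<close>
    define D where "D = real DIM('e) + 1"
    have D: "D > 0" by (simp add: D_def)
    define r where "r = min r1 (min r2 r3 / D)"
    have "r > 0" using r1 r2 r3 D by (auto simp: r_def)
    show ?case
    proof (intro exI[of _ r] conjI allI impI)
      show "r > 0" by fact
      fix v :: 'e assume v: "norm v < r"
      define y where "y = x + (\<Sum>b\<in>B. (v \<bullet> b) *\<^sub>R b)"
      have near: "dist (y + s *\<^sub>R b) x < min r2 r3" if "\<bar>s\<bar> \<le> \<bar>v \<bullet> b\<bar>" for s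
      proof -
        have "dist (y + s *\<^sub>R b) x = norm ((\<Sum>b\<in>B. (v \<bullet> b) *\<^sub>R b) + s *\<^sub>R b)"
          by (simp add: y_def dist_norm algebra_simps)
        also have "\<dots> \<le> (\<Sum>b\<in>B. norm ((v \<bullet> b) *\<^sub>R b)) + norm (s *\<^sub>R b)"
          by (rule order_trans[OF norm_triangle_ineq add_right_mono[OF norm_sum]])
        also have "\<dots> \<le> (\<Sum>b\<in>B. norm v) + norm v"
        proof (intro add_mono sum_mono)
          show "norm ((v \<bullet> c) *\<^sub>R c) \<le> norm v" if "c \<in> B" for c
            using that insert.prems(1) by (auto simp: subset_iff Basis_le_norm)
          show "norm (s *\<^sub>R b) \<le> norm v"
            using that b Basis_le_norm[OF b, of v] by simp
        qed
        also have "\<dots> \<le> D * norm v"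
        proof -
          have "card B \<le> DIM('e)" using insert.prems(1) by (intro card_mono) auto
          then show ?thesis by (simp add: D_def algebra_simps mult_left_mono)
        qed
        also have "\<dots> < D * (min r2 r3 / D)" using v D by (intro mult_strict_left_mono) (auto simp: r_def)
        finally show ?thesis using D by simp
      qed
      have "\<exists>s. \<bar>s\<bar> \<le> \<bar>v \<bullet> b\<bar> \<and> f (y + (v \<bullet> b) *\<^sub>R b) - f (y + 0 *\<^sub>R b) = (v \<bullet> b) * g b (y + s *\<^sub>R b)"
      proof (rule MVT_interval_zero)
        fix s assume s: "\<bar>s\<bar> \<le> \<bar>v \<bullet> b\<bar>"
        have "y + s *\<^sub>R b \<in> S" using near[OF s] r3(2) by (auto simp: dist_commute)
        from d[OF this b] have "((\<lambda>h. f (y + (h + s) *\<^sub>R b)) has_real_derivative g b (y + s *\<^sub>R b)) (at 0)"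
          by (simp add: algebra_simps)
        then show "((\<lambda>h. f (y + h *\<^sub>R b)) has_real_derivative g b (y + s *\<^sub>R b)) (at s)"
          by (subst (asm) DERIV_shift[symmetric]) simp
      qed
      then obtain s where s: "\<bar>s\<bar> \<le> \<bar>v \<bullet> b\<bar>" "f (y + (v \<bullet> b) *\<^sub>R b) - f y = (v \<bullet> b) * g b (y + s *\<^sub>R b)"
        by auto
      have 1: "\<bar>(v \<bullet> b) * (g b (y + s *\<^sub>R b) - g b x)\<bar> \<le> norm v * (e / 2)"
        unfolding abs_mult using near[OF s(1)] r2(2)[of "y + s *\<^sub>R b"] b
        by (intro mult_mono) (auto simp: Basis_le_norm)
      have 2: "\<bar>f y - f x - (\<Sum>b\<in>B. (v \<bullet> b) * g b x)\<bar> \<le> e / 2 * norm v"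
        unfolding y_def using v by (intro r1(2)) (simp add: r_def)
      have eq: "f (x + (\<Sum>b\<in>insert b B. (v \<bullet> b) *\<^sub>R b)) - f x - (\<Sum>b\<in>insert b B. (v \<bullet> b) * g b x)
        = (f y - f x - (\<Sum>b\<in>B. (v \<bullet> b) * g b x)) + (v \<bullet> b) * (g b (y + s *\<^sub>R b) - g b x)"
        using insert.hyps s(2) by (simp add: y_def algebra_simps)
      show "\<bar>f (x + (\<Sum>b\<in>insert b B. (v \<bullet> b) *\<^sub>R b)) - f x - (\<Sum>b\<in>insert b B. (v \<bullet> b) * g b x)\<bar> \<le> e * norm v"
        unfolding eq by (rule order_trans[OF abs_triangle_ineq order_trans[OF add_mono[OF 2 1]]]) simp
    qed
  qed
  show ?thesis
    unfolding has_derivative_at_alt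
  proof (intro conjI allI impI)
    show "bounded_linear (\<lambda>v. \<Sum>b\<in>Basis. (v \<bullet> b) * g b x)"
      by (intro bounded_linear_sum bounded_linear_mult_left[THEN bounded_linear_compose] bounded_linear_inner_left)
    fix e :: real assume "0 < e"
    from key[OF order_refl this] obtain r where r: "0 < r" "\<And>v. norm v < r \<Longrightarrow>
      \<bar>f (x + (\<Sum>b\<in>Basis. (v \<bullet> b) *\<^sub>R b)) - f x - (\<Sum>b\<in>Basis. (v \<bullet> b) * g b x)\<bar> \<le> e * norm v"
      by auto
    show "\<exists>d>0. \<forall>y. norm (y - x) < d \<longrightarrow> norm (f y - f x - (\<Sum>b\<in>Basis. ((y - x) \<bullet> b) * g b x)) \<le> e * norm (y - x)"
    proof (intro exI[of _ r] conjI allI impI r)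
      fix y assume "norm (y - x) < r"
      from r(2)[OF this] show "norm (f y - f x - (\<Sum>b\<in>Basis. ((y - x) \<bullet> b) * g b x)) \<le> e * norm (y - x)"
        by (simp add: euclidean_representation)
    qed
  qed
qed

lemma Ck_on_has_derivative:
  assumes "Ck_on t S f" "open S" "set bs \<subseteq> Basis" "length bs < t" "x \<in> S"
  shows "(iter_deriv bs f has_derivative (\<lambda>v. \<Sum>b\<in>Basis. (v \<bullet> b) * iter_deriv (b # bs) f x)) (at x)"
  using assms by (intro has_derivative_continuous_partials[where S = S and g = "\<lambda>b. iter_deriv (b # bs) f"]
      Ck_on_DERIV Ck_onD_cont) auto

text \<open>The second difference along \<open>b\<close>, \<open>c\<close> is symmetric in \<open>b\<close>, \<open>c\<close>; both mixed partials are its limit.\<close>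

lemma second_difference:
  assumes C: "Ck_on t S f" and bs: "set bs \<subseteq> Basis" "length bs + 2 \<le> t"
    and bc: "b \<in> Basis" "c \<in> Basis" and h: "0 < h"
    and sub: "\<And>s u. 0 \<le> s \<Longrightarrow> s \<le> h \<Longrightarrow> 0 \<le> u \<Longrightarrow> u \<le> h \<Longrightarrow> x + s *\<^sub>R b + u *\<^sub>R c \<in> S"
  defines "g \<equiv> iter_deriv bs f"
  shows "\<exists>s u. 0 \<le> s \<and> s \<le> h \<and> 0 \<le> u \<and> u \<le> h \<and>
    g (x + h *\<^sub>R b + h *\<^sub>R c) - g (x + h *\<^sub>R b) - g (x + h *\<^sub>R c) + g x
      = h^2 * iter_deriv (c # b # bs) f (x + s *\<^sub>R b + u *\<^sub>R c)"
proof -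
  have 1: "((\<lambda>s. g (x + s *\<^sub>R b + u *\<^sub>R c)) has_real_derivative
      iter_deriv (b # bs) f (x + s *\<^sub>R b + u *\<^sub>R c)) (at s)"
    if "0 \<le> s" "s \<le> h" "0 \<le> u" "u \<le> h" for s u
    using Ck_on_DERIV_line[OF C bs(1) _ _ bc(1), where x = "x + u *\<^sub>R c" and s = s] bs(2) sub[of s u] that
    by (simp add: g_def algebra_simps)
  have 2: "((\<lambda>u. iter_deriv (b # bs) f (x + s *\<^sub>R b + u *\<^sub>R c)) has_real_derivative
      iter_deriv (c # b # bs) f (x + s *\<^sub>R b + u *\<^sub>R c)) (at u)"
    if "0 \<le> s" "s \<le> h" "0 \<le> u" "u \<le> h" for s u
    using Ck_on_DERIV_line[OF C _ _ _ bc(2), where x = "x + s *\<^sub>R b" and s = u and bs = "b # bs"] bs bc sub[of s u] that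
    by (simp add: g_def algebra_simps)
  \<comment> \<open>Mean value theorem in direction \<open>b\<close>, for the difference between the
    values at offsets \<open>h\<close> and 0 in direction \<open>c\<close>; the second application
    is in direction \<open>c\<close>.\<close>
  obtain s where s: "0 < s" "s < h"
    "(g (x + h *\<^sub>R b + h *\<^sub>R c) - g (x + h *\<^sub>R b + 0 *\<^sub>R c)) - (g (x + 0 *\<^sub>R b + h *\<^sub>R c) - g (x + 0 *\<^sub>R b + 0 *\<^sub>R c))
      = (h - 0) * (iter_deriv (b # bs) f (x + s *\<^sub>R b + h *\<^sub>R c) - iter_deriv (b # bs) f (x + s *\<^sub>R b + 0 *\<^sub>R c))"
    using MVT2[OF h, of "\<lambda>s. g (x + s *\<^sub>R b + h *\<^sub>R c) - g (x + s *\<^sub>R b + 0 *\<^sub>R c)"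
        "\<lambda>s. iter_deriv (b # bs) f (x + s *\<^sub>R b + h *\<^sub>R c) - iter_deriv (b # bs) f (x + s *\<^sub>R b + 0 *\<^sub>R c)"]
      DERIV_diff[OF 1 1] h by (auto simp del: iter_deriv.simps diff_zero scaleR_zero_left)
  obtain u where u: "0 < u" "u < h"
    "iter_deriv (b # bs) f (x + s *\<^sub>R b + h *\<^sub>R c) - iter_deriv (b # bs) f (x + s *\<^sub>R b + 0 *\<^sub>R c)
      = (h - 0) * iter_deriv (c # b # bs) f (x + s *\<^sub>R b + u *\<^sub>R c)"
    using MVT2[OF h, of "\<lambda>u. iter_deriv (b # bs) f (x + s *\<^sub>R b + u *\<^sub>R c)"
        "\<lambda>u. iter_deriv (c # b # bs) f (x + s *\<^sub>R b + u *\<^sub>R c)"] 2[of s] s by (auto simp del: iter_deriv.simps)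
  show ?thesis
    using s u by (intro exI[of _ s] exI[of _ u]) (simp add: power2_eq_square)
qed

lemma iter_deriv_swap:
  assumes C: "Ck_on t S f" and S: "open S" "x \<in> S" and bs: "set bs \<subseteq> Basis" "length bs + 2 \<le> t"
    and bc: "b \<in> Basis" "c \<in> Basis"
  shows "iter_deriv (b # c # bs) f x = iter_deriv (c # b # bs) f x"
proof -
  obtain r where r: "0 < r" "ball x r \<subseteq> S" using S openE by blast
  \<comment> \<open>Both second differences are the same number, so the two mixed partials agree at
    points arbitrarily near \<open>x\<close>; continuity carries this over to \<open>x\<close>
    itself.\<close>
  have approx: "\<exists>y z. dist y x < e \<and> dist z x < e \<and> iter_deriv (b # c # bs) f y = iter_deriv (c # b # bs) f z"
    if "0 < e" for e
  proof -
    define h where "h = min e r / 4"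
    have h: "0 < h" "h < e / 2" "h < r / 2" using that r by (auto simp: h_def)
    have near: "dist (x + s *\<^sub>R b' + u *\<^sub>R c') x < min e r"
      if "0 \<le> s" "s \<le> h" "0 \<le> u" "u \<le> h" "b' \<in> Basis" "c' \<in> Basis" for s u b' c'
    proof -
      have "dist (x + s *\<^sub>R b' + u *\<^sub>R c') x = norm (s *\<^sub>R b' + u *\<^sub>R c')" by (simp add: dist_norm algebra_simps)
      also have "\<dots> \<le> s + u" using that by (intro order_trans[OF norm_triangle_ineq]) auto
      finally show ?thesis using that h by auto
    qed
    have S': "x + s *\<^sub>R b' + u *\<^sub>R c' \<in> S"
      if "0 \<le> s" "s \<le> h" "0 \<le> u" "u \<le> h" "b' \<in> Basis" "c' \<in> Basis" for s u b' c'
      using near[OF that] r by (auto simp: dist_commute)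
    let ?g = "iter_deriv bs f"
    obtain s u where su: "0 \<le> s" "s \<le> h" "0 \<le> u" "u \<le> h"
      and eq1: "?g (x + h *\<^sub>R b + h *\<^sub>R c) - ?g (x + h *\<^sub>R b) - ?g (x + h *\<^sub>R c) + ?g x
        = h^2 * iter_deriv (c # b # bs) f (x + s *\<^sub>R b + u *\<^sub>R c)"
      using second_difference[OF C bs bc h(1) S'] bc by blast
    obtain s' u' where su': "0 \<le> s'" "s' \<le> h" "0 \<le> u'" "u' \<le> h"
      and eq2: "?g (x + h *\<^sub>R c + h *\<^sub>R b) - ?g (x + h *\<^sub>R c) - ?g (x + h *\<^sub>R b) + ?g x
        = h^2 * iter_deriv (b # c # bs) f (x + s' *\<^sub>R c + u' *\<^sub>R b)"
      using second_difference[OF C bs bc(2,1) h(1) S'] bc by blast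
    have eq: "h^2 * iter_deriv (c # b # bs) f (x + s *\<^sub>R b + u *\<^sub>R c)
        = h^2 * iter_deriv (b # c # bs) f (x + s' *\<^sub>R c + u' *\<^sub>R b)"
      unfolding eq1[symmetric] eq2[symmetric] by (simp add: add_ac)
    show ?thesis
      using near[OF su(1-4) bc] near[OF su' bc(2,1)] eq h(1)
      by (intro exI[of _ "x + s' *\<^sub>R c + u' *\<^sub>R b"] exI[of _ "x + s *\<^sub>R b + u *\<^sub>R c"]) (auto simp del: iter_deriv.simps)
  qed
  have cont: "continuous (at x) (iter_deriv ds f)" if "set ds \<subseteq> Basis" "length ds \<le> t" for ds
    using Ck_onD_cont[OF C that] S continuous_on_eq_continuous_at by blast
  show ?thesis
  proof (rule ccontr)
    assume ne: "iter_deriv (b # c # bs) f x \<noteq> iter_deriv (c # b # bs) f x"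
    define \<epsilon> where "\<epsilon> = \<bar>iter_deriv (b # c # bs) f x - iter_deriv (c # b # bs) f x\<bar> / 2"
    have "\<epsilon> > 0" using ne by (simp add: \<epsilon>_def)
    obtain e1 where e1: "e1 > 0" "\<And>y. dist y x < e1 \<Longrightarrow> \<bar>iter_deriv (b # c # bs) f y - iter_deriv (b # c # bs) f x\<bar> < \<epsilon>"
      using cont[of "b # c # bs"] bs bc \<open>\<epsilon> > 0\<close> unfolding continuous_at_eps_delta dist_real_def
      by (auto simp del: iter_deriv.simps)
    obtain e2 where e2: "e2 > 0" "\<And>y. dist y x < e2 \<Longrightarrow> \<bar>iter_deriv (c # b # bs) f y - iter_deriv (c # b # bs) f x\<bar> < \<epsilon>"
      using cont[of "c # b # bs"] bs bc \<open>\<epsilon> > 0\<close> unfolding continuous_at_eps_delta dist_real_def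
      by (auto simp del: iter_deriv.simps)
    obtain y z where yz: "dist y x < min e1 e2" "dist z x < min e1 e2" "iter_deriv (b # c # bs) f y = iter_deriv (c # b # bs) f z"
      using approx[of "min e1 e2"] e1 e2 by auto
    then show False using e1(2)[of y] e2(2)[of z] by (simp add: \<epsilon>_def del: iter_deriv.simps) argo
  qed
qed

section \<open>Reordering iterated partial derivatives\<close>

lemma dir_deriv_cong:
  assumes "open S" "x \<in> S" "\<And>y. y \<in> S \<Longrightarrow> f y = g y"
  shows "dir_deriv b f x = dir_deriv b g x"
proof -
  have "\<forall>\<^sub>F h in nhds 0. x + h *\<^sub>R b \<in> S"
  proof -
    have "((\<lambda>h. x + h *\<^sub>R b) \<longlongrightarrow> x + 0 *\<^sub>R b) (nhds 0)"
      by (intro tendsto_intros) (simp add: filterlim_ident)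
    then show ?thesis using assms topological_tendstoD by fastforce
  qed
  then have "\<forall>\<^sub>F h in nhds 0. f (x + h *\<^sub>R b) = g (x + h *\<^sub>R b)"
    by eventually_elim (use assms in auto)
  then show ?thesis unfolding dir_deriv_def by (intro deriv_cong_ev) auto
qed

text \<open>Swaps take place underneath outer derivatives, which is why equality is propagated on
  all of the open set \<open>S\<close> and not at a single point.\<close>

lemma iter_deriv_bubble:
  assumes C: "Ck_on t S f" and S: "open S"
  shows "set (as @ b # bs) \<subseteq> Basis \<Longrightarrow> length (as @ b # bs) \<le> t \<Longrightarrow> x \<in> S \<Longrightarrow>
    iter_deriv (as @ b # bs) f x = iter_deriv (b # as @ bs) f x"
proof (induction as arbitrary: x)
  case (Cons a as)
  have "iter_deriv ((a # as) @ b # bs) f x = dir_deriv a (iter_deriv (as @ b # bs) f) x" by simp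
  also have "\<dots> = dir_deriv a (iter_deriv (b # as @ bs) f) x"
    using Cons by (intro dir_deriv_cong[OF S]) auto
  also have "\<dots> = iter_deriv (a # b # as @ bs) f x" by simp
  also have "\<dots> = iter_deriv (b # a # as @ bs) f x"
    using Cons.prems by (intro iter_deriv_swap[OF C S]) auto
  finally show ?case by simp
qed auto

lemma iter_deriv_perm:
  assumes C: "Ck_on t S f" and S: "open S"
  shows "mset as = mset bs \<Longrightarrow> set as \<subseteq> Basis \<Longrightarrow> length as \<le> t \<Longrightarrow> x \<in> S \<Longrightarrow>
    iter_deriv as f x = iter_deriv bs f x"
proof (induction as arbitrary: bs x)
  case (Cons a as)
  have "a \<in> set bs" by (metis Cons.prems(1) list.set_intros(1) set_mset_mset)
  then obtain us vs where bs: "bs = us @ a # vs" by (meson split_list)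
  have eq: "mset as = mset (us @ vs)" using Cons.prems(1) by (simp add: bs)
  have bs': "set bs \<subseteq> Basis" "length bs \<le> t"
    using Cons.prems by (metis set_mset_mset, metis size_mset)
  have "iter_deriv (a # as) f x = dir_deriv a (iter_deriv as f) x" by simp
  also have "\<dots> = dir_deriv a (iter_deriv (us @ vs) f) x"
    using Cons eq by (intro dir_deriv_cong[OF S]) auto
  also have "\<dots> = iter_deriv (us @ a # vs) f x"
    using iter_deriv_bubble[OF C S, of us a vs x] bs' Cons.prems(4) by (simp add: bs)
  finally show ?case by (simp add: bs)
qed auto

text \<open>\<open>cond_Deriv\<close> bounds only \<open>multi_deriv\<close>, in which the
  directions are sorted, whereas \<open>line_deriv\<close> sums over directions in every order. The
  multi-index counts how often each axis occurs in \<open>bs\<close>.\<close>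

lemma iter_deriv_eq_multi_deriv:
  fixes f :: "'d::{finite,linorder} rvec \<Rightarrow> real"
  assumes C: "Ck_on t S f" and S: "open S" "x \<in> S" and bs: "set bs \<subseteq> Basis" "length bs \<le> t"
  shows "\<exists>a. (\<Sum>j\<in>UNIV. a j) = length bs \<and> iter_deriv bs f x = multi_deriv a f x"
proof -
  define a :: "'d \<Rightarrow> nat" where "a j = count (mset bs) (axis j 1)" for j
  let ?l = "concat (map (\<lambda>j. replicate (a j) (axis j 1)) (sorted_list_of_set UNIV)) :: 'd rvec list"
  have "mset ?l = (\<Sum>j\<in>UNIV. replicate_mset (a j) (axis j 1))"
    by (simp add: mset_concat o_def sum_list_distinct_conv_sum_set flip: sum.distinct_set_conv_list)
  also have "\<dots> = mset bs"
  proof (rule multiset_eqI)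
    fix v :: "'d rvec"
    have *: "count (\<Sum>j\<in>UNIV. replicate_mset (a j) (axis j 1)) v = (\<Sum>j\<in>UNIV. if v = axis j 1 then a j else 0)"
      by (simp add: count_sum)
    show "count (\<Sum>j\<in>UNIV. replicate_mset (a j) (axis j 1)) v = count (mset bs) v"
    proof (cases "v \<in> Basis")
      case True
      then obtain i where "v = axis i 1" by (auto simp: Basis_vec_def)
      then show ?thesis unfolding * by (simp add: axis_eq_axis a_def)
    next
      case False
      then have "v \<noteq> axis j 1" for j by auto
      moreover have "count (mset bs) v = 0" using False bs by (auto simp: count_eq_zero_iff)
      ultimately show ?thesis unfolding * by simp
    qed
  qed
  finally have m: "mset ?l = mset bs" .
  have "length bs = size (mset ?l)" unfolding m by simp
  also have "\<dots> = (\<Sum>j\<in>UNIV. a j)"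
    by (simp add: length_concat o_def sum_list_distinct_conv_sum_set)
  finally show ?thesis
    using iter_deriv_perm[OF C S(1) m[symmetric] bs S(2)] by (intro exI[of _ a]) (simp add: multi_deriv_def)
qed

text \<open>The \<open>m\<close>-th derivative of \<open>s \<mapsto> f (x + s *\<^sub>R v)\<close>
  at 0, for smooth \<open>f\<close>. Summing over ordered lists instead of multi-indices avoids
  multinomial coefficients, and one more differentiation just prepends a basis vector.\<close>

definition line_deriv :: "nat \<Rightarrow> ('e::euclidean_space \<Rightarrow> real) \<Rightarrow> 'e \<Rightarrow> 'e \<Rightarrow> real" where
  "line_deriv m f x v = (\<Sum>bs | set bs \<subseteq> Basis \<and> length bs = m. (\<Prod>b\<leftarrow>bs. v \<bullet> b) * iter_deriv bs f x)"

lemma sum_lists_Suc: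
  assumes "finite B"
  shows "(\<Sum>bs | set bs \<subseteq> B \<and> length bs = Suc m. F bs) = (\<Sum>b\<in>B. \<Sum>bs | set bs \<subseteq> B \<and> length bs = m. F (b # bs))"
proof -
  have "{bs. set bs \<subseteq> B \<and> length bs = Suc m} = (\<lambda>(b, bs). b # bs) ` (B \<times> {bs. set bs \<subseteq> B \<and> length bs = m})"
    by (auto simp: length_Suc_conv image_iff)
  moreover have "inj_on (\<lambda>(b, bs). b # bs) (B \<times> {bs. set bs \<subseteq> B \<and> length bs = m})" by (auto simp: inj_on_def)
  ultimately show ?thesis
    by (simp add: sum.reindex sum.cartesian_product split_def)
qed

lemma sum_lists_0: "(\<Sum>bs | set bs \<subseteq> B \<and> length bs = 0. F bs) = F []"
proof -
  have "{bs. set bs \<subseteq> B \<and> length bs = 0} = {[]}" by auto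
  then show ?thesis by simp
qed

lemma line_deriv_0 [simp]: "line_deriv 0 f x v = f x"
  by (simp add: line_deriv_def sum_lists_0 del: length_0_conv)

lemma line_deriv_DERIV:
  assumes C: "Ck_on t S f" and S: "open S" "x + s *\<^sub>R v \<in> S" and m: "m < t"
  shows "((\<lambda>s. line_deriv m f (x + s *\<^sub>R v) v) has_real_derivative line_deriv (Suc m) f (x + s *\<^sub>R v) v) (at s)"
proof -
  have fin: "finite {bs. set bs \<subseteq> (Basis :: 'a set) \<and> length bs = m}" by (simp add: finite_lists_length_eq)
  have *: "((\<lambda>s. iter_deriv bs f (x + s *\<^sub>R v)) has_real_derivative
      (\<Sum>b\<in>Basis. (v \<bullet> b) * iter_deriv (b # bs) f (x + s *\<^sub>R v))) (at s)"
    if "set bs \<subseteq> Basis" "length bs = m" for bs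
  proof -
    have "((\<lambda>s. iter_deriv bs f (x + s *\<^sub>R v)) has_derivative
      (\<lambda>h. \<Sum>b\<in>Basis. ((h *\<^sub>R v) \<bullet> b) * iter_deriv (b # bs) f (x + s *\<^sub>R v))) (at s)"
      using that m
      by (intro has_derivative_compose[where f = "\<lambda>s. x + s *\<^sub>R v" and g = "iter_deriv bs f"]
          Ck_on_has_derivative[OF C S(1) that(1) _ S(2)]) (auto intro!: derivative_eq_intros)
    then show ?thesis
      unfolding has_field_derivative_def by (rule has_derivative_eq_rhs) (simp add: fun_eq_iff sum_distrib_left mult_ac)
  qed
  have "((\<lambda>s. line_deriv m f (x + s *\<^sub>R v) v) has_real_derivative
      (\<Sum>bs | set bs \<subseteq> Basis \<and> length bs = m. (\<Prod>b\<leftarrow>bs. v \<bullet> b) * (\<Sum>b\<in>Basis. (v \<bullet> b) * iter_deriv (b # bs) f (x + s *\<^sub>R v)))) (at s)"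
    unfolding line_deriv_def using fin by (intro DERIV_sum DERIV_cmult *) auto
  also have "(\<Sum>bs | set bs \<subseteq> Basis \<and> length bs = m. (\<Prod>b\<leftarrow>bs. v \<bullet> b) * (\<Sum>b\<in>Basis. (v \<bullet> b) * iter_deriv (b # bs) f (x + s *\<^sub>R v)))
     = line_deriv (Suc m) f (x + s *\<^sub>R v) v"
    unfolding line_deriv_def sum_lists_Suc[OF finite_Basis] sum_distrib_left
    by (subst sum.swap) (simp add: mult_ac)
  finally show ?thesis .
qed

lemma Taylor_line:
  assumes C: "Ck_on t S f" and S: "open S" "\<And>s. 0 \<le> s \<Longrightarrow> s \<le> 1 \<Longrightarrow> x + s *\<^sub>R v \<in> S" and t: "0 < t"
  shows "\<exists>s. 0 < s \<and> s < 1 \<and> f (x + v) = (\<Sum>m<t. line_deriv m f x v / fact m) + line_deriv t f (x + s *\<^sub>R v) v / fact t"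
proof -
  have "\<exists>s>0. s < 1 \<and> f (x + 1 *\<^sub>R v) = (\<Sum>m<t. line_deriv m f (x + 0 *\<^sub>R v) v / fact m * 1 ^ m) + line_deriv t f (x + s *\<^sub>R v) v / fact t * 1 ^ t"
    by (rule Maclaurin[where diff = "\<lambda>m s. line_deriv m f (x + s *\<^sub>R v) v" and h = 1])
      (use t line_deriv_DERIV[OF C S(1)] S(2) in auto)
  then show ?thesis by auto
qed

text \<open>There are \<open>DIM('e) ^ m\<close> lists, each with a coefficient of size at most
  \<open>norm v ^ m\<close>.\<close>

lemma line_deriv_bound:
  fixes f :: "'e::euclidean_space \<Rightarrow> real"
  assumes "\<And>bs. set bs \<subseteq> Basis \<Longrightarrow> length bs = m \<Longrightarrow> \<bar>iter_deriv bs f x\<bar> \<le> B"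
  shows "\<bar>line_deriv m f x v\<bar> \<le> B * (real DIM('e) * norm v) ^ m"
proof -
  have fin: "finite {bs. set bs \<subseteq> (Basis :: 'e set) \<and> length bs = m}" by (simp add: finite_lists_length_eq)
  have p: "\<bar>\<Prod>b\<leftarrow>bs. v \<bullet> b\<bar> \<le> norm v ^ length bs" if "set bs \<subseteq> Basis" for bs
    using that
  proof (induction bs)
    case (Cons b bs)
    have "\<bar>v \<bullet> b\<bar> \<le> norm v" using Cons.prems by (intro Basis_le_norm) auto
    then show ?case using Cons by (auto simp: abs_mult intro!: mult_mono)
  qed auto
  have "\<bar>line_deriv m f x v\<bar> \<le> (\<Sum>bs | set bs \<subseteq> (Basis :: 'e set) \<and> length bs = m. norm v ^ m * B)"
    unfolding line_deriv_def using p assms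
    by (intro order_trans[OF sum_abs] sum_mono) (force simp: abs_mult intro!: mult_mono)
  also have "\<dots> = B * (real DIM('e) * norm v) ^ m"
    by (simp add: card_lists_length_eq power_mult_distrib)
  finally show ?thesis .
qed

lemma line_deriv_2: "line_deriv 2 f x v = v \<bullet> hess f x v"
  unfolding line_deriv_def numeral_2_eq_2 sum_lists_Suc[OF finite_Basis] sum_lists_0 hess_def
  by (simp add: inner_sum_right sum_distrib_left mult_ac)

lemma hess_inner_Basis:
  assumes "b \<in> Basis" "c \<in> Basis"
  shows "hess f x c \<bullet> b = iter_deriv [b, c] f x"
proof -
  have "hess f x c \<bullet> b = (\<Sum>b'\<in>Basis. if b' = b then \<Sum>c'\<in>Basis. (c \<bullet> c') * iter_deriv [b', c'] f x else 0)"
    unfolding hess_def inner_sum_left by (intro sum.cong) (auto simp: inner_Basis assms)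
  also have "\<dots> = (\<Sum>c'\<in>Basis. (c \<bullet> c') * iter_deriv [b, c'] f x)" using assms by simp
  also have "\<dots> = (\<Sum>c'\<in>Basis. if c' = c then iter_deriv [b, c'] f x else 0)"
    by (intro sum.cong) (auto simp: inner_Basis assms)
  also have "\<dots> = iter_deriv [b, c] f x" using assms by simp
  finally show ?thesis .
qed

lemma line_deriv_1_local_max:
  assumes C: "Ck_on t S f" "1 \<le> t" and S: "open S" "x \<in> S" and max: "\<And>y. y \<in> S \<Longrightarrow> f y \<le> f x"
  shows "line_deriv 1 f x v = 0"
proof -
  have d: "((\<lambda>s. line_deriv 0 f (x + s *\<^sub>R v) v) has_real_derivative line_deriv (Suc 0) f (x + 0 *\<^sub>R v) v) (at 0)"
    using C(2) S by (intro line_deriv_DERIV[OF C(1)]) auto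
  obtain e where e: "0 < e" "ball x e \<subseteq> S" using S openE by blast
  show ?thesis
  proof (rule DERIV_local_max)
    show "((\<lambda>s. f (x + s *\<^sub>R v)) has_real_derivative line_deriv 1 f x v) (at 0)" using d by simp
    \<comment> \<open>The summand 1 keeps the radius meaningful for \<open>v = 0\<close>.\<close>
    show "0 < e / (norm v + 1)" using e by (simp add: add_nonneg_pos)
    show "\<forall>s. \<bar>0 - s\<bar> < e / (norm v + 1) \<longrightarrow> f (x + s *\<^sub>R v) \<le> f (x + 0 *\<^sub>R v)"
    proof (intro allI impI)
      fix s assume s: "\<bar>0 - s\<bar> < e / (norm v + 1)"
      have "\<bar>s\<bar> * norm v \<le> \<bar>s\<bar> * (norm v + 1)" by (intro mult_left_mono) auto
      also have "\<dots> < e" using s by (simp add: pos_less_divide_eq add_nonneg_pos)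
      finally have "x + s *\<^sub>R v \<in> S" using e(2) by (auto simp: dist_norm)
      then show "f (x + s *\<^sub>R v) \<le> f (x + 0 *\<^sub>R v)" using max by simp
    qed
  qed
qed

section \<open>Eigenvalues and the Cholesky factor\<close>

text \<open>A minimiser of the quadratic form on the unit sphere of \<open>W\<close> exists by
  compactness, and minimality forces it to be an eigenvector. The version for invariant subspaces
  serves both the least eigenvalue and the proof that eigenvectors span.\<close>

lemma eigenvector_min_on_subspace:
  fixes A :: "'e::euclidean_space \<Rightarrow> 'e"
  assumes A: "linear A" "\<And>v w. A v \<bullet> w = v \<bullet> A w"
    and W: "subspace W" "\<And>v. v \<in> W \<Longrightarrow> A v \<in> W" "x \<in> W" "x \<noteq> 0"
  shows "\<exists>v m. v \<in> W \<and> norm v = 1 \<and> A v = m *\<^sub>R v \<and> (\<forall>w\<in>W. m * (norm w)\<^sup>2 \<le> w \<bullet> A w)"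
proof -
  interpret A: linear A by fact
  have cont: "continuous_on S (\<lambda>v. v \<bullet> A v)" for S
    by (intro continuous_intros linear_continuous_on) (simp add: A linear_conv_bounded_linear[symmetric])
  have K: "compact (sphere 0 1 \<inter> W)" using W(1) by (intro compact_Int_closed closed_subspace) auto
  have "x /\<^sub>R norm x \<in> sphere 0 1 \<inter> W" using W by (auto simp: subspace_def)
  then obtain v where v: "v \<in> W" "norm v = 1" "\<And>w. w \<in> W \<Longrightarrow> norm w = 1 \<Longrightarrow> v \<bullet> A v \<le> w \<bullet> A w"
    using continuous_attains_inf[OF K _ cont] by fastforce
  define m where "m = v \<bullet> A v"
  have min: "m * (norm w)\<^sup>2 \<le> w \<bullet> A w" if "w \<in> W" for w
  proof (cases "w = 0")
    case False
    have "m \<le> (w /\<^sub>R norm w) \<bullet> A (w /\<^sub>R norm w)" unfolding m_def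
      using that False W(1) by (intro v) (auto simp: subspace_def)
    then show ?thesis using False by (simp add: A.scaleR field_simps power2_eq_square)
  qed auto
  have "A v - m *\<^sub>R v = 0"
  proof -
    define p where "p = A v - m *\<^sub>R v"
    define s where "s = p \<bullet> A p - m * (norm p)\<^sup>2"
    have pW: "p \<in> W" unfolding p_def using W v by (simp add: subspace_diff subspace_scale)
    have vv: "v \<bullet> v = 1" using v(2) by (simp add: dot_square_norm)
    \<comment> \<open>Minimality along \<open>v + t *\<^sub>R p\<close>. The linear coefficient is
      \<open>2 * (p \<bullet> p)\<close>, so a small negative \<open>t\<close> gives a contradiction
      unless the residual \<open>p\<close> vanishes.\<close>
    have *: "0 \<le> 2 * t * (p \<bullet> p) + t\<^sup>2 * s" for t
    proof -
      have "v + t *\<^sub>R p \<in> W" using W(1) v(1) pW by (simp add: subspace_add subspace_scale)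
      from min[OF this] have "0 \<le> (v + t *\<^sub>R p) \<bullet> A (v + t *\<^sub>R p) - m * ((v + t *\<^sub>R p) \<bullet> (v + t *\<^sub>R p))"
        by (simp add: dot_square_norm)
      also have "\<dots> = 2 * t * (p \<bullet> A v - m * (p \<bullet> v)) + t\<^sup>2 * (p \<bullet> A p - m * (p \<bullet> p))"
        using A(2)[of v p] vv by (simp add: A.add A.scaleR inner_simps inner_commute power2_eq_square m_def[symmetric] algebra_simps)
      also have "p \<bullet> A v - m * (p \<bullet> v) = p \<bullet> p" by (simp add: p_def inner_simps)
      finally show ?thesis by (simp add: s_def dot_square_norm)
    qed
    have "p \<bullet> p \<le> 0"
    proof (rule ccontr)
      assume "\<not> p \<bullet> p \<le> 0"
      then have pp: "p \<bullet> p > 0" by linarith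
      \<comment> \<open>The denominator makes the quadratic term at most half as large as the linear
        one.\<close>
      define t where "t = - (p \<bullet> p) / (\<bar>s\<bar> + 1)"
      have t: "t < 0" using pp by (simp add: t_def divide_neg_pos del: inner_gt_zero_iff)
      have "t\<^sup>2 * s \<le> t\<^sup>2 * (\<bar>s\<bar> + 1)" by (intro mult_left_mono) auto
      also have "\<dots> = - t * (p \<bullet> p)" by (simp add: t_def power2_eq_square)
      finally have "0 \<le> t * (p \<bullet> p)" using *[of t] by simp
      then show False using t pp by (metis mult_neg_pos not_le)
    qed
    then have "p = 0" by (metis inner_eq_zero_iff inner_ge_zero order_antisym)
    then show ?thesis by (simp add: p_def)
  qed
  then show ?thesis using v min by (intro exI[of _ v] exI[of _ m]) auto
qed

lemma eigenvectors_orthogonal: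
  fixes A :: "'e::euclidean_space \<Rightarrow> 'e"
  assumes "\<And>v w. A v \<bullet> w = v \<bullet> A w" "A v = l *\<^sub>R v" "A w = m *\<^sub>R w" "l \<noteq> m"
  shows "v \<bullet> w = 0"
proof -
  have "l * (v \<bullet> w) = m * (v \<bullet> w)" using assms(1)[of v w] assms(2,3) by simp
  then show ?thesis using assms(4) by simp
qed

text \<open>Turns the eigenvalue bound of \<open>cond_Hess_u\<close> into a bound for the quadratic
  form. The maximum in \<open>ord_eigenval\<close> runs over eigenvalues \<open>l\<close> for which
  the eigenspaces at or above \<open>l\<close> have total dimension at least \<open>DIM('e)\<close>.
  No \<open>l\<close> above the least eigenvalue \<open>m\<close> qualifies, since the eigenvector
  \<open>v0\<close> of \<open>m\<close> is orthogonal to all those eigenspaces.\<close>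

lemma ord_eigenval_DIM_lower_bound:
  fixes A :: "'e::euclidean_space \<Rightarrow> 'e"
  assumes A: "linear A" "\<And>v w. A v \<bullet> w = v \<bullet> A w"
    and c: "c \<le> ord_eigenval DIM('e) A"
  shows "c * (norm w)\<^sup>2 \<le> w \<bullet> A w"
proof -
  interpret A: linear A by fact
  define E where "E \<mu> = {v. A v = \<mu> *\<^sub>R v}" for \<mu>
  have subE: "subspace (E \<mu>)" for \<mu>
    by (auto simp: E_def subspace_def A.add A.scaleR A.zero algebra_simps)
  obtain x :: 'e where x: "x \<noteq> 0" using nonzero_Basis SOME_Basis by blast
  obtain v0 m where v0: "norm v0 = 1" "A v0 = m *\<^sub>R v0" and m: "\<And>w. m * (norm w)\<^sup>2 \<le> w \<bullet> A w"
    using eigenvector_min_on_subspace[OF A, of UNIV x] x by auto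
  have "\<exists>B. B \<subseteq> E \<mu> \<and> pairwise orthogonal B \<and> (\<forall>x\<in>B. norm x = 1) \<and> independent B \<and> card B = dim (E \<mu>) \<and> span B = E \<mu>" for \<mu>
    using orthonormal_basis_subspace[OF subE[of \<mu>]] by (metis (no_types))
  then obtain B where B: "\<And>\<mu>. B \<mu> \<subseteq> E \<mu>" "\<And>\<mu>. pairwise orthogonal (B \<mu>)" "\<And>\<mu> x. x \<in> B \<mu> \<Longrightarrow> norm x = 1"
    "\<And>\<mu>. independent (B \<mu>)" "\<And>\<mu>. card (B \<mu>) = dim (E \<mu>)" "\<And>\<mu>. span (B \<mu>) = E \<mu>"
    by metis
  have orth: "orthogonal x y" if "x \<in> E \<mu>" "y \<in> E \<nu>" "\<mu> \<noteq> \<nu>" for x y \<mu> \<nu>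
    using eigenvectors_orthogonal[OF A(2), of x \<mu> y \<nu>] that by (simp add: E_def orthogonal_def)
  have pwU: "pairwise orthogonal (\<Union>\<mu>\<in>M. B \<mu>)" for M
  proof (rule pairwiseI)
    fix x y assume "x \<in> (\<Union>\<mu>\<in>M. B \<mu>)" "y \<in> (\<Union>\<mu>\<in>M. B \<mu>)" "x \<noteq> y"
    then obtain \<mu> \<nu> where xy: "x \<in> B \<mu>" "y \<in> B \<nu>" by auto
    show "orthogonal x y"
    proof (cases "\<mu> = \<nu>")
      case True
      then show ?thesis using xy B(2)[of \<mu>] \<open>x \<noteq> y\<close> by (auto simp: pairwise_def)
    next
      case False
      then show ?thesis using orth xy B(1) by blast
    qed
  qed
  have finB: "finite (B \<mu>)" for \<mu> using B(4) independent_imp_finite by blast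
  define ev where "ev = eigenvals A"
  have evE: "\<mu> \<in> ev \<longleftrightarrow> (\<exists>v\<in>E \<mu>. v \<noteq> 0)" for \<mu> by (auto simp: ev_def eigenvals_def E_def)
  \<comment> \<open>One eigenvector per eigenvalue gives an orthogonal, hence finite, family.
    Without finiteness the \<open>Max\<close> and the sum in \<open>ord_eigenval\<close> would carry
    no information.\<close>
  have finev: "finite ev"
  proof -
    have "\<exists>v. v \<in> E \<mu> \<and> v \<noteq> 0" if "\<mu> \<in> ev" for \<mu> using that evE by auto
    then obtain f where f: "\<And>\<mu>. \<mu> \<in> ev \<Longrightarrow> f \<mu> \<in> E \<mu> \<and> f \<mu> \<noteq> 0" by metis
    have "pairwise orthogonal (f ` ev)"
      unfolding pairwise_def using f orth by blast
    then have "finite (f ` ev)" by (rule pairwise_orthogonal_imp_finite)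
    moreover have "inj_on f ev"
    proof (rule inj_onI)
      fix \<mu> \<nu> assume "\<mu> \<in> ev" "\<nu> \<in> ev" "f \<mu> = f \<nu>"
      then show "\<mu> = \<nu>" using f[of \<mu>] f[of \<nu>] by (auto simp: E_def)
    qed
    ultimately show ?thesis using finite_imageD by blast
  qed
  have m_ev: "m \<in> ev" unfolding evE using v0 by (intro bexI[of _ v0]) (auto simp: E_def)
  have m_le: "m \<le> \<mu>" if ev: "\<mu> \<in> ev" for \<mu>
  proof -
    obtain v where v: "v \<noteq> 0" "v \<in> E \<mu>" using ev evE[of \<mu>] by blast
    then have v: "v \<noteq> 0" "A v = \<mu> *\<^sub>R v" unfolding E_def by simp_all
    have "m * (norm v)\<^sup>2 \<le> \<mu> * (norm v)\<^sup>2" using m[of v] v(2) by (simp add: dot_square_norm)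
    then show ?thesis using v(1) by simp
  qed
  define U where "U = (\<Union>\<mu>\<in>ev. B \<mu>)"
  \<comment> \<open>Otherwise the orthogonal complement of the span is a nonzero invariant subspace
    and contains an eigenvector, which would lie in the span as well.\<close>
  have spU: "span U = UNIV"
  proof (rule ccontr)
    assume ne: "span U \<noteq> UNIV"
    define W where "W = {w. \<forall>u\<in>span U. u \<bullet> w = 0}"
    have "subspace W" by (auto simp: W_def subspace_def inner_simps)
    have "span U \<subset> span UNIV" using ne by auto
    then obtain y where y: "y \<noteq> 0" "\<And>u. u \<in> span U \<Longrightarrow> orthogonal y u"
      using orthogonal_to_subspace_exists_gen[of U UNIV] by metis
    then have "y \<in> W" by (auto simp: W_def orthogonal_def inner_commute)
    have EU: "E \<mu> \<subseteq> span U" if "\<mu> \<in> ev" for \<mu>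
      using B(6)[of \<mu>] that span_mono[of "B \<mu>" U] by (auto simp: U_def)
    have Ainv: "A u \<in> span U" if "u \<in> span U" for u
      using that
    proof (induction rule: span_induct_alt)
      case base
      then show ?case by (simp add: A.zero span_zero)
    next
      case (step c x y)
      obtain \<mu> where "\<mu> \<in> ev" "x \<in> B \<mu>" using step by (auto simp: U_def)
      then have "A x = \<mu> *\<^sub>R x" using B(1) by (auto simp: E_def)
      then show ?case using step by (simp add: A.add A.scaleR span_add span_scale span_base)
    qed
    have "A w \<in> W" if "w \<in> W" for w
      using that Ainv unfolding W_def by (simp flip: A(2))
    then obtain v l where v: "v \<in> W" "norm v = 1" "A v = l *\<^sub>R v"
      using eigenvector_min_on_subspace[OF A \<open>subspace W\<close> _ \<open>y \<in> W\<close> y(1)] by blast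
    have "v \<in> E l" "l \<in> ev" using v by (auto simp: E_def evE intro!: bexI[of _ v])
    then have "v \<in> span U" using EU by auto
    then have "v \<bullet> v = 0" using v(1) by (auto simp: W_def)
    then show False using v(2) by auto
  qed
  have fU: "finite U" unfolding U_def using finev finB by auto
  \<comment> \<open>Hence \<open>m\<close> itself belongs to the set whose maximum is taken, and
    this set is nonempty.\<close>
  have "DIM('e) \<le> card U"
    using dim_le_card[of UNIV U] spU fU by (auto simp: dim_UNIV)
  also have "\<dots> \<le> (\<Sum>\<mu>\<in>ev. dim (E \<mu>))"
    unfolding U_def B(5)[symmetric] using finev by (rule card_UN_le)
  also have "ev = {\<mu> \<in> ev. m \<le> \<mu>}" using m_le by auto
  finally have m_in: "m \<in> {l \<in> ev. DIM('e) \<le> (\<Sum>\<mu> | \<mu> \<in> ev \<and> l \<le> \<mu>. dim (E \<mu>))}" using m_ev by simp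
  have upper: "l \<le> m" if l: "l \<in> ev" "DIM('e) \<le> (\<Sum>\<mu> | \<mu> \<in> ev \<and> l \<le> \<mu>. dim (E \<mu>))" for l
  proof (rule ccontr)
    assume "\<not> l \<le> m"
    define T where "T = (\<Union>\<mu>\<in>{\<mu> \<in> ev. l \<le> \<mu>}. B \<mu>)"
    have v0T: "orthogonal v0 y" if y: "y \<in> T" for y
    proof -
      obtain \<mu> where "y \<in> B \<mu>" "l \<le> \<mu>" using y by (auto simp: T_def)
      then show ?thesis using B(1) v0(2) \<open>\<not> l \<le> m\<close> by (intro orth[of _ m _ \<mu>]) (auto simp: E_def)
    qed
    have pw: "pairwise orthogonal (insert v0 T)"
      using pwU[of "{\<mu> \<in> ev. l \<le> \<mu>}"] v0T by (auto simp: pairwise_insert T_def orthogonal_commute)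
    have "0 \<notin> insert v0 T" using v0(1) B(3) by (force simp: T_def)
    then have ind: "independent (insert v0 T)" using pairwise_orthogonal_independent[OF pw] by simp
    have fT: "finite T" unfolding T_def using finev finB by auto
    have "v0 \<notin> T" using v0T[of v0] v0(1) by (auto simp: orthogonal_def)
    have "card T = (\<Sum>\<mu> | \<mu> \<in> ev \<and> l \<le> \<mu>. card (B \<mu>))"
      unfolding T_def
    proof (rule card_UN_disjoint)
      show "\<forall>i\<in>{\<mu> \<in> ev. l \<le> \<mu>}. \<forall>j\<in>{\<mu> \<in> ev. l \<le> \<mu>}. i \<noteq> j \<longrightarrow> B i \<inter> B j = {}"
      proof (intro ballI impI equals0I)
        fix i j x assume "i \<noteq> j" "x \<in> B i \<inter> B j"
        then have "x \<bullet> x = 0" "norm x = 1" using orth[of x i x j] B(1,3) by (auto simp: orthogonal_def)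
        then show False by auto
      qed
    qed (use finev finB in auto)
    then have "DIM('e) < card (insert v0 T)"
      using l(2) fT \<open>v0 \<notin> T\<close> by (simp add: B(5))
    then show False using independent_bound[OF ind] by simp
  qed
  define X where "X = {l \<in> ev. DIM('e) \<le> (\<Sum>\<mu> | \<mu> \<in> ev \<and> l \<le> \<mu>. dim (E \<mu>))}"
  have "Max X \<in> X" using m_in finev unfolding X_def by (intro Max_in) auto
  then have "Max X \<le> m" using upper by (auto simp: X_def)
  then have "c \<le> m" using c by (simp add: ord_eigenval_def X_def ev_def E_def)
  then have "c * (norm w)\<^sup>2 \<le> m * (norm w)\<^sup>2" by (simp add: mult_right_mono)
  then show ?thesis using m[of w] by simp
qed

section \<open>The Hessian as a self-adjoint operator\<close>

lemma linear_hess: "linear (hess f x)"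
proof -
  have "hess f x = (\<lambda>v. \<Sum>b\<in>Basis. \<Sum>c\<in>Basis. (v \<bullet> c) *\<^sub>R (iter_deriv [b, c] f x *\<^sub>R b))"
    by (simp add: hess_def fun_eq_iff scaleR_left.sum)
  then show ?thesis
    by (simp add: linear_iff inner_simps scaleR_add_left sum.distrib scaleR_sum_right mult.assoc distrib_right)
qed

lemma hess_self_adjoint:
  assumes C: "Ck_on 2 S f" and S: "open S" "x \<in> S"
  shows "hess f x v \<bullet> w = v \<bullet> hess f x w"
proof -
  have "hess f x v \<bullet> w = (\<Sum>b\<in>Basis. \<Sum>c\<in>Basis. (v \<bullet> c) * (w \<bullet> b) * iter_deriv [b, c] f x)"
    unfolding hess_def inner_sum_left by (simp add: sum_distrib_left inner_commute mult_ac)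
  also have "\<dots> = (\<Sum>c\<in>Basis. \<Sum>b\<in>Basis. (v \<bullet> c) * (w \<bullet> b) * iter_deriv [b, c] f x)"
    by (rule sum.swap)
  also have "\<dots> = (\<Sum>c\<in>Basis. \<Sum>b\<in>Basis. (v \<bullet> c) * (w \<bullet> b) * iter_deriv [c, b] f x)"
    using iter_deriv_swap[OF C S, of "[]"] by (intro sum.cong) (auto simp del: iter_deriv.simps)
  also have "\<dots> = v \<bullet> hess f x w"
    by (simp add: hess_def inner_sum_right sum_distrib_left mult_ac)
  finally show ?thesis .
qed

text \<open>Outer-product elimination. The induction adds the smallest index \<open>b\<close>:
  column \<open>b\<close> of \<open>A\<close> divided by \<open>sqrt (A b b)\<close> becomes column
  \<open>b\<close> of the factor, and the induction hypothesis factors the Schur complement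
  \<open>A'\<close>. Functions restricted to a subset \<open>S\<close> of the index type replace
  matrices of varying size.\<close>

lemma cholesky_induct:
  fixes A :: "'d::{finite,linorder} \<Rightarrow> 'd \<Rightarrow> real"
  assumes "finite S" "\<And>i j. A i j = A j i"
    "\<And>x. (\<exists>i\<in>S. x i \<noteq> 0) \<Longrightarrow> 0 < (\<Sum>i\<in>S. \<Sum>j\<in>S. A i j * x i * x j)"
  shows "\<exists>L. (\<forall>i j. i < j \<longrightarrow> L i j = 0) \<and> (\<forall>i\<in>S. 0 < L i i) \<and> (\<forall>i\<in>S. \<forall>j\<in>S. (\<Sum>k\<in>S. L i k * L j k) = A i j)"
  using assms
proof (induction S arbitrary: A rule: finite_linorder_min_induct)
  case empty
  then show ?case by (intro exI[of _ "\<lambda>_ _. 0"]) auto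
next
  case (insert b S A)
  have bS: "b \<notin> S" using insert.hyps by auto
  note fS = insert.hyps(1)
  have pos: "0 < A b b"
  proof -
    define e :: "'d \<Rightarrow> real" where "e i = (if i = b then 1 else 0)" for i
    have e: "e b = 1" "\<And>i. i \<in> S \<Longrightarrow> e i = 0" using bS by (auto simp: e_def)
    have "(\<Sum>i\<in>insert b S. \<Sum>j\<in>insert b S. A i j * e i * e j) = A b b"
      using fS bS e by simp
    then show ?thesis using insert.prems(2)[of e] e by auto
  qed
  define l where "l i = A i b / sqrt (A b b)" for i
  have lb: "l b = sqrt (A b b)" "l b * l b = A b b" using pos by (simp_all add: l_def real_div_sqrt)
  have ll: "l i * l b = A i b" for i using pos by (simp add: l_def real_div_sqrt)
  define A' where "A' i j = A i j - l i * l j" for i j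
  have pos': "0 < (\<Sum>i\<in>S. \<Sum>j\<in>S. A' i j * x i * x j)" if x: "\<exists>i\<in>S. x i \<noteq> 0" for x
  proof -
    define s where "s = (\<Sum>i\<in>S. A i b * x i)"
    \<comment> \<open>The value of coordinate \<open>b\<close> that minimises the quadratic form of
      \<open>A\<close>; the minimum is the form of \<open>A'\<close>, which is therefore
      positive.\<close>
    define t where "t = - s / A b b"
    define z where "z = x(b := t)"
    have zx: "z i = x i" if "i \<in> S" for i using that bS by (auto simp: z_def)
    have "0 < (\<Sum>i\<in>insert b S. \<Sum>j\<in>insert b S. A i j * z i * z j)"
      using x bS by (intro insert.prems(2)) (auto simp: z_def)
    also have "\<dots> = A b b * t * t + (\<Sum>j\<in>S. A b j * t * x j) + ((\<Sum>i\<in>S. A i b * x i * t) + (\<Sum>i\<in>S. \<Sum>j\<in>S. A i j * x i * x j))"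
      using fS bS zx by (simp add: sum.distrib z_def cong: sum.cong)
    also have "(\<Sum>j\<in>S. A b j * t * x j) = t * s"
      by (simp add: s_def sum_distrib_left insert.prems(1)[of b] mult_ac)
    also have "(\<Sum>i\<in>S. A i b * x i * t) = t * s" by (simp add: s_def sum_distrib_left mult_ac)
    also have "A b b * t * t + t * s + (t * s + (\<Sum>i\<in>S. \<Sum>j\<in>S. A i j * x i * x j)) = (\<Sum>i\<in>S. \<Sum>j\<in>S. A i j * x i * x j) - s * s / A b b"
      using pos by (simp add: t_def field_simps)
    also have "s * s / A b b = (\<Sum>i\<in>S. l i * x i) * (\<Sum>i\<in>S. l i * x i)"
    proof -
      have "(\<Sum>i\<in>S. l i * x i) = s / sqrt (A b b)" by (simp add: s_def l_def sum_divide_distrib)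
      then show ?thesis using pos by simp
    qed
    also have "(\<Sum>i\<in>S. \<Sum>j\<in>S. A i j * x i * x j) - (\<Sum>i\<in>S. l i * x i) * (\<Sum>i\<in>S. l i * x i) = (\<Sum>i\<in>S. \<Sum>j\<in>S. A' i j * x i * x j)"
      by (simp add: A'_def sum_product sum_subtractf algebra_simps)
    finally show ?thesis .
  qed
  have "\<exists>L. (\<forall>i j. i < j \<longrightarrow> L i j = 0) \<and> (\<forall>i\<in>S. 0 < L i i) \<and> (\<forall>i\<in>S. \<forall>j\<in>S. (\<Sum>k\<in>S. L i k * L j k) = A' i j)"
    using insert.prems(1) pos' by (intro insert.IH) (auto simp: A'_def mult_ac)
  then obtain L where L: "\<And>i j. i < j \<Longrightarrow> L i j = 0" "\<And>i. i \<in> S \<Longrightarrow> 0 < L i i"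
    "\<And>i j. i \<in> S \<Longrightarrow> j \<in> S \<Longrightarrow> (\<Sum>k\<in>S. L i k * L j k) = A' i j" by blast
  \<comment> \<open>About row \<open>b\<close> and column \<open>b\<close> of \<open>L\<close>
    nothing is known beyond triangularity, so both are set explicitly.\<close>
  define L' where "L' i k = (if i < k then 0 else if k = b then l i else if i = b then 0 else L i k)" for i k
  have L'b: "L' i b = l i" if "i \<in> insert b S" for i using that insert.hyps(2) by (auto simp: L'_def)
  have L'S: "L' i k = L i k" if "i \<in> S" "k \<in> S" for i k using that insert.hyps(2) L(1) by (auto simp: L'_def)
  have L'0: "L' b k = 0" if "k \<in> S" for k using that insert.hyps(2) by (auto simp: L'_def)
  have "(\<Sum>k\<in>insert b S. L' i k * L' j k) = A i j" if "i \<in> insert b S" "j \<in> insert b S" for i j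
  proof -
    have "(\<Sum>k\<in>insert b S. L' i k * L' j k) = l i * l j + (\<Sum>k\<in>S. L' i k * L' j k)"
      using fS bS that L'b by simp
    also have "\<dots> = A i j"
    proof (cases "i = b \<or> j = b")
      case True
      then have "(\<Sum>k\<in>S. L' i k * L' j k) = 0" using L'0 by (auto intro!: sum.neutral)
      then show ?thesis using True ll[of i] ll[of j] insert.prems(1)[of b j] by (auto simp: mult.commute)
    next
      case False
      then have "i \<in> S" "j \<in> S" using that by auto
      then show ?thesis using L(3) by (simp add: L'S A'_def cong: sum.cong)
    qed
    finally show ?thesis .
  qed
  moreover have "0 < L' i i" if "i \<in> insert b S" for i
    using that L'b[of b] L'S[of i i] L(2) lb(1) pos by (cases "i = b") auto
  ultimately show ?case by (intro exI[of _ L']) (auto simp: L'_def)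
qed

text \<open>Existence of a factor, so that the choice operator in \<open>cholesky\<close> really
  picks one.\<close>

lemma cholesky_works:
  fixes A :: "'d::{finite,linorder} rmat"
  assumes "transpose A = A" "\<And>x. x \<noteq> 0 \<Longrightarrow> 0 < x \<bullet> (A *v x)"
  shows "i < j \<Longrightarrow> cholesky A $ i $ j = 0" "0 < cholesky A $ i $ i" "cholesky A ** transpose (cholesky A) = A"
proof -
  have sym: "A $ i $ j = A $ j $ i" for i j using assms(1) by (metis transpose_def vec_lambda_beta)
  have "0 < (\<Sum>i\<in>UNIV. \<Sum>j\<in>UNIV. A $ i $ j * x i * x j)" if "\<exists>i\<in>UNIV. x i \<noteq> 0" for x
  proof -
    have "(\<chi> i. x i) \<noteq> 0" using that by (auto simp: vec_eq_iff)
    from assms(2)[OF this] show ?thesis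
      by (simp add: inner_vec_def matrix_vector_mult_def sum_distrib_left mult_ac)
  qed
  from cholesky_induct[of UNIV "\<lambda>i j. A $ i $ j", OF _ sym this] obtain L where
    L: "\<forall>i j. i < j \<longrightarrow> L i j = 0" "\<forall>i. 0 < L i i" "\<forall>i j. (\<Sum>k\<in>UNIV. L i k * L j k) = A $ i $ j" by auto
  have "\<exists>L :: 'd rmat. (\<forall>i j. i < j \<longrightarrow> L $ i $ j = 0) \<and> (\<forall>i. 0 < L $ i $ i) \<and> L ** transpose L = A"
    using L by (intro exI[of _ "\<chi> i j. L i j"]) (auto simp: vec_eq_iff matrix_matrix_mult_def transpose_def)
  from someI_ex[OF this] show "i < j \<Longrightarrow> cholesky A $ i $ j = 0" "0 < cholesky A $ i $ i" "cholesky A ** transpose (cholesky A) = A"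
    unfolding cholesky_def by blast+
qed

text \<open>Induction along the order: if everything below \<open>i\<close> is fixed and
  \<open>p i < i\<close>, then \<open>p (p i) = p i\<close> contradicts injectivity.\<close>

lemma permutes_le_imp_id:
  fixes p :: "'d::{finite,linorder} \<Rightarrow> 'd"
  assumes "p permutes UNIV" "\<And>i. p i \<le> i"
  shows "p = id"
proof
  fix i
  have wf: "wf {(x, y). (x :: 'd) < y}"
  proof (rule finite_acyclic_wf)
    have "trans {(x, y). (x :: 'd) < y}" by (auto simp: trans_def)
    then show "acyclic {(x, y). (x :: 'd) < y}" by (auto simp: acyclic_def trancl_id)
  qed auto
  show "p i = id i"
  proof (induction i rule: wf_induct_rule[OF wf])
    case (1 i)
    show ?case
    proof (rule ccontr)
      assume "p i \<noteq> id i"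
      then have "p i < i" using assms(2)[of i] by simp
      then have "p (p i) = p i" using 1 by simp
      then show False using permutes_inj[OF assms(1)] \<open>p i < i\<close> by (metis injD less_irrefl)
    qed
  qed
qed

text \<open>Every permutation other than the identity sends some \<open>i\<close> to a larger
  \<open>p i\<close>, and the corresponding entry is 0.\<close>

lemma det_lower_triangular:
  fixes A :: "'a::comm_ring_1^('n::{finite,linorder})^('n::{finite,linorder})"
  assumes ld: "\<And>i j. i < j \<Longrightarrow> A $ i $ j = 0"
  shows "det A = (\<Prod>i\<in>UNIV. A $ i $ i)"
proof -
  have "of_int (sign p) * (\<Prod>i\<in>UNIV. A $ i $ p i) = 0" if p: "p permutes UNIV" "p \<noteq> id" for p
  proof -
    obtain i where "i < p i" using permutes_le_imp_id[OF p(1)] p(2) by (meson not_le)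
    then have "(\<Prod>i\<in>UNIV. A $ i $ p i) = 0" using ld by (intro prod_zero) auto
    then show ?thesis by simp
  qed
  then have "det A = (\<Sum>p\<in>{id}. of_int (sign p) * (\<Prod>i\<in>UNIV. A $ i $ p i))"
    unfolding det_def by (intro sum.mono_neutral_right) (auto simp: permutes_id)
  then show ?thesis by (simp add: sign_id)
qed

text \<open>A crude bound from the Leibniz formula. It serves to show that \<open>1 / det L\<close>
  grows at most polynomially in the group size, which exponentially small tails absorb.\<close>

lemma abs_det_le:
  fixes A :: "real^'n^'n"
  assumes "\<And>i j. \<bar>A $ i $ j\<bar> \<le> B"
  shows "\<bar>det A\<bar> \<le> fact CARD('n) * B ^ CARD('n)"
proof -
  have "\<bar>det A\<bar> \<le> (\<Sum>p | p permutes (UNIV :: 'n set). B ^ CARD('n))"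
    unfolding det_def
  proof (intro order_trans[OF sum_abs] sum_mono)
    fix p :: "'n \<Rightarrow> 'n"
    have "\<bar>of_int (sign p) * (\<Prod>i\<in>UNIV. A $ i $ p i)\<bar> = (\<Prod>i\<in>UNIV. \<bar>A $ i $ p i\<bar>)"
      by (simp add: abs_mult abs_prod sign_def)
    also have "\<dots> \<le> (\<Prod>i\<in>(UNIV :: 'n set). B)" using assms by (intro prod_mono) auto
    finally show "\<bar>of_int (sign p) * (\<Prod>i\<in>UNIV. A $ i $ p i)\<bar> \<le> B ^ CARD('n)" by simp
  qed
  also have "\<dots> = fact CARD('n) * B ^ CARD('n)"
    by (simp add: card_permutations[OF refl])
  finally show ?thesis .
qed

lemma cholesky_matrix_inv:
  fixes H :: "'d::{finite,linorder} rmat"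
  assumes H: "transpose H = H" "\<And>x. x \<noteq> 0 \<Longrightarrow> 0 < x \<bullet> (H *v x)"
  defines "L \<equiv> cholesky (matrix_inv H)"
  shows "i < j \<Longrightarrow> L $ i $ j = 0" "0 < L $ i $ i" "(det L)\<^sup>2 * det H = 1"
    "(L *v z) \<bullet> (H *v (L *v z)) = z \<bullet> z"
proof -
  have "\<exists>B. B ** H = mat 1"
    unfolding matrix_left_invertible_ker using H(2) by (metis inner_zero_right less_irrefl)
  then have "invertible H" by (simp add: invertible_left_inverse)
  then have inv: "H ** matrix_inv H = mat 1" "matrix_inv H ** H = mat 1"
    unfolding invertible_def matrix_inv_def by (metis (mono_tags, lifting) someI_ex)+
  define K where "K = matrix_inv H"
  have K: "H ** K = mat 1" "K ** H = mat 1" using inv by (simp_all add: K_def)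
  have tK: "transpose K = K"
  proof -
    have "transpose K ** H = mat 1" using K(1) by (metis H(1) matrix_transpose_mul transpose_mat)
    then show ?thesis by (metis K(1) matrix_mul_assoc matrix_mul_lid matrix_mul_rid)
  qed
  \<comment> \<open>Since \<open>x = H *v (K *v x)\<close>, the form of \<open>K\<close> at
    \<open>x\<close> is that of \<open>H\<close> at \<open>K *v x\<close>.\<close>
  have pK: "0 < x \<bullet> (K *v x)" if "x \<noteq> 0" for x
  proof -
    have x: "x = H *v (K *v x)" by (simp add: matrix_vector_mul_assoc K)
    then have "K *v x \<noteq> 0" using that by auto
    from H(2)[OF this] show ?thesis using x by (simp add: inner_commute)
  qed
  note ch = cholesky_works[OF tK pK, folded L_def[folded K_def]]
  show "i < j \<Longrightarrow> L $ i $ j = 0" "0 < L $ i $ i" using ch(1,2) by (auto simp: L_def K_def)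
  have LL: "L ** transpose L = K" using ch(3) by (simp add: L_def K_def)
  have "det K * det H = 1" using K(2) by (metis det_I det_mul)
  moreover have "det K = (det L)\<^sup>2" by (simp add: LL[symmetric] det_mul det_transpose power2_eq_square)
  ultimately show "(det L)\<^sup>2 * det H = 1" by simp
  \<comment> \<open>A right inverse of a square matrix is also a left inverse; this moves
    \<open>L\<close> to the other side.\<close>
  have "L ** (transpose L ** H) = mat 1" by (simp add: matrix_mul_assoc LL K)
  then have LHL: "(transpose L ** H) ** L = mat 1" using matrix_left_right_inverse by blast
  have "(L *v z) \<bullet> (H *v (L *v z)) = z \<bullet> (transpose L *v (H *v (L *v z)))"
    by (metis dot_lmul_matrix inner_commute vector_transpose_matrix transpose_transpose)
  also have "\<dots> = z \<bullet> z" using LHL by (simp add: matrix_vector_mul_assoc matrix_mul_assoc)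
  finally show "(L *v z) \<bullet> (H *v (L *v z)) = z \<bullet> z" .
qed

section \<open>Change of variables for triangular matrices\<close>

lemma vec_lambda_measurable [measurable]:
  "(\<lambda>f. \<chi> i::'d::finite. f i) \<in> borel_measurable (\<Pi>\<^sub>M i\<in>(UNIV :: 'd set). (lborel :: real measure))"
proof (subst borel_measurable_euclidean_space, intro ballI)
  fix b :: "'d rvec" assume "b \<in> Basis"
  then obtain i where b: "b = axis i 1" by (auto simp: Basis_vec_def)
  show "(\<lambda>f. (\<chi> i. f i) \<bullet> b) \<in> borel_measurable (\<Pi>\<^sub>M i\<in>(UNIV :: 'd set). (lborel :: real measure))"
    unfolding b inner_axis by simp
qed

text \<open>Lebesgue measure on vectors as a product measure, which makes Fubini for a single
  coordinate available. The two agree on boxes.\<close>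

lemma lborel_vec_eq_distr:
  "(lborel :: 'd::finite rvec measure) = distr (\<Pi>\<^sub>M i\<in>UNIV. lborel) borel (\<lambda>f. \<chi> i. f i)"
proof (rule lborel_eqI)
  interpret product_sigma_finite "\<lambda>_::'d. lborel :: real measure" by standard
  fix l u :: "'d rvec" assume lu: "\<And>b. b \<in> Basis \<Longrightarrow> l \<bullet> b \<le> u \<bullet> b"
  have lu': "l $ i \<le> u $ i" for i using lu[of "axis i 1"] by (simp add: inner_axis axis_in_Basis_iff)
  have "(\<lambda>f. \<chi> i. f i) -` box l u \<inter> space (\<Pi>\<^sub>M i\<in>(UNIV :: 'd set). (lborel :: real measure)) = (\<Pi>\<^sub>E i\<in>UNIV. {l $ i<..<u $ i})"
    by (auto simp: mem_box_cart space_PiM PiE_def Pi_iff)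
  then have "emeasure (distr (\<Pi>\<^sub>M i\<in>UNIV. lborel) borel (\<lambda>f. \<chi> i. f i)) (box l u)
    = emeasure (\<Pi>\<^sub>M i\<in>(UNIV :: 'd set). (lborel :: real measure)) (\<Pi>\<^sub>E i\<in>UNIV. {l $ i<..<u $ i})"
    by (subst emeasure_distr) auto
  also have "\<dots> = (\<Prod>i\<in>UNIV. ennreal (u $ i - l $ i))" using lu' by (simp add: emeasure_PiM)
  also have "\<dots> = ennreal (\<Prod>i\<in>UNIV. (u - l) $ i)" using lu' by (subst prod_ennreal[symmetric]) auto
  also have "(\<Prod>i\<in>UNIV. (u - l) $ i) = (\<Prod>b\<in>Basis. (u - l) \<bullet> b)"
  proof -
    have "Basis = (\<lambda>i. axis i (1::real)) ` (UNIV :: 'd set)" by (auto simp: Basis_vec_def)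
    moreover have "inj (\<lambda>i::'d. axis i (1::real))" by (auto simp: inj_on_def axis_eq_axis)
    ultimately show ?thesis by (subst \<open>Basis = _\<close>, subst prod.reindex) (simp_all add: inner_axis)
  qed
  finally show "emeasure (distr (\<Pi>\<^sub>M i\<in>UNIV. lborel) borel (\<lambda>f. \<chi> i. f i)) (box l u) = (\<Prod>b\<in>Basis. (u - l) \<bullet> b)" .
qed simp

text \<open>Once the other coordinates are fixed, \<open>g\<close> is constant by its hypothesis,
  and the inner integral is a one-dimensional affine substitution.\<close>

lemma nn_integral_lborel_shear:
  fixes F :: "'d::finite rvec \<Rightarrow> ennreal" and g :: "'d rvec \<Rightarrow> real"
  assumes [measurable]: "F \<in> borel_measurable borel" "g \<in> borel_measurable borel"
    and g: "\<And>x y. (\<And>i. i \<noteq> j \<Longrightarrow> x $ i = y $ i) \<Longrightarrow> g x = g y" and c: "0 < c"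
  shows "ennreal c * (\<integral>\<^sup>+x. F (\<chi> i. if i = j then c * x $ j + g x else x $ i) \<partial>lborel) = (\<integral>\<^sup>+x. F x \<partial>lborel)"
proof -
  interpret product_sigma_finite "\<lambda>_::'d. lborel :: real measure" by standard
  define I where "I = UNIV - {j}"
  have U: "UNIV = insert j I" and I: "finite I" "j \<notin> I" by (auto simp: I_def)
  have split: "(\<integral>\<^sup>+x. h x \<partial>lborel) = (\<integral>\<^sup>+f. (\<integral>\<^sup>+y. h (\<chi> i. (f(j := y)) i) \<partial>lborel) \<partial>(\<Pi>\<^sub>M i\<in>I. lborel))"
    if [measurable]: "h \<in> borel_measurable borel" for h :: "'d rvec \<Rightarrow> ennreal"
  proof -
    have "(\<integral>\<^sup>+x. h x \<partial>lborel) = (\<integral>\<^sup>+f. h (\<chi> i. f i) \<partial>(\<Pi>\<^sub>M i\<in>UNIV. lborel))"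
      by (subst lborel_vec_eq_distr, subst nn_integral_distr) auto
    also have "\<dots> = (\<integral>\<^sup>+f. (\<integral>\<^sup>+y. h (\<chi> i. (f(j := y)) i) \<partial>lborel) \<partial>(\<Pi>\<^sub>M i\<in>I. lborel))"
      unfolding U by (rule product_nn_integral_insert[OF I]) (simp flip: U)
    finally show ?thesis .
  qed
  have E: "(\<lambda>x::'d rvec. \<chi> i. if i = j then c * x $ j + g x else x $ i) \<in> borel_measurable borel"
  proof (subst borel_measurable_euclidean_space, intro ballI)
    fix b :: "'d rvec" assume "b \<in> Basis"
    then obtain i where b: "b = axis i 1" by (auto simp: Basis_vec_def)
    show "(\<lambda>x. (\<chi> i. if i = j then c * x $ j + g x else x $ i) \<bullet> b) \<in> borel_measurable borel"
      unfolding b inner_axis by (cases "i = j") simp_all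
  qed
  have upd: "(\<lambda>y. (\<chi> i. (f(j := y)) i) :: 'd rvec) \<in> borel_measurable borel" for f
  proof (subst borel_measurable_euclidean_space, intro ballI)
    fix b :: "'d rvec" assume "b \<in> Basis"
    then obtain i where b: "b = axis i 1" by (auto simp: Basis_vec_def)
    show "(\<lambda>y. (\<chi> i. (f(j := y)) i) \<bullet> b) \<in> borel_measurable borel"
      unfolding b inner_axis by (cases "i = j") simp_all
  qed
  have "(\<integral>\<^sup>+y. F (\<chi> i. (f(j := y)) i) \<partial>lborel)
      = ennreal c * (\<integral>\<^sup>+y. F (\<chi> i. if i = j then c * (\<chi> i. (f(j := y)) i) $ j + g (\<chi> i. (f(j := y)) i) else (\<chi> i. (f(j := y)) i) $ i) \<partial>lborel)" for f
  proof -
    have m: "(\<lambda>y. F (\<chi> i. (f(j := y)) i)) \<in> borel_measurable borel"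
      using measurable_compose[OF upd assms(1)] .
    have "g (\<chi> i. (f(j := y)) i) = g (\<chi> i. f i)" for y by (rule g) auto
    from this have "F (\<chi> i. if i = j then c * (\<chi> i. (f(j := y)) i) $ j + g (\<chi> i. (f(j := y)) i) else (\<chi> i. (f(j := y)) i) $ i)
      = F (\<chi> i. (f(j := g (\<chi> i. f i) + c * y)) i)" for y
      unfolding \<open>\<And>y. g (\<chi> i. (f(j := y)) i) = g (\<chi> i. f i)\<close>
      by (intro arg_cong[where f = F]) (auto simp: vec_eq_iff)
    then show ?thesis
      using c nn_integral_real_affine[OF m, of c "g (\<chi> i. f i)"] by simp
  qed
  note inner = this
  have "(\<integral>\<^sup>+x. F x \<partial>lborel) = (\<integral>\<^sup>+f. ennreal c * (\<integral>\<^sup>+y. F (\<chi> i. if i = j then c * (\<chi> i. (f(j := y)) i) $ j + g (\<chi> i. (f(j := y)) i) else (\<chi> i. (f(j := y)) i) $ i) \<partial>lborel) \<partial>(\<Pi>\<^sub>M i\<in>I. lborel))"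
    unfolding split[OF assms(1)] inner ..
  also have "\<dots> = ennreal c * (\<integral>\<^sup>+f. (\<integral>\<^sup>+y. F (\<chi> i. if i = j then c * (\<chi> i. (f(j := y)) i) $ j + g (\<chi> i. (f(j := y)) i) else (\<chi> i. (f(j := y)) i) $ i) \<partial>lborel) \<partial>(\<Pi>\<^sub>M i\<in>I. lborel))"
  proof (rule nn_integral_cmult)
    have H: "(\<lambda>x. F (\<chi> i. if i = j then c * x $ j + g x else x $ i)) \<in> borel_measurable borel"
      using measurable_compose[OF E assms(1)] .
    have "(\<lambda>f. \<chi> i. f i) \<in> borel_measurable (\<Pi>\<^sub>M i\<in>insert j I. (lborel :: real measure))"
      using vec_lambda_measurable[where 'd = 'd] unfolding U .
    from measurable_compose[OF measurable_compose[OF measurable_add_dim this] H]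
    show "(\<lambda>f. \<integral>\<^sup>+y. F (\<chi> i. if i = j then c * (\<chi> i. (f(j := y)) i) $ j + g (\<chi> i. (f(j := y)) i) else (\<chi> i. (f(j := y)) i) $ i) \<partial>lborel) \<in> borel_measurable (\<Pi>\<^sub>M i\<in>I. lborel)"
      by (intro lborel.borel_measurable_nn_integral) (simp only: split_def)
  qed
  also have "\<dots> = ennreal c * (\<integral>\<^sup>+x. F (\<chi> i. if i = j then c * x $ j + g x else x $ i) \<partial>lborel)"
    using split[OF measurable_compose[OF E assms(1)]] by simp
  finally show ?thesis by simp
qed

text \<open>A triangular map is a composition of shears that change one coordinate each.\<close>

lemma nn_integral_lborel_lower_triangular:
  fixes L :: "'d::{finite,linorder} rmat"
  assumes L: "\<And>i j. i < j \<Longrightarrow> L $ i $ j = 0" "\<And>i. 0 < L $ i $ i"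
    and [measurable]: "F \<in> borel_measurable borel"
  shows "ennreal (\<Prod>i\<in>UNIV. L $ i $ i) * (\<integral>\<^sup>+x. F (L *v x) \<partial>lborel) = (\<integral>\<^sup>+x. F x \<partial>lborel)"
proof -
  \<comment> \<open>\<open>M S\<close> applies only the rows of \<open>L\<close> with index in
    \<open>S\<close>. Indices are added in decreasing order: row \<open>b\<close> reads only
    coordinates up to \<open>b\<close>, which \<open>M S\<close> leaves untouched because all of
    \<open>S\<close> lies above \<open>b\<close>.\<close>
  define M where "M S x = (\<chi> i. if i \<in> S then (L *v x) $ i else x $ i)" for S x
  have Mm: "M S \<in> borel_measurable borel" for S
  proof (subst borel_measurable_euclidean_space, intro ballI)
    fix b :: "'d rvec" assume "b \<in> Basis"
    then obtain i where b: "b = axis i 1" by (auto simp: Basis_vec_def)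
    show "(\<lambda>x. M S x \<bullet> b) \<in> borel_measurable borel"
      unfolding b inner_axis M_def matrix_vector_mult_def by (cases "i \<in> S") simp_all
  qed
  have "ennreal (\<Prod>i\<in>S. L $ i $ i) * (\<integral>\<^sup>+x. F (M S x) \<partial>lborel) = (\<integral>\<^sup>+x. F x \<partial>lborel)"
    if "F \<in> borel_measurable borel" "finite S" for S F
    using that(2,1)
  proof (induction S arbitrary: F rule: finite_linorder_min_induct)
    case empty
    have "M {} x = x" for x by (simp add: M_def vec_eq_iff)
    then show ?case by simp
  next
    case (insert b S F)
    define g where "g x = (\<Sum>i | i < b. L $ b $ i * x $ i)" for x :: "'d rvec"
    define E where "E x = (\<chi> i. if i = b then L $ b $ b * x $ b + g x else x $ i)" for x :: "'d rvec"
    have bS: "b \<notin> S" using insert.hyps by auto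
    have gm: "g \<in> borel_measurable borel" unfolding g_def by simp
    have Lb: "(L *v x) $ b = L $ b $ b * x $ b + g x" for x
    proof -
      have "(L *v x) $ b = (\<Sum>i | i \<le> b. L $ b $ i * x $ i)"
        unfolding matrix_vector_mult_def using L(1) by (simp, intro sum.mono_neutral_right) auto
      also have "{i. i \<le> b} = insert b {i. i < b}" by auto
      finally show ?thesis by (simp add: g_def)
    qed
    have ME: "M (insert b S) x = E (M S x)" for x
    proof -
      have "g (M S x) = g x" unfolding g_def M_def using insert.hyps(2) by (intro sum.cong) auto
      then show ?thesis using bS Lb by (auto simp: vec_eq_iff E_def) (auto simp: M_def)
    qed
    have Em: "E \<in> borel_measurable borel"
    proof (subst borel_measurable_euclidean_space, intro ballI)
      fix c :: "'d rvec" assume "c \<in> Basis"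
      then obtain i where b: "c = axis i 1" by (auto simp: Basis_vec_def)
      show "(\<lambda>x. E x \<bullet> c) \<in> borel_measurable borel"
        unfolding b inner_axis E_def using gm by (cases "i = b") simp_all
    qed
    have "ennreal (\<Prod>i\<in>insert b S. L $ i $ i) * (\<integral>\<^sup>+x. F (M (insert b S) x) \<partial>lborel)
      = ennreal (L $ b $ b) * (ennreal (\<Prod>i\<in>S. L $ i $ i) * (\<integral>\<^sup>+x. F (E (M S x)) \<partial>lborel))"
      using insert.hyps(1) bS L(2) by (simp add: ME ennreal_mult prod_nonneg less_imp_le mult.assoc)
    also have "\<dots> = ennreal (L $ b $ b) * (\<integral>\<^sup>+x. F (E x) \<partial>lborel)"
      using insert.IH[OF measurable_compose[OF Em insert.prems]] by simp
    also have "\<dots> = (\<integral>\<^sup>+x. F x \<partial>lborel)"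
      unfolding E_def
      by (rule nn_integral_lborel_shear[OF insert.prems gm _ L(2)]) (auto simp: g_def intro!: sum.cong)
    finally show ?case .
  qed
  from this[OF assms(3), of UNIV] show ?thesis by (simp add: M_def)
qed

lemma integral_lborel_lower_triangular:
  fixes L :: "'d::{finite,linorder} rmat"
  assumes L: "\<And>i j. i < j \<Longrightarrow> L $ i $ j = 0" "\<And>i. 0 < L $ i $ i"
    and F[measurable]: "F \<in> borel_measurable borel" and nn: "\<And>x. 0 \<le> F x"
  shows "(\<integral>x. F x \<partial>lborel) = det L * (\<integral>z. F (L *v z + c) \<partial>lborel)"
proof -
  have [measurable]: "(\<lambda>z. L *v z + c) \<in> borel_measurable borel"
    by (intro borel_measurable_continuous_onI continuous_on_add linear_continuous_on continuous_on_const)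
      (rule matrix_vector_mul_bounded_linear)
  have dL: "det L = (\<Prod>i\<in>UNIV. L $ i $ i)" by (rule det_lower_triangular[OF L(1)])
  have "(\<integral>\<^sup>+x. ennreal (F x) \<partial>lborel) = (\<integral>\<^sup>+x. ennreal (F x) \<partial>distr lborel borel ((+) c))"
    by (simp add: lborel_distr_plus)
  also have "\<dots> = (\<integral>\<^sup>+x. ennreal (F (c + x)) \<partial>lborel)" by (rule nn_integral_distr) auto
  also have "\<dots> = ennreal (det L) * (\<integral>\<^sup>+z. ennreal (F (c + L *v z)) \<partial>lborel)"
    using nn_integral_lborel_lower_triangular[OF L, of "\<lambda>x. ennreal (F (c + x))"]
    by (simp add: dL)
  finally have "(\<integral>\<^sup>+x. ennreal (F x) \<partial>lborel) = ennreal (det L) * (\<integral>\<^sup>+z. ennreal (F (L *v z + c)) \<partial>lborel)"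
    by (simp add: add.commute)
  moreover have "0 < det L" unfolding dL by (intro prod_pos) (use L(2) in auto)
  ultimately show ?thesis using nn by (simp add: integral_eq_nn_integral enn2real_mult)
qed

section \<open>Polynomials and Gaussian moments\<close>

text \<open>Guards the sums in \<open>poly_fun\<close>, which would be 0 over an infinite index set;
  later it also allows the events of all multi-indices to be intersected.\<close>

lemma finite_multi_index: "finite {a :: 'd::finite \<Rightarrow> nat. (\<Sum>j\<in>UNIV. a j) \<le> r}"
proof (rule finite_subset)
  show "{a :: 'd \<Rightarrow> nat. (\<Sum>j\<in>UNIV. a j) \<le> r} \<subseteq> (UNIV \<rightarrow>\<^sub>E {..r})"
  proof
    fix a :: "'d \<Rightarrow> nat" assume "a \<in> {a. (\<Sum>j\<in>UNIV. a j) \<le> r}"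
    moreover have "a j \<le> (\<Sum>j\<in>UNIV. a j)" for j by (rule member_le_sum) auto
    ultimately show "a \<in> UNIV \<rightarrow>\<^sub>E {..r}" by (auto intro: order_trans)
  qed
qed (simp add: finite_PiE)

section \<open>Closure properties and growth of polynomial functions\<close>

lemma poly_fun_add: "poly_fun r P \<Longrightarrow> poly_fun r R \<Longrightarrow> poly_fun r (\<lambda>u. P u + R u)"
  unfolding poly_fun_def
  by (elim exE, rule_tac x = "\<lambda>a. c a + ca a" in exI) (simp add: fun_eq_iff algebra_simps sum.distrib)

lemma poly_fun_cmult: "poly_fun r P \<Longrightarrow> poly_fun r (\<lambda>u. k * P u)"
  unfolding poly_fun_def
  by (elim exE, rule_tac x = "\<lambda>a. k * c a" in exI) (simp add: fun_eq_iff sum_distrib_left mult.assoc)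

lemma poly_fun_0: "poly_fun r (\<lambda>u. 0)"
  unfolding poly_fun_def by (rule exI[of _ "\<lambda>_. 0"]) simp

lemma poly_fun_sum: "(\<And>i. i \<in> I \<Longrightarrow> poly_fun r (P i)) \<Longrightarrow> poly_fun r (\<lambda>u. \<Sum>i\<in>I. P i u)"
  by (induction I rule: infinite_finite_induct) (auto intro: poly_fun_add poly_fun_0)

lemma poly_fun_monomial:
  fixes a :: "'d::finite \<Rightarrow> nat"
  assumes "(\<Sum>j\<in>UNIV. a j) \<le> r"
  shows "poly_fun r (\<lambda>u. \<Prod>j\<in>UNIV. (u $ j) ^ a j)"
  unfolding poly_fun_def
proof (rule exI[of _ "\<lambda>b. if b = a then 1 else 0"], rule ext)
  fix u :: "'d rvec"
  have "(\<Sum>b | (\<Sum>j\<in>UNIV. b j) \<le> r. (if b = a then 1 else 0) * (\<Prod>j\<in>UNIV. (u $ j) ^ b j))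
    = (\<Sum>b\<in>{a}. (if b = a then 1 else 0) * (\<Prod>j\<in>UNIV. (u $ j) ^ b j))"
    using assms by (intro sum.mono_neutral_right finite_multi_index) auto
  then show "(\<Prod>j\<in>UNIV. (u $ j) ^ a j) = (\<Sum>b | (\<Sum>j\<in>UNIV. b j) \<le> r. (if b = a then 1 else 0) * (\<Prod>j\<in>UNIV. (u $ j) ^ b j))"
    by simp
qed

lemma poly_fun_mono:
  assumes "poly_fun r P" "r \<le> r'"
  shows "poly_fun r' P"
proof -
  obtain c where "P = (\<lambda>u. \<Sum>a | (\<Sum>j\<in>UNIV. a j) \<le> r. c a * (\<Prod>j\<in>UNIV. (u $ j) ^ a j))"
    using assms(1) by (auto simp: poly_fun_def)
  then show ?thesis
    using assms(2) by (auto intro!: poly_fun_sum poly_fun_cmult poly_fun_monomial)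
qed

lemma poly_fun_const: "poly_fun r (\<lambda>u. k)"
  using poly_fun_cmult[OF poly_fun_monomial[of "\<lambda>_. 0" r], of k] by simp

lemma poly_fun_mult:
  assumes "poly_fun r P" "poly_fun s R"
  shows "poly_fun (r + s) (\<lambda>u. P u * R u)"
proof -
  obtain c where c: "P = (\<lambda>u. \<Sum>a | (\<Sum>j\<in>UNIV. a j) \<le> r. c a * (\<Prod>j\<in>UNIV. (u $ j) ^ a j))"
    using assms(1) by (auto simp: poly_fun_def)
  obtain d where d: "R = (\<lambda>u. \<Sum>b | (\<Sum>j\<in>UNIV. b j) \<le> s. d b * (\<Prod>j\<in>UNIV. (u $ j) ^ b j))"
    using assms(2) by (auto simp: poly_fun_def)
  have eq: "(\<lambda>u. P u * R u) = (\<lambda>u. \<Sum>a | (\<Sum>j\<in>UNIV. a j) \<le> r. \<Sum>b | (\<Sum>j\<in>UNIV. b j) \<le> s.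
      c a * d b * (\<Prod>j\<in>UNIV. (u $ j) ^ (a j + b j)))"
    unfolding c d sum_product by (simp add: power_add prod.distrib mult_ac)
  show ?thesis unfolding eq
    by (intro poly_fun_sum poly_fun_cmult poly_fun_monomial) (auto simp: sum.distrib intro: add_mono)
qed

lemma poly_fun_coord: "poly_fun 1 (\<lambda>u. u $ i)"
proof -
  have eq: "(\<lambda>u::'a rvec. u $ i) = (\<lambda>u. \<Prod>j\<in>UNIV. (u $ j) ^ (if j = i then 1 else 0))"
    by (simp add: fun_eq_iff if_distrib cong: if_cong)
  show ?thesis by (subst eq, rule poly_fun_monomial) simp
qed

lemma poly_fun_inner_matrix: "poly_fun 1 (\<lambda>z. (L *v z) \<bullet> b)"
proof -
  have eq: "(\<lambda>z. (L *v z) \<bullet> b) = (\<lambda>z. \<Sum>i\<in>UNIV. \<Sum>j\<in>UNIV. (L $ i $ j * b $ i) * z $ j)"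
    by (simp add: fun_eq_iff inner_vec_def matrix_vector_mult_def sum_distrib_left mult_ac)
  show ?thesis unfolding eq by (intro poly_fun_sum poly_fun_cmult poly_fun_coord)
qed

lemma poly_fun_prod_list: "poly_fun (length bs) (\<lambda>z. \<Prod>b\<leftarrow>bs. (L *v z) \<bullet> b)"
proof (induction bs)
  case (Cons b bs)
  from poly_fun_mult[OF poly_fun_inner_matrix[of L b] Cons] show ?case by simp
qed (simp add: poly_fun_const)

lemma poly_fun_measurable:
  assumes "poly_fun r P"
  shows "P \<in> borel_measurable borel"
proof -
  obtain c where c: "P = (\<lambda>u. \<Sum>a | (\<Sum>j\<in>UNIV. a j) \<le> r. c a * (\<Prod>j\<in>UNIV. (u $ j) ^ a j))"
    using assms(1) by (auto simp: poly_fun_def)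
  show ?thesis unfolding c by measurable
qed

lemma poly_fun_growth:
  fixes P :: "'d::finite rvec \<Rightarrow> real"
  assumes "poly_fun r P"
  shows "\<exists>C. \<forall>u. \<bar>P u\<bar> \<le> C * (1 + norm u) ^ r"
proof -
  obtain c where c: "P = (\<lambda>u. \<Sum>a | (\<Sum>j\<in>UNIV. a j) \<le> r. c a * (\<Prod>j\<in>UNIV. (u $ j) ^ a j))"
    using assms(1) by (auto simp: poly_fun_def)
  have "\<bar>P u\<bar> \<le> (\<Sum>a | (\<Sum>j\<in>(UNIV :: 'd set). a j) \<le> r. \<bar>c a\<bar>) * (1 + norm u) ^ r" for u
    unfolding c sum_distrib_right
  proof (intro order_trans[OF sum_abs] sum_mono)
    fix a :: "'d \<Rightarrow> nat" assume a: "a \<in> {a. (\<Sum>j\<in>UNIV. a j) \<le> r}"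
    have "\<bar>\<Prod>j\<in>UNIV. (u $ j) ^ a j\<bar> \<le> (\<Prod>j\<in>UNIV. (1 + norm u) ^ a j)"
      unfolding abs_prod power_abs
    proof (intro prod_mono conjI power_mono)
      show "\<bar>u $ j\<bar> \<le> 1 + norm u" for j using component_le_norm_cart[of u j] by linarith
    qed auto
    also have "\<dots> = (1 + norm u) ^ (\<Sum>j\<in>UNIV. a j)" by (simp add: power_sum)
    also have "\<dots> \<le> (1 + norm u) ^ r" using a by (intro power_increasing) auto
    finally show "\<bar>c a * (\<Prod>j\<in>UNIV. (u $ j) ^ a j)\<bar> \<le> \<bar>c a\<bar> * (1 + norm u) ^ r"
      by (simp add: abs_mult mult_left_mono)
  qed
  then show ?thesis by blast
qed

section \<open>The Gaussian density and its moments\<close>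

lemma gauss_dens_exp:
  fixes z :: "'d::finite rvec"
  shows "gauss_dens z = (1 / sqrt (2 * pi)) ^ CARD('d) * exp (- (norm z)\<^sup>2 / 2)"
proof -
  have "(norm z)\<^sup>2 = (\<Sum>j\<in>UNIV. (z $ j)\<^sup>2)"
    by (simp add: norm_vec_def L2_set_def sum_nonneg)
  then have "(\<Prod>j\<in>UNIV. exp (- (z $ j)\<^sup>2 / 2)) = exp (- (norm z)\<^sup>2 / 2)"
    by (simp add: exp_sum[symmetric] sum_divide_distrib sum_negf)
  then show ?thesis
    unfolding gauss_dens_def std_normal_density_def prod.distrib prod_constant by simp
qed

lemma gauss_dens_pos: "0 < gauss_dens z"
  by (simp add: gauss_dens_exp)

lemma gauss_dens_measurable [measurable]: "gauss_dens \<in> borel_measurable borel"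
  unfolding gauss_dens_exp[abs_def] by measurable

text \<open>Lets \<open>1 + norm z\<close> be bounded by a product over the coordinates, so that
  Gaussian moments are dominated by products of one-dimensional ones.\<close>

lemma sum_le_prod_one_plus:
  fixes a :: "'i \<Rightarrow> real"
  assumes "finite S" "\<And>i. i \<in> S \<Longrightarrow> 0 \<le> a i"
  shows "1 + (\<Sum>i\<in>S. a i) \<le> (\<Prod>i\<in>S. 1 + a i)"
  using assms
proof (induction S rule: finite_induct)
  case (insert i S)
  have "1 + (\<Sum>i\<in>insert i S. a i) \<le> (1 + a i) * (1 + (\<Sum>i\<in>S. a i))"
    using insert.hyps insert.prems by (simp add: algebra_simps sum_nonneg)
  also have "\<dots> \<le> (1 + a i) * (\<Prod>i\<in>S. 1 + a i)"
    using insert.IH insert.prems by (intro mult_left_mono) auto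
  finally show ?case using insert.hyps by simp
qed simp

lemma integrable_gauss_moment:
  "integrable lborel (\<lambda>z :: 'd::finite rvec. gauss_dens z * (1 + norm z) ^ M)"
proof -
  define f where "f x = std_normal_density x * (1 + \<bar>x\<bar>) ^ M" for x :: real
  have f0: "0 \<le> f x" for x by (simp add: f_def)
  have [measurable]: "f \<in> borel_measurable borel" unfolding f_def by measurable
  have "integrable lborel f"
  proof -
    have "f = (\<lambda>x. \<Sum>k\<le>M. of_nat (M choose k) * (std_normal_density x * \<bar>x\<bar> ^ k))"
      by (simp add: fun_eq_iff f_def add.commute[of 1] binomial_ring sum_distrib_left mult_ac)
    moreover have "integrable lborel (\<lambda>x. std_normal_density x * \<bar>x\<bar> ^ k)" for k
    proof (cases "even k")
      case True
      then obtain j where k: "k = 2 * j" by auto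
      show ?thesis using std_normal_moment_even[of j] by (auto simp: k has_bochner_integral_iff power_even_abs)
    next
      case False
      then obtain j where k: "k = 2 * j + 1" by (auto elim: oddE)
      show ?thesis using std_normal_moment_abs_odd[of j] by (auto simp: k has_bochner_integral_iff)
    qed
    ultimately show ?thesis by simp
  qed
  then have fin: "(\<integral>\<^sup>+x. ennreal (f x) \<partial>lborel) < \<infinity>"
    using f0 by (simp add: integrable_iff_bounded)
  have le: "norm (gauss_dens z * (1 + norm z) ^ M) \<le> (\<Prod>b\<in>Basis. f (z \<bullet> b))" for z :: "'d rvec"
  proof -
    have "1 + norm z \<le> 1 + (\<Sum>j\<in>UNIV. \<bar>z $ j\<bar>)" using norm_le_l1_cart[of z] by simp
    also have "\<dots> \<le> (\<Prod>j\<in>UNIV. 1 + \<bar>z $ j\<bar>)" by (rule sum_le_prod_one_plus) auto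
    finally have "(1 + norm z) ^ M \<le> (\<Prod>j\<in>UNIV. 1 + \<bar>z $ j\<bar>) ^ M" by (intro power_mono) auto
    then have "gauss_dens z * (1 + norm z) ^ M \<le> (\<Prod>j\<in>UNIV. f (z $ j))"
      using gauss_dens_pos[of z] by (simp add: f_def prod.distrib prod_power_distrib gauss_dens_def)
    also have "\<dots> = (\<Prod>b\<in>Basis. f (z \<bullet> b))"
    proof -
      have "Basis = (\<lambda>i. axis i (1::real)) ` (UNIV :: 'd set)" by (auto simp: Basis_vec_def)
      moreover have "inj (\<lambda>i::'d. axis i (1::real))" by (auto simp: inj_on_def axis_eq_axis)
      ultimately show ?thesis by (subst \<open>Basis = _\<close>, subst prod.reindex) (simp_all add: inner_axis)
    qed
    finally show ?thesis using gauss_dens_pos[of z] by simp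
  qed
  show ?thesis
  proof (rule Bochner_Integration.integrable_bound)
    show "integrable lborel (\<lambda>z :: 'd rvec. \<Prod>b\<in>Basis. f (z \<bullet> b))"
    proof (rule integrableI_bounded)
      have "(\<integral>\<^sup>+z. ennreal (norm (\<Prod>b\<in>Basis. f (z \<bullet> b))) \<partial>(lborel :: 'd rvec measure))
        = (\<integral>\<^sup>+z. (\<Prod>b\<in>Basis. ennreal (f (z \<bullet> b))) \<partial>(lborel :: 'd rvec measure))"
        using f0 by (intro nn_integral_cong) (simp add: prod_nonneg prod_ennreal)
      also have "\<dots> = (\<Prod>b\<in>(Basis :: 'd rvec set). (\<integral>\<^sup>+x. ennreal (f x) \<partial>lborel))"
        by (rule nn_integral_lborel_prod) auto
      also have "\<dots> < \<infinity>" using fin by (simp add: power_less_top_ennreal)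
      finally show "(\<integral>\<^sup>+z. ennreal (norm (\<Prod>b\<in>Basis. f (z \<bullet> b))) \<partial>(lborel :: 'd rvec measure)) < \<infinity>" .
    qed measurable
    show "AE z in (lborel :: 'd rvec measure). norm (gauss_dens z * (1 + norm z) ^ M) \<le> norm (\<Prod>b\<in>Basis. f (z \<bullet> b))"
      by (rule AE_I2) (use order_trans[OF le abs_ge_self] in simp)
  qed measurable
qed

lemma integrable_gauss_poly:
  fixes P :: "'d::finite rvec \<Rightarrow> real"
  assumes "poly_fun r P"
  shows "integrable lborel (\<lambda>z. gauss_dens z * P z)"
proof -
  obtain C where C: "\<And>u. \<bar>P u\<bar> \<le> C * (1 + norm u) ^ r" using poly_fun_growth[OF assms] by auto
  note poly_fun_measurable[OF assms, measurable]
  show ?thesis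
  proof (rule Bochner_Integration.integrable_bound)
    show "integrable lborel (\<lambda>z :: 'd rvec. C * (gauss_dens z * (1 + norm z) ^ r))"
      by (intro integrable_mult_right integrable_gauss_moment)
    show "AE z in lborel. norm (gauss_dens z * P z) \<le> norm (C * (gauss_dens z * (1 + norm z) ^ r))"
    proof (rule AE_I2)
      fix z
      have "norm (gauss_dens z * P z) \<le> gauss_dens z * (C * (1 + norm z) ^ r)"
        using C[of z] gauss_dens_pos[of z] by (simp add: abs_mult mult_left_mono)
      then show "norm (gauss_dens z * P z) \<le> norm (C * (gauss_dens z * (1 + norm z) ^ r))"
        by (simp add: mult_ac)
    qed
  qed measurable
qed

lemma integral_lborel_odd:
  fixes f :: "'e::euclidean_space \<Rightarrow> real"
  assumes [measurable]: "f \<in> borel_measurable borel" and odd: "\<And>z. f (- z) = - f z"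
  shows "(\<integral>z. f z \<partial>lborel) = 0"
proof -
  have eq: "lborel = distr lborel borel (\<lambda>x::'e. - x)"
    using lborel_affine[of "-1" "0::'e"] by (simp add: density_1)
  have "(\<integral>z. f z \<partial>lborel) = (\<integral>z. f z \<partial>distr lborel borel (\<lambda>x::'e. - x))"
    using eq by (rule arg_cong)
  also have "\<dots> = (\<integral>z. f (- z) \<partial>lborel)" by (rule integral_distr) auto
  also have "\<dots> = - (\<integral>z. f z \<partial>lborel)" by (simp add: odd)
  finally show ?thesis by simp
qed

lemma quad_exact_graded:
  fixes P :: "nat \<Rightarrow> 'd::finite rvec \<Rightarrow> real"
  assumes k: "1 \<le> k" and Q: "finite Q" "quad_exact k Q \<omega>" "k mod 3 = 1 \<longrightarrow> quad_symmetric Q \<omega>"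
    and P: "\<And>w. poly_fun (3 * w) (P w)" "\<And>w z. P w (- z) = (- 1) ^ w * P w z"
  defines "r \<equiv> (k + 2) div 3"
  shows "(\<integral>z. gauss_dens z * (\<Sum>w<2*r. P w z) \<partial>lborel) = (\<Sum>z\<in>Q. gauss_dens z * (\<Sum>w<2*r. P w z) * \<omega> z)"
proof -
  have one: "(\<integral>z. gauss_dens z * P w z \<partial>lborel) = (\<Sum>z\<in>Q. gauss_dens z * P w z * \<omega> z)" if w: "w < 2 * r" for w
  proof (cases "3 * w \<le> 2 * k - 1")
    case True
    then show ?thesis using Q(2) poly_fun_mono[OF P(1)[of w]] by (simp add: quad_exact_def)
  next
    case False
    \<comment> \<open>For \<open>w = 2 * r - 1\<close> the degree bound \<open>3 * w\<close> is
      \<open>6 * r - 3\<close>. This is \<open>2 * k - 3\<close> for remainder 0,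
      \<open>2 * k - 1\<close> for remainder 2, and \<open>2 * k + 1\<close> for remainder 1; in the
      last case every smaller \<open>w\<close> is still covered by exactness.\<close>
    define s where "s = k div 3"
    have ks: "k = 3 * s + k mod 3" by (simp add: s_def)
    have "k mod 3 < 3" by simp
    then consider "k mod 3 = 0" | "k mod 3 = 1" | "k mod 3 = 2" by linarith
    then have "k mod 3 = 1 \<and> w = 2 * r - 1 \<and> r \<ge> 1"
    proof cases
      case 1
      then have "k = 3 * s" using ks by simp
      moreover from this have "r = s" by (simp add: r_def)
      ultimately show ?thesis using False w k by simp
    next
      case 2
      then have "k = 3 * s + 1" using ks by simp
      moreover from this have "r = s + 1" by (simp add: r_def)
      ultimately show ?thesis using False w 2 by simp
    next
      case 3
      then have "k = 3 * s + 2" using ks by simp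
      moreover from this have "r = s + 1" by (simp add: r_def)
      ultimately show ?thesis using False w by simp
    qed
    then have odd: "odd w" and sym: "quad_symmetric Q \<omega>" using Q(3) by auto
    have e: "gauss_dens (- z) = gauss_dens z" for z :: "'d rvec" by (simp add: gauss_dens_exp)
    note poly_fun_measurable[OF P(1)[of w], measurable]
    have "(\<integral>z. gauss_dens z * P w z \<partial>lborel) = 0"
      by (rule integral_lborel_odd) (use odd in \<open>simp_all add: P(2) e\<close>)
    moreover have "(\<Sum>z\<in>Q. gauss_dens z * P w z * \<omega> z) = (\<Sum>z\<in>Q. gauss_dens (- z) * P w (- z) * \<omega> (- z))"
      using sym by (intro sum.reindex_bij_witness[of _ uminus uminus]) (auto simp: quad_symmetric_def)
    moreover have "\<dots> = - (\<Sum>z\<in>Q. gauss_dens z * P w z * \<omega> z)"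
      using sym odd by (simp add: sum_negf[symmetric] e P(2) quad_symmetric_def)
    ultimately show ?thesis by simp
  qed
  have "(\<integral>z. gauss_dens z * (\<Sum>w<2*r. P w z) \<partial>lborel) = (\<Sum>w<2*r. \<integral>z. gauss_dens z * P w z \<partial>lborel)"
    unfolding sum_distrib_left by (intro Bochner_Integration.integral_sum integrable_gauss_poly[OF P(1)])
  also have "\<dots> = (\<Sum>w<2*r. \<Sum>z\<in>Q. gauss_dens z * P w z * \<omega> z)" using one by simp
  also have "\<dots> = (\<Sum>z\<in>Q. gauss_dens z * (\<Sum>w<2*r. P w z) * \<omega> z)"
    by (subst sum.swap) (simp add: sum_distrib_left sum_distrib_right)
  finally show ?thesis .
qed

section \<open>The exponential of a graded sum\<close>

text \<open>The coefficient of \<open>t ^ w\<close> in the exponential of the sum of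
  \<open>X w * t ^ w\<close> over \<open>w \<ge> 1\<close>. The recursion compares coefficients in
  the differential equation \<open>S' = Y' * S\<close> of \<open>S = exp Y\<close>, which avoids
  sums over partitions of \<open>w\<close>.\<close>

fun exp_coeff :: "(nat \<Rightarrow> real) \<Rightarrow> nat \<Rightarrow> real" where
  "exp_coeff X 0 = 1"
| "exp_coeff X (Suc w) = (\<Sum>i\<le>w. real (Suc i) * X (Suc i) * exp_coeff X (w - i)) / real (Suc w)"

text \<open>The factor \<open>Suc i \<le> Suc v\<close> cancels against the division, and the powers
  of 2 up to \<open>2 ^ v\<close> add up to less than \<open>2 ^ Suc v\<close>.\<close>

lemma exp_coeff_bound:
  assumes "0 \<le> a" "\<And>w. 1 \<le> w \<Longrightarrow> \<bar>X w\<bar> \<le> a ^ w"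
  shows "\<bar>exp_coeff X w\<bar> \<le> (2 * a) ^ w"
proof (induction w rule: less_induct)
  case (less w)
  show ?case
  proof (cases w)
    case (Suc v)
    have "\<bar>\<Sum>i\<le>v. real (Suc i) * X (Suc i) * exp_coeff X (v - i)\<bar> \<le> (\<Sum>i\<le>v. real (Suc v) * (a ^ Suc v * 2 ^ (v - i)))"
    proof (intro order_trans[OF sum_abs] sum_mono)
      fix i assume i: "i \<in> {..v}"
      have "\<bar>real (Suc i) * X (Suc i) * exp_coeff X (v - i)\<bar> \<le> real (Suc v) * (a ^ Suc i) * (2 * a) ^ (v - i)"
        unfolding abs_mult using less[of "v - i"] assms(1) assms(2)[of "Suc i"] i Suc by (intro mult_mono) auto
      also have "\<dots> = real (Suc v) * (a ^ Suc v * 2 ^ (v - i))"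
        using i by (simp add: power_mult_distrib power_diff flip: power_add)
      finally show "\<bar>real (Suc i) * X (Suc i) * exp_coeff X (v - i)\<bar> \<le> real (Suc v) * (a ^ Suc v * 2 ^ (v - i))" .
    qed
    also have "\<dots> = real (Suc v) * a ^ Suc v * (\<Sum>i\<le>v. 2 ^ (v - i))" by (simp add: sum_distrib_left mult_ac)
    also have "(\<Sum>i\<le>v. (2::real) ^ (v - i)) = (\<Sum>i\<le>v. 2 ^ i)"
      by (rule sum.reindex_bij_witness[of _ "\<lambda>i. v - i" "\<lambda>i. v - i"]) auto
    also have "(\<Sum>i\<le>v. (2::real) ^ i) \<le> 2 ^ Suc v" by (induction v) auto
    finally have "\<bar>\<Sum>i\<le>v. real (Suc i) * X (Suc i) * exp_coeff X (v - i)\<bar> \<le> real (Suc v) * a ^ Suc v * 2 ^ Suc v"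
      using assms(1) by (simp add: mult_left_mono)
    then show ?thesis unfolding Suc
      by (simp add: abs_divide divide_le_eq power_mult_distrib mult_ac del: power_Suc of_nat_Suc)
  qed simp
qed

text \<open>The power series \<open>S\<close> in an auxiliary variable \<open>t\<close> solves
  \<open>S' = Y' * S\<close>, so \<open>S t * exp (- Y t)\<close> has the same value at 0 and at 1.
  The bound 1 / 8 makes the coefficients at most \<open>(1 / 4) ^ w\<close>; hence the series
  converges for \<open>\<bar>t\<bar> \<le> 2\<close> and can be differentiated termwise around
  [0, 1].\<close>

lemma exp_coeff_sums:
  assumes a: "0 \<le> a" "a \<le> 1 / 8" and X: "\<And>w. 1 \<le> w \<Longrightarrow> \<bar>X w\<bar> \<le> a ^ w" "\<And>w. m < w \<Longrightarrow> X w = 0"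
  shows "exp_coeff X sums exp (\<Sum>w=1..m. X w)"
proof -
  define c where "c = exp_coeff X"
  have bound: "norm (c w * t ^ w) \<le> (1 / 2) ^ w" if "\<bar>t\<bar> \<le> 2" for t w
  proof -
    have "norm (c w * t ^ w) \<le> (2 * a) ^ w * 2 ^ w"
      unfolding c_def norm_mult norm_power using that a(1) exp_coeff_bound[of a X w, OF a(1) X(1)]
      by (intro mult_mono power_mono) auto
    also have "\<dots> = (2 * a * 2) ^ w" by (simp only: power_mult_distrib)
    also have "\<dots> \<le> (1 / 2) ^ w" using a by (intro power_mono) auto
    finally show ?thesis .
  qed
  have summ: "summable (\<lambda>w. norm (c w * t ^ w))" if "\<bar>t\<bar> \<le> 2" for t
  proof (rule summable_comparison_test'[where g = "\<lambda>w. (1 / 2) ^ w" and N = 0])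
    show "summable (\<lambda>w. (1 / 2 :: real) ^ w)" by (rule summable_geometric) simp
    show "norm (norm (c w * t ^ w)) \<le> (1 / 2) ^ w" for w using bound[OF that, of w] by simp
  qed
  define S where "S t = (\<Sum>w. c w * t ^ w)" for t
  define Y where "Y t = (\<Sum>w=1..m. X w * t ^ w)" for t :: real
  define Y' where "Y' t = (\<Sum>i<m. real (Suc i) * X (Suc i) * t ^ i)" for t :: real
  have dY: "(Y has_real_derivative Y' t) (at t)" for t
  proof -
    have "(Y has_real_derivative (\<Sum>w=1..m. X w * (real w * t ^ (w - 1)))) (at t)"
      unfolding Y_def by (intro DERIV_sum DERIV_cmult) (use DERIV_pow in simp)
    also have "(\<Sum>w=1..m. X w * (real w * t ^ (w - 1))) = Y' t"
      unfolding Y'_def by (rule sum.reindex_bij_witness[of _ Suc "\<lambda>w. w - 1"]) auto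
    finally show ?thesis .
  qed
  have dS: "(S has_real_derivative Y' t * S t) (at t)" if t: "\<bar>t\<bar> < 2" for t
  proof -
    define b where "b i = real (Suc i) * X (Suc i) * t ^ i" for i
    have b0: "b i = 0" if "i \<notin> {..<m}" for i using that X(2)[of "Suc i"] by (simp add: b_def)
    have "summable (\<lambda>i. norm (b i))" by (rule summable_finite[of "{..<m}"]) (use b0 in auto)
    moreover have "(\<Sum>i. b i) = Y' t"
      unfolding Y'_def using b0 by (subst suminf_finite[of "{..<m}"]) (auto simp: b_def)
    ultimately have "Y' t * S t = (\<Sum>k. \<Sum>i\<le>k. b i * (c (k - i) * t ^ (k - i)))"
      using Cauchy_product[of b "\<lambda>w. c w * t ^ w"] summ[of t] t by (simp add: S_def)
    \<comment> \<open>This is the recursion of \<open>exp_coeff\<close>, multiplied by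
      \<open>Suc k\<close>.\<close>
    also have "(\<lambda>k. \<Sum>i\<le>k. b i * (c (k - i) * t ^ (k - i))) = (\<lambda>k. diffs c k * t ^ k)"
    proof
      fix k
      have "(\<Sum>i\<le>k. b i * (c (k - i) * t ^ (k - i))) = (\<Sum>i\<le>k. real (Suc i) * X (Suc i) * c (k - i) * t ^ k)"
        by (intro sum.cong) (auto simp: b_def power_add[symmetric])
      also have "\<dots> = diffs c k * t ^ k"
        by (simp add: diffs_def c_def sum_distrib_right del: of_nat_Suc)
      finally show "(\<Sum>i\<le>k. b i * (c (k - i) * t ^ (k - i))) = diffs c k * t ^ k" .
    qed
    finally have "Y' t * S t = (\<Sum>k. diffs c k * t ^ k)" .
    moreover have "(S has_real_derivative (\<Sum>k. diffs c k * t ^ k)) (at t)"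
      unfolding S_def using t summ[of 2] by (intro termdiffs_strong[of _ 2]) (auto intro: summable_norm_cancel)
    ultimately show ?thesis by simp
  qed
  have "\<exists>k. \<forall>t\<in>{0..1}. S t * exp (- Y t) = k"
  proof (rule has_field_derivative_zero_constant)
    fix t :: real assume "t \<in> {0..1}"
    then have "((\<lambda>t. S t * exp (- Y t)) has_real_derivative 0) (at t)"
      by (auto intro!: derivative_eq_intros dS dY)
    then show "((\<lambda>t. S t * exp (- Y t)) has_real_derivative 0) (at t within {0..1})"
      by (rule has_field_derivative_at_within)
  qed simp
  then have "S 1 * exp (- Y 1) = S 0 * exp (- Y 0)" by (metis atLeastAtMost_iff order_refl zero_le_one)
  moreover have "S 0 = 1" unfolding S_def by (simp add: powser_zero c_def)
  moreover have "Y 0 = 0" by (simp add: Y_def power_0_left)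
  ultimately have "S 1 = exp (Y 1)" by (simp add: exp_minus field_simps)
  moreover have "summable c" by (rule summable_norm_cancel) (use summ[of 1] in simp)
  ultimately show ?thesis by (simp add: S_def Y_def c_def sums_iff)
qed

text \<open>The tail of the series is dominated by a geometric one of ratio 1 / 4, whose sum 4 / 3
  is rounded up to 2.\<close>

lemma exp_coeff_truncation:
  assumes a: "0 \<le> a" "a \<le> 1 / 8" and X: "\<And>w. 1 \<le> w \<Longrightarrow> \<bar>X w\<bar> \<le> a ^ w" "\<And>w. m < w \<Longrightarrow> X w = 0"
  shows "\<bar>exp (\<Sum>w=1..m. X w) - (\<Sum>w<N. exp_coeff X w)\<bar> \<le> 2 * (2 * a) ^ N"
proof -
  have s: "exp_coeff X sums exp (\<Sum>w=1..m. X w)"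
    by (rule exp_coeff_sums[OF assms])
  have "exp (\<Sum>w=1..m. X w) - (\<Sum>w<N. exp_coeff X w) = (\<Sum>w. exp_coeff X (w + N))"
    using suminf_minus_initial_segment[OF sums_summable[OF s], of N] sums_unique[OF s] by simp
  also have "\<bar>\<dots>\<bar> \<le> (\<Sum>w. (2 * a) ^ N * (1 / 4) ^ w)"
  proof -
    have "\<bar>exp_coeff X (w + N)\<bar> \<le> (2 * a) ^ N * (1 / 4) ^ w" for w
    proof -
      have "\<bar>exp_coeff X (w + N)\<bar> \<le> (2 * a) ^ N * (2 * a) ^ w"
        using exp_coeff_bound[OF a(1) X(1), of "w + N"] by (simp add: power_add mult.commute)
      also have "\<dots> \<le> (2 * a) ^ N * (1 / 4) ^ w" using a by (intro mult_left_mono power_mono) auto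
      finally show ?thesis .
    qed
    then have "norm (\<Sum>w. exp_coeff X (w + N)) \<le> (\<Sum>w. (2 * a) ^ N * (1 / 4) ^ w)"
      by (intro norm_suminf_le) (auto intro: summable_mult)
    then show ?thesis by simp
  qed
  also have "\<dots> = (2 * a) ^ N * (4 / 3)" by (subst suminf_mult) (auto simp: suminf_geometric)
  also have "\<dots> \<le> 2 * (2 * a) ^ N" using a(1) by simp
  finally show ?thesis .
qed

text \<open>Degree bound and parity are additive in the weight, and the two factors in each term of
  the recursion have weights adding up to \<open>w\<close>.\<close>

lemma exp_coeff_graded:
  fixes X :: "'d::finite rvec \<Rightarrow> nat \<Rightarrow> real"
  assumes X: "\<And>w. 1 \<le> w \<Longrightarrow> poly_fun (3 * w) (\<lambda>z. X z w)"
    "\<And>w z. 1 \<le> w \<Longrightarrow> X (- z) w = (- 1) ^ w * X z w"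
  shows "poly_fun (3 * w) (\<lambda>z. exp_coeff (X z) w) \<and> (\<forall>z. exp_coeff (X (- z)) w = (- 1) ^ w * exp_coeff (X z) w)"
proof (induction w rule: less_induct)
  case (less w)
  show ?case
  proof (cases w)
    case (Suc v)
    have "poly_fun (3 * w) (\<lambda>z. real (Suc i) * X z (Suc i) * exp_coeff (X z) (v - i))" if "i \<le> v" for i
    proof -
      have "poly_fun (3 * Suc i + 3 * (v - i)) (\<lambda>z. (real (Suc i) * X z (Suc i)) * exp_coeff (X z) (v - i))"
        using less[of "v - i"] Suc by (intro poly_fun_mult poly_fun_cmult X) auto
      moreover have "3 * Suc i + 3 * (v - i) = 3 * w" using that Suc by simp
      ultimately show ?thesis by simp
    qed
    then have "poly_fun (3 * w) (\<lambda>z. (1 / real (Suc v)) * (\<Sum>i\<le>v. real (Suc i) * X z (Suc i) * exp_coeff (X z) (v - i)))"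
      by (intro poly_fun_cmult poly_fun_sum) auto
    moreover have "exp_coeff (X (- z)) w = (- 1) ^ w * exp_coeff (X z) w" for z
    proof -
      have "(\<Sum>i\<le>v. real (Suc i) * X (- z) (Suc i) * exp_coeff (X (- z)) (v - i))
        = (\<Sum>i\<le>v. (- 1) ^ w * (real (Suc i) * X z (Suc i) * exp_coeff (X z) (v - i)))"
      proof (intro sum.cong refl)
        fix i assume i: "i \<in> {..v}"
        have "(- 1 :: real) ^ Suc i * (- 1) ^ (v - i) = (- 1) ^ w"
          using i Suc by (simp only: power_add[symmetric]) simp
        then have m: "(- 1 :: real) ^ w = (- 1) ^ Suc i * (- 1) ^ (v - i)" ..
        have "exp_coeff (X (- z)) (v - i) = (- 1) ^ (v - i) * exp_coeff (X z) (v - i)"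
          using less[of "v - i"] Suc by simp
        then show "real (Suc i) * X (- z) (Suc i) * exp_coeff (X (- z)) (v - i)
            = (- 1) ^ w * (real (Suc i) * X z (Suc i) * exp_coeff (X z) (v - i))"
          using X(2)[of "Suc i" z] unfolding m by (simp del: power_Suc of_nat_Suc)
      qed
      then show ?thesis by (simp add: Suc sum_distrib_left del: power_Suc of_nat_Suc)
    qed
    ultimately show ?thesis by (simp add: Suc del: of_nat_Suc)
  qed (simp add: poly_fun_const)
qed

lemma abs_exp_diff_le:
  fixes x y :: real
  assumes "x \<le> 1" "y \<le> 1"
  shows "\<bar>exp y - exp x\<bar> \<le> 3 * \<bar>y - x\<bar>"
proof -
  have *: "exp b - exp a \<le> 3 * \<bar>b - a\<bar>" if "b \<le> 1" for a b :: real
  proof -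
    have "exp a = exp b * exp (a - b)" by (simp flip: exp_add)
    also have "\<dots> \<ge> exp b * (1 + (a - b))" by (intro mult_left_mono) auto
    finally have "exp b - exp a \<le> exp b * (b - a)" by (simp add: algebra_simps)
    also have "\<dots> \<le> exp b * \<bar>b - a\<bar>" by (intro mult_left_mono) auto
    also have "\<dots> \<le> 3 * \<bar>b - a\<bar>"
      using order_trans[OF _ exp_le, of "exp b"] that by (intro mult_right_mono) auto
    finally show ?thesis .
  qed
  show ?thesis using *[of y x] *[of x y] assms by (auto simp: abs_if)
qed

section \<open>The error for one group\<close>

text \<open>
  One group: \<open>J\<close> is its integrand with mode \<open>m\<close>. The derivatives of \<open>ln J\<close> near the mode are bounded
  by \<open>\<Lambda>\<close>, the Hessian is at least \<open>\<lambda>\<close>, and \<open>\<rho>\<close> is the radius within which the Taylor expansion of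
  \<open>ln J\<close> is used.
\<close>

locale laplace_group =
  fixes J :: "'d::{finite,linorder} rvec \<Rightarrow> real" and m u0 :: "'d rvec"
    and \<delta> \<Lambda> \<mu> \<rho> \<tau> a :: real and k r :: nat and Q :: "'d rvec set" and \<omega> :: "'d rvec \<Rightarrow> real"
  assumes k: "1 \<le> k" and r: "r = (k + 2) div 3"
    and Q: "finite Q" "quad_exact k Q \<omega>" "k mod 3 = 1 \<longrightarrow> quad_symmetric Q \<omega>"
    and J_int: "integrable lborel J" and J_nonneg: "\<And>u. 0 \<le> J u" and J_max: "\<And>u. J u \<le> J m"
    and J_pos: "\<And>u. u \<in> ball u0 \<delta> \<Longrightarrow> 0 < J u" and m: "m \<in> ball u0 (\<delta> / 2)"
    and C: "Ck_on (2 * r + 2) (ball u0 \<delta>) (\<lambda>u. ln (J u))"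
    and D: "\<And>bs u. set bs \<subseteq> Basis \<Longrightarrow> length bs \<le> 2 * r + 2 \<Longrightarrow> u \<in> ball u0 \<delta> \<Longrightarrow>
      \<bar>iter_deriv bs (\<lambda>u. ln (J u)) u\<bar> \<le> \<Lambda>"
    and Hs: "\<And>u v. u \<in> ball u0 \<delta> \<Longrightarrow> \<mu> * (norm v)\<^sup>2 \<le> - (v \<bullet> hess (\<lambda>u. ln (J u)) u v)"
    and lam: "0 < \<mu>" and rho: "0 < \<rho>" "\<rho> < \<delta> / 2"
    and tail: "(\<integral>u. indicator (- ball u0 \<delta>) u * J u \<partial>lborel) \<le> \<tau> * J m"
    and a: "\<Lambda> * (real CARD('d) * \<rho>) ^ 3 \<le> a" "real CARD('d) * \<rho> \<le> a" "a \<le> 1 / 8"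
    and sm: "\<Lambda> * (real CARD('d) / sqrt \<mu>) ^ 3 \<le> 1" "real CARD('d) / sqrt \<mu> \<le> 1"
    and Z: "1 \<le> \<rho> * sqrt \<mu>" "\<And>z. z \<in> Q \<Longrightarrow> norm z \<le> \<rho> * sqrt \<mu>"
begin

definition "f = (\<lambda>u. ln (J u))"
definition "H = - matrix (hess f m)"
definition "L = cholesky (matrix_inv H)"
definition "cd = sqrt (2 * pi) ^ CARD('d)"
text \<open>The common factor of the integral and the quadrature sum, which cancels in the
  difference of logarithms. The Gaussian constant \<open>cd\<close> is included so that on
  \<open>A\<close> the function \<open>\<psi>\<close> is \<open>gauss_dens\<close> times the
  exponential of a bounded function.\<close>

definition "nrm = det L * J m * cd"
text \<open>The weight is the Taylor degree minus 2, so that cubic terms have weight 1. The cutoff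
  is at weight \<open>2 * r\<close>, which already has the order of the final error and is left to
  the Taylor remainder.\<close>

definition "X z w = (if 1 \<le> w \<and> w < 2 * r then line_deriv (w + 2) f m (L *v z) / fact (w + 2) else 0)"
definition "P z = (\<Sum>w<2*r. exp_coeff (X z) w)"
definition "\<psi> z = J (L *v z + m) / (J m * cd)"
text \<open>The preimage of \<open>cball m \<rho>\<close> under the substitution, so that the change
  of variables is exact. It contains the ball of radius \<open>\<rho> * sqrt \<mu>\<close>, by
  \<open>AI\<close>.\<close>

definition "A = {z. norm (L *v z) \<le> \<rho>}"

section \<open>Expansion of the rescaled integrand near the mode\<close>

lemma r1: "1 \<le> r" using k r by simp

lemma mB: "m \<in> ball u0 \<delta>" using m rho by auto

lemma Jm: "0 < J m" using J_pos mB by simp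

lemma cd1: "1 \<le> cd"
proof -
  have "1 \<le> sqrt (2 * pi)" using pi_gt3 by simp
  then show ?thesis unfolding cd_def by (rule one_le_power)
qed

lemma nearB: "norm v < \<delta> / 2 \<Longrightarrow> m + v \<in> ball u0 \<delta>"
  using m norm_triangle_ineq[of "m - u0" v] by (simp add: dist_norm norm_minus_commute algebra_simps)

lemma Lam: "0 \<le> \<Lambda>" using D[of "[]" m] mB by simp

lemma a0: "0 \<le> a" using a(2) rho(1) by (smt (verit) mult_nonneg_nonneg of_nat_0_le_iff)

lemma H_apply: "H *v v = - hess f m v"
proof -
  have "matrix (hess f m) *v v = hess f m v"
    by (rule matrix_works) (simp add: linear_matrix_vector_mul_eq linear_hess)
  moreover have "H *v v = - (matrix (hess f m) *v v)"
    by (simp add: H_def vec_eq_iff matrix_vector_mult_def sum_negf)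
  ultimately show ?thesis by simp
qed

lemma H_sym: "transpose H = H"
proof -
  have "x \<bullet> (H *v y) = (H *v x) \<bullet> y" for x y
    using hess_self_adjoint[OF Ck_on_mono[OF C, of 2] _ mB, of x y] r1 by (simp add: H_apply f_def)
  then have "(transpose H *v x) \<bullet> y = (H *v x) \<bullet> y" for x y
    by (metis dot_lmul_matrix inner_commute vector_transpose_matrix transpose_transpose)
  then have "transpose H *v x = H *v x" for x by (metis vector_eq_rdot)
  then show ?thesis by (simp add: matrix_eq)
qed

lemma H_pos: "x \<noteq> 0 \<Longrightarrow> 0 < x \<bullet> (H *v x)"
  using Hs[OF mB, of x] lam by (simp add: H_apply f_def) (smt (verit) mult_pos_pos zero_less_norm_iff zero_less_power)

lemmas Lfacts = cholesky_matrix_inv[OF H_sym H_pos, folded L_def]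

lemma L_quad: "(L *v z) \<bullet> hess f m (L *v z) = - (norm z)\<^sup>2"
  using Lfacts(4)[of z] by (simp add: H_apply dot_square_norm)

text \<open>The Hessian bound at \<open>m\<close>, applied to \<open>L *v z\<close>, where the
  quadratic form equals \<open>(norm z)\<^sup>2\<close>.\<close>

lemma L_norm: "sqrt \<mu> * norm (L *v z) \<le> norm z"
proof -
  have "\<mu> * (norm (L *v z))\<^sup>2 \<le> (norm z)\<^sup>2" using Hs[OF mB, of "L *v z"] L_quad[of z] by (simp add: f_def)
  then have "sqrt (\<mu> * (norm (L *v z))\<^sup>2) \<le> sqrt ((norm z)\<^sup>2)" by (rule real_sqrt_le_mono)
  then show ?thesis by (simp add: real_sqrt_mult)
qed

lemma det_L: "0 < det L"
proof -
  have "det L = (\<Prod>i\<in>UNIV. L $ i $ i)" by (rule det_lower_triangular) (rule Lfacts(1))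
  then show ?thesis by (auto intro: prod_pos Lfacts(2))
qed

text \<open>\<open>1 / det L\<close> is the square root of \<open>det H\<close>, and the entries of
  \<open>H\<close> are second derivatives. A coarse bound suffices because it only multiplies
  tails.\<close>

lemma inv_det_L: "1 / det L \<le> 1 + fact CARD('d) * \<Lambda> ^ CARD('d)"
proof -
  define s where "s = 1 / det L"
  have "\<bar>H $ i $ j\<bar> \<le> \<Lambda>" for i j
  proof -
    have "H $ i $ j = - (hess f m (axis j 1) \<bullet> axis i 1)" by (simp add: H_def matrix_def inner_axis)
    also have "\<dots> = - iter_deriv [axis i 1, axis j 1] f m" by (subst hess_inner_Basis) auto
    finally show ?thesis using D[of "[axis i 1, axis j 1]" m] mB r1 by (simp add: f_def)
  qed
  from abs_det_le[of H, OF this] have "det H \<le> fact CARD('d) * \<Lambda> ^ CARD('d)" by linarith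
  moreover have "s\<^sup>2 = det H" using Lfacts(3) det_L by (simp add: s_def power_divide field_simps)
  ultimately have "s\<^sup>2 \<le> fact CARD('d) * \<Lambda> ^ CARD('d)" by simp
  moreover have "s \<le> 1 + s\<^sup>2" using sum_squares_ge_zero[of "s - 1" 0] by (simp add: power2_eq_square algebra_simps)
    (smt (verit) mult_le_cancel_left1 zero_le_square)
  ultimately show ?thesis by (simp add: s_def)
qed

lemma nrm_pos: "0 < nrm" using det_L Jm cd1 by (simp add: nrm_def)

lemma term_bound:
  assumes "w \<le> 2 * r" "u \<in> ball u0 \<delta>"
  shows "\<bar>line_deriv (w + 2) f u v / fact (w + 2)\<bar> \<le> \<Lambda> * (real CARD('d) * norm v) ^ (w + 2)"
proof -
  have "\<bar>line_deriv (w + 2) f u v / fact (w + 2)\<bar> = \<bar>line_deriv (w + 2) f u v\<bar> / fact (w + 2)" by simp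
  also have "\<dots> \<le> \<bar>line_deriv (w + 2) f u v\<bar> / 1"
    by (intro divide_left_mono) (auto simp: fact_ge_1 simp del: fact_Suc)
  also have "\<dots> \<le> \<Lambda> * (real DIM('d rvec) * norm v) ^ (w + 2)"
    using line_deriv_bound[of "w + 2" f u \<Lambda> v] D assms unfolding f_def by auto
  finally show ?thesis by simp
qed

text \<open>One factor \<open>\<Lambda> * s ^ 3\<close> pays for the large \<Lambda>, and each of
  the other \<open>w - 1\<close> powers of \<open>s\<close> contributes a factor \<open>b\<close>.
  Two inequalities thus bound all weights at once, which is the origin of the paired assumptions
  \<open>a\<close> and \<open>sm\<close>.\<close>

lemma power_bound:
  assumes "1 \<le> w" "0 \<le> s" "\<Lambda> * s ^ 3 \<le> b" "s \<le> b"
  shows "\<Lambda> * s ^ (w + 2) \<le> b ^ w"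
proof -
  obtain v where w: "w = Suc v" using assms(1) by (cases w) auto
  have "\<Lambda> * s ^ (w + 2) = (\<Lambda> * s ^ 3) * s ^ v" by (simp add: w power_add numeral_3_eq_3 mult_ac)
  also have "\<dots> \<le> b * b ^ v" using assms Lam by (intro mult_mono power_mono) auto
  finally show ?thesis by (simp add: w)
qed

lemma term_bound_near:
  assumes "1 \<le> w" "w \<le> 2 * r" "u \<in> ball u0 \<delta>" "norm v \<le> \<rho>"
  shows "\<bar>line_deriv (w + 2) f u v / fact (w + 2)\<bar> \<le> a ^ w"
proof -
  have "\<bar>line_deriv (w + 2) f u v / fact (w + 2)\<bar> \<le> \<Lambda> * (real CARD('d) * norm v) ^ (w + 2)"
    using assms by (intro term_bound)
  also have "\<dots> \<le> \<Lambda> * (real CARD('d) * \<rho>) ^ (w + 2)"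
    using assms Lam by (intro mult_left_mono power_mono) auto
  also have "\<dots> \<le> a ^ w" using assms a rho by (intro power_bound) auto
  finally show ?thesis .
qed

lemma X_bound_near: "z \<in> A \<Longrightarrow> 1 \<le> w \<Longrightarrow> \<bar>X z w\<bar> \<le> a ^ w"
  using term_bound_near[OF _ _ mB, of w "L *v z"] a0 by (simp add: X_def A_def)

text \<open>Needed also outside \<open>A\<close>, where the Taylor terms no longer approximate
  anything, because the integral of the polynomial \<open>P\<close> runs over the whole space. The
  assumptions \<open>sm\<close> make the bound independent of the group size; the exponent comes
  from \<open>w + 2 \<le> 3 * w\<close>.\<close>

lemma X_bound_all: "1 \<le> w \<Longrightarrow> \<bar>X z w\<bar> \<le> ((1 + norm z) ^ 3) ^ w"
proof (cases "w < 2 * r")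
  case True
  assume w: "1 \<le> w"
  have Ln: "norm (L *v z) \<le> norm z / sqrt \<mu>" using L_norm[of z] lam by (simp add: pos_le_divide_eq mult.commute)
  have "\<bar>X z w\<bar> \<le> \<Lambda> * (real CARD('d) * norm (L *v z)) ^ (w + 2)"
    using term_bound[of w m "L *v z"] True w mB by (simp add: X_def)
  also have "\<dots> \<le> \<Lambda> * (real CARD('d) * (norm z / sqrt \<mu>)) ^ (w + 2)"
    using Ln Lam by (intro mult_left_mono power_mono) auto
  also have "\<dots> = (\<Lambda> * (real CARD('d) / sqrt \<mu>) ^ (w + 2)) * norm z ^ (w + 2)"
    by (simp add: power_mult_distrib power_divide)
  also have "\<dots> \<le> 1 ^ w * (1 + norm z) ^ (3 * w)"
  proof (intro mult_mono power_bound)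
    have "norm z ^ (w + 2) \<le> (1 + norm z) ^ (w + 2)" by (intro power_mono) auto
    also have "\<dots> \<le> (1 + norm z) ^ (3 * w)" using w by (intro power_increasing) auto
    finally show "norm z ^ (w + 2) \<le> (1 + norm z) ^ (3 * w)" .
  qed (use w sm lam in auto)
  finally show ?thesis by (simp add: power_mult)
qed (simp add: X_def)

lemma exp_coeff_graded_X:
  "poly_fun (3 * w) (\<lambda>z. exp_coeff (X z) w)" "exp_coeff (X (- z)) w = (- 1) ^ w * exp_coeff (X z) w"
proof -
  have 1: "poly_fun (3 * w) (\<lambda>z. X z w)" if "1 \<le> w" for w
  proof (cases "w < 2 * r")
    case True
    have "poly_fun (w + 2) (\<lambda>z. (1 / fact (w + 2)) * line_deriv (w + 2) f m (L *v z))"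
      unfolding line_deriv_def
    proof (intro poly_fun_cmult poly_fun_sum)
      fix bs :: "'d rvec list" assume bs: "bs \<in> {bs. set bs \<subseteq> Basis \<and> length bs = w + 2}"
      have "poly_fun (length bs) (\<lambda>z. iter_deriv bs f m * (\<Prod>b\<leftarrow>bs. (L *v z) \<bullet> b))"
        by (intro poly_fun_cmult poly_fun_prod_list)
      then show "poly_fun (w + 2) (\<lambda>z. (\<Prod>b\<leftarrow>bs. (L *v z) \<bullet> b) * iter_deriv bs f m)"
        using bs by (simp add: mult.commute)
    qed
    then have "poly_fun (3 * w) (\<lambda>z. (1 / fact (w + 2)) * line_deriv (w + 2) f m (L *v z))"
      by (rule poly_fun_mono) (use that in simp)
    then show ?thesis using True that by (simp add: X_def)
  qed (simp add: X_def poly_fun_0)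
  have 2: "X (- z) w = (- 1) ^ w * X z w" for w z
  proof -
    have p: "(\<Prod>b\<leftarrow>bs. (- v) \<bullet> b) = (- 1) ^ length bs * (\<Prod>b\<leftarrow>bs. v \<bullet> b)" for v and bs :: "'d rvec list"
      by (induction bs) auto
    have "L *v (- z) = - (L *v z)" by (simp add: vec_eq_iff matrix_vector_mult_def sum_negf)
    then have "line_deriv (w + 2) f m (L *v (- z)) = (- 1) ^ w * line_deriv (w + 2) f m (L *v z)"
      unfolding line_deriv_def sum_distrib_left by (intro sum.cong) (auto simp: p mult_ac)
    then show ?thesis by (simp add: X_def)
  qed
  show "poly_fun (3 * w) (\<lambda>z. exp_coeff (X z) w)" "exp_coeff (X (- z)) w = (- 1) ^ w * exp_coeff (X z) w"
    using exp_coeff_graded[of X w] 1 2 by auto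
qed

lemma P_exact: "(\<integral>z. gauss_dens z * P z \<partial>lborel) = (\<Sum>z\<in>Q. gauss_dens z * P z * \<omega> z)"
  unfolding P_def using quad_exact_graded[OF k Q exp_coeff_graded_X, folded r] .

lemma P_poly: "poly_fun (6 * r) P"
proof -
  have "poly_fun (6 * r) (\<lambda>z. P z)" unfolding P_def
    by (intro poly_fun_sum poly_fun_mono[OF exp_coeff_graded_X(1)]) auto
  then show ?thesis by simp
qed

text \<open>\<open>exp_coeff_bound\<close> asks for no smallness, so it applies with
  \<open>a = (1 + norm z) ^ 3\<close> at every \<open>z\<close>.\<close>

lemma P_bound: "\<bar>P z\<bar> \<le> real (2 * r) * 4 ^ r * (1 + norm z) ^ (6 * r)"
proof -
  have "\<bar>P z\<bar> \<le> (\<Sum>w<2*r. (2 * (1 + norm z) ^ 3) ^ (2 * r))"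
    unfolding P_def
  proof (intro order_trans[OF sum_abs] sum_mono)
    fix w assume w: "w \<in> {..<2 * r}"
    have "\<bar>exp_coeff (X z) w\<bar> \<le> (2 * (1 + norm z) ^ 3) ^ w"
      by (rule exp_coeff_bound) (auto intro: X_bound_all)
    also have "\<dots> \<le> (2 * (1 + norm z) ^ 3) ^ (2 * r)"
    proof (intro power_increasing)
      have "1 \<le> (1 + norm z) ^ 3" by (intro one_le_power) auto
      then show "1 \<le> 2 * (1 + norm z) ^ 3" by linarith
    qed (use w in auto)
    finally show "\<bar>exp_coeff (X z) w\<bar> \<le> (2 * (1 + norm z) ^ 3) ^ (2 * r)" .
  qed
  also have "\<dots> = real (2 * r) * (2 ^ (2 * r) * (1 + norm z) ^ (3 * (2 * r)))"
    by (simp add: power_mult_distrib power_mult[symmetric])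
  also have "(2 :: real) ^ (2 * r) = 4 ^ r" by (simp add: power_mult)
  finally show ?thesis by (simp add: mult_ac)
qed

text \<open>The Taylor terms at the mode: order 0 is divided out, order 1 vanishes by maximality,
  order 2 gives the Gaussian, orders 3 to \<open>2 * r + 1\<close> form \<open>S\<close>, and the
  remainder \<open>rem\<close> has the size of the first omitted weight. Hence
  \<open>R = S + rem\<close>.\<close>

lemma psi_near:
  assumes z: "z \<in> A"
  shows "\<exists>R. \<psi> z = gauss_dens z * exp R \<and> \<bar>R\<bar> \<le> 1 \<and> \<bar>exp R - P z\<bar> \<le> 5 * 4 ^ r * a ^ (2 * r)"
proof -
  define v where "v = L *v z"
  have v: "norm v \<le> \<rho>" using z by (simp add: A_def v_def)
  have seg: "m + s *\<^sub>R v \<in> ball u0 \<delta>" if "0 \<le> s" "s \<le> 1" for s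
  proof (rule nearB)
    have "norm (s *\<^sub>R v) \<le> 1 * norm v" unfolding norm_scaleR using that by (intro mult_right_mono) auto
    then show "norm (s *\<^sub>R v) < \<delta> / 2" using v rho by simp
  qed
  have "\<exists>s. 0 < s \<and> s < 1 \<and> f (m + v) = (\<Sum>j<2*r+2. line_deriv j f m v / fact j) + line_deriv (2*r+2) f (m + s *\<^sub>R v) v / fact (2*r+2)"
    by (rule Taylor_line[OF C[folded f_def] open_ball seg]) auto
  then obtain s where s: "0 < s" "s < 1" "f (m + v) = (\<Sum>j<2*r+2. line_deriv j f m v / fact j) + line_deriv (2*r+2) f (m + s *\<^sub>R v) v / fact (2*r+2)"
    by blast
  define rem where "rem = line_deriv (2*r+2) f (m + s *\<^sub>R v) v / fact (2*r+2)"
  have rem: "\<bar>rem\<bar> \<le> a ^ (2 * r)"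
    unfolding rem_def using r1 s v seg[of s] by (intro term_bound_near) auto
  define S where "S = (\<Sum>w=1..2*r-1. X z w)"
  \<comment> \<open>A geometric series of ratio 1 / 8. Together with the remainder it keeps
    \<open>R\<close> in [-1, 1], so that \<open>\<psi>\<close> and \<open>gauss_dens\<close> are
    comparable on \<open>A\<close>.\<close>
  have S: "\<bar>S\<bar> \<le> 1 / 4"
  proof -
    have "\<bar>S\<bar> \<le> (\<Sum>w=1..2*r-1. (1 / 8) ^ w)"
      unfolding S_def using X_bound_near[OF z] power_mono[OF a(3) a0]
      by (intro order_trans[OF sum_abs] sum_mono) (meson atLeastAtMost_iff order_trans)
    also have "\<dots> = (\<Sum>w<2*r-1. (1 / 8) ^ Suc w)"
      by (rule sum.reindex_bij_witness[of _ Suc "\<lambda>w. w - 1"]) auto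
    also have "\<dots> \<le> (\<Sum>w. (1 / 8 :: real) ^ Suc w)"
      by (intro sum_le_suminf) (auto intro!: summable_mult)
    also have "\<dots> = (1 / 8) * (\<Sum>w. (1 / 8) ^ w)"
      unfolding power_Suc by (rule suminf_mult) (rule summable_geometric, simp)
    also have "\<dots> \<le> 1 / 4" by (simp add: suminf_geometric)
    finally show ?thesis .
  qed
  have grad0: "line_deriv 1 f m v = 0"
  proof (rule line_deriv_1_local_max[where t = "2*r+2" and S = "ball u0 \<delta>"])
    show "f y \<le> f m" if "y \<in> ball u0 \<delta>" for y using J_pos[OF that] J_max[of y] by (simp add: f_def)
  qed (use C mB in \<open>auto simp: f_def\<close>)
  have "(\<Sum>j<2*r+2. line_deriv j f m v / fact j) = f m - (norm z)\<^sup>2 / 2 + S"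
  proof -
    have "{..<2*r+2} = insert 0 (insert 1 (insert 2 {3..<2*r+2}))" using r1 by auto
    then have "(\<Sum>j<2*r+2. line_deriv j f m v / fact j) = f m + (- (norm z)\<^sup>2 / 2 + (\<Sum>j=3..<2*r+2. line_deriv j f m v / fact j))"
      using grad0 L_quad[of z] by (simp add: line_deriv_2 v_def fact_numeral)
    also have "(\<Sum>j=3..<2*r+2. line_deriv j f m v / fact j) = S"
    proof -
      have "(\<Sum>j=1+2..<2*r+2. line_deriv j f m v / fact j) = (\<Sum>w=1..<2*r. line_deriv (w + 2) f m v / fact (w + 2))"
        by (rule sum.shift_bounds_nat_ivl)
      also have "\<dots> = S"
        unfolding S_def X_def v_def using r1 by (intro sum.cong) auto
      finally show ?thesis by (simp add: numeral_3_eq_3)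
    qed
    finally show ?thesis by simp
  qed
  then have fv: "f (m + v) = f m - (norm z)\<^sup>2 / 2 + (S + rem)" using s(3) by (simp add: rem_def)
  have pos: "0 < J (m + v)" using J_pos seg[of 1] by simp
  have "J (m + v) = exp (f (m + v))" using pos by (simp add: f_def)
  also have "\<dots> = J m * exp (- (norm z)\<^sup>2 / 2) * exp (S + rem)"
  proof -
    have "exp (f m - (norm z)\<^sup>2 / 2 + (S + rem)) = exp (f m) * exp (- (norm z)\<^sup>2 / 2) * exp (S + rem)"
      by (simp flip: exp_add)
    then show ?thesis unfolding fv using Jm by (simp add: f_def)
  qed
  finally have "\<psi> z = gauss_dens z * exp (S + rem)"
    using Jm cd1 by (simp add: \<psi>_def v_def[symmetric] add.commute gauss_dens_exp cd_def power_divide)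
  moreover have ap: "a ^ (2 * r) \<le> 1 / 8"
  proof -
    have "a ^ (2 * r) \<le> a ^ 1" using a0 a(3) r1 by (intro power_decreasing) auto
    then show ?thesis using a(3) by simp
  qed
  moreover have "\<bar>S + rem\<bar> \<le> 1" using S rem ap by linarith
  \<comment> \<open>The 5 is 3 for dropping \<open>rem\<close> inside the exponential plus 2 for
    truncating the series of \<open>exp S\<close>.\<close>
  moreover have "\<bar>exp (S + rem) - P z\<bar> \<le> 5 * 4 ^ r * a ^ (2 * r)"
  proof -
    have "\<bar>exp (S + rem) - exp S\<bar> \<le> 3 * \<bar>(S + rem) - S\<bar>"
      using S rem ap by (intro abs_exp_diff_le) linarith+
    then have 1: "\<bar>exp (S + rem) - exp S\<bar> \<le> 3 * a ^ (2 * r)" using rem by simp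
    have 2: "\<bar>exp S - P z\<bar> \<le> 2 * (2 * a) ^ (2 * r)"
      unfolding S_def P_def by (rule exp_coeff_truncation[OF a0 a(3) X_bound_near[OF z]]) (auto simp: X_def)
    have 3: "(2 * a) ^ (2 * r) = 4 ^ r * a ^ (2 * r)" by (simp add: power_mult_distrib power_mult)
    have "1 * a ^ (2 * r) \<le> 4 ^ r * a ^ (2 * r)" using a0 by (intro mult_right_mono) auto
    then show ?thesis using 1 2 unfolding 3 by linarith
  qed
  ultimately show ?thesis by blast
qed

end

text \<open>This number, later \<open>c0\<close>, bounds the normalised marginal from below: on the
  unit ball, which lies in \<open>A\<close>, the function \<open>\<psi>\<close> is at least
  \<open>exp (- 1) * gauss_dens\<close>. It does not depend on the data.\<close>

lemma exp_neg_one_gauss_pos: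
  "0 < exp (- 1) * (\<integral>z. indicator (cball 0 1) z * gauss_dens z \<partial>(lborel :: 'd::finite rvec measure))"
proof -
  define c where "c = (1 / sqrt (2 * pi)) ^ CARD('d) * exp (- 1 / 2 :: real)"
  have "0 < c" by (simp add: c_def)
  have int: "integrable lborel (\<lambda>z :: 'd rvec. gauss_dens z)"
    using integrable_gauss_moment[where M = 0 and 'd = 'd] by simp
  have "0 < c * measure lborel (cball (0 :: 'd rvec) 1)"
    using \<open>0 < c\<close> content_cball_pos[of 1 "0 :: 'd rvec"] by simp
  also have "\<dots> = (\<integral>z. indicator (cball (0 :: 'd rvec) 1) z * c \<partial>lborel)" by simp
  also have "\<dots> \<le> (\<integral>z. indicator (cball (0 :: 'd rvec) 1) z * gauss_dens z \<partial>lborel)"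
  proof (rule integral_mono)
    show "integrable lborel (\<lambda>z :: 'd rvec. indicator (cball 0 1) z * c)"
      using emeasure_lborel_cball_finite[of "0 :: 'd rvec" 1]
      by (intro integrable_mult_left integrable_real_indicator) auto
    show "integrable lborel (\<lambda>z :: 'd rvec. indicator (cball 0 1) z * gauss_dens z)"
      using integrable_mult_indicator[OF _ int, of "cball 0 1"] by simp
    show "indicator (cball 0 1) z * c \<le> indicator (cball 0 1) z * gauss_dens z" for z :: "'d rvec"
    proof (cases "norm z \<le> 1")
      case True
      then have "(norm z)\<^sup>2 \<le> 1" by (simp add: power_le_one)
      then have "c \<le> gauss_dens z" unfolding c_def gauss_dens_exp by (intro mult_left_mono) auto
      then show ?thesis by (simp add: mult_left_mono)
    qed (simp add: indicator_def)
  qed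
  finally show ?thesis by simp
qed

text \<open>The condition \<open>E \<le> c / 2\<close> keeps \<open>x\<close> above
  \<open>c / 2\<close>, where the logarithm has Lipschitz constant \<open>2 / c\<close>.\<close>

lemma abs_ln_diff_le:
  fixes x y c E :: real
  assumes "c \<le> y" "0 < c" "\<bar>x - y\<bar> \<le> E" "E \<le> c / 2"
  shows "0 < x" "\<bar>ln x - ln y\<bar> \<le> 2 * E / c"
proof -
  have x: "c / 2 \<le> x" using assms by linarith
  then show "0 < x" using assms by linarith
  have *: "ln u - ln v \<le> 2 * E / c" if "c / 2 \<le> u" "c / 2 \<le> v" "\<bar>u - v\<bar> \<le> E" for u v :: real
  proof -
    have "ln u - ln v \<le> (u - v) / v" using that assms(2) by (intro ln_diff_le) auto
    also have "\<dots> \<le> E / v" using that assms(2) by (intro divide_right_mono) auto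
    also have "\<dots> \<le> E / (c / 2)" using that assms(2) by (intro divide_left_mono) auto
    finally show ?thesis by (simp add: field_simps)
  qed
  show "\<bar>ln x - ln y\<bar> \<le> 2 * E / c"
    using *[of x y] *[of y x] x assms by (auto simp: abs_if split: if_splits)
qed

context laplace_group
begin

section \<open>Integral against quadrature sum for one group\<close>

lemma Zpos: "0 < \<rho> * sqrt \<mu>" using Z(1) by linarith

lemma AI: "norm z \<le> \<rho> * sqrt \<mu> \<Longrightarrow> z \<in> A"
proof -
  assume "norm z \<le> \<rho> * sqrt \<mu>"
  then have "sqrt \<mu> * norm (L *v z) \<le> sqrt \<mu> * \<rho>" using L_norm[of z] by (simp add: mult.commute)
  then show ?thesis using lam by (simp add: A_def)
qed

lemma J_meas [measurable]: "J \<in> borel_measurable borel"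
  using borel_measurable_integrable[OF J_int] by simp

lemma L_meas [measurable]: "(\<lambda>z. L *v z) \<in> borel_measurable borel"
  by (intro borel_measurable_continuous_onI linear_continuous_on) (rule matrix_vector_mul_bounded_linear)

lemma A_meas [measurable]: "A \<in> sets borel"
  unfolding A_def by measurable

lemma psi_meas [measurable]: "\<psi> \<in> borel_measurable borel"
  unfolding \<psi>_def by measurable

lemma P_meas [measurable]: "P \<in> borel_measurable borel"
  by (rule poly_fun_measurable[OF P_poly])

lemma psi_nonneg: "0 \<le> \<psi> z" using J_nonneg Jm cd1 by (simp add: \<psi>_def)

lemma gauss_int: "integrable lborel (gauss_dens :: 'd rvec \<Rightarrow> real)"
  using integrable_gauss_moment[where M = 0 and 'd = 'd] by simp

lemma psi_le: "z \<in> A \<Longrightarrow> \<psi> z \<le> 3 * gauss_dens z"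
proof -
  assume "z \<in> A"
  then obtain R where R: "\<psi> z = gauss_dens z * exp R" "\<bar>R\<bar> \<le> 1" using psi_near by blast
  have "exp R \<le> 3" using order_trans[OF _ exp_le, of "exp R"] R(2) by simp
  then show ?thesis using R(1) gauss_dens_pos[of z] by (simp add: mult.commute)
qed

lemma psi_ge: "z \<in> A \<Longrightarrow> exp (- 1) * gauss_dens z \<le> \<psi> z"
proof -
  assume "z \<in> A"
  then obtain R where R: "\<psi> z = gauss_dens z * exp R" "\<bar>R\<bar> \<le> 1" using psi_near by blast
  then show ?thesis using gauss_dens_pos[of z] by (simp add: mult.commute)
qed

lemma psi_P: "z \<in> A \<Longrightarrow> \<bar>\<psi> z - gauss_dens z * P z\<bar> \<le> gauss_dens z * (5 * 4 ^ r * a ^ (2 * r))"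
proof -
  assume "z \<in> A"
  then obtain R where R: "\<psi> z = gauss_dens z * exp R" "\<bar>exp R - P z\<bar> \<le> 5 * 4 ^ r * a ^ (2 * r)"
    using psi_near by blast
  have "\<bar>\<psi> z - gauss_dens z * P z\<bar> = gauss_dens z * \<bar>exp R - P z\<bar>"
    using gauss_dens_pos[of z] by (simp add: R(1) abs_mult right_diff_distrib[symmetric])
  also have "\<dots> \<le> gauss_dens z * (5 * 4 ^ r * a ^ (2 * r))"
    using R(2) gauss_dens_pos[of z] by (intro mult_left_mono) auto
  finally show ?thesis .
qed

lemma psi_int: "integrable lborel (\<lambda>z. indicator A z * \<psi> z)"
proof (rule Bochner_Integration.integrable_bound)
  show "integrable lborel (\<lambda>z :: 'd rvec. 3 * gauss_dens z)" using gauss_int by simp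
  show "AE z in lborel. norm (indicator A z * \<psi> z) \<le> norm (3 * gauss_dens z)"
    using psi_nonneg by (intro AE_I2) (auto simp: indicator_def intro: order_trans[OF psi_le abs_ge_self])
qed measurable

lemma P_int: "integrable lborel (\<lambda>z. gauss_dens z * P z)"
  by (rule integrable_gauss_poly[OF P_poly])

lemma P_int_ind: "integrable lborel (\<lambda>z. indicator S z * (gauss_dens z * P z))" if "S \<in> sets borel" for S
  using integrable_mult_indicator[OF _ P_int, of S] that by simp

text \<open>Outside \<open>A\<close> the factor
  \<open>((1 + norm z) / (\<rho> * sqrt \<mu>)) ^ N\<close> is at least 1 and may be inserted under
  the integral. As \<open>\<rho> * sqrt \<mu>\<close> will grow like a power of the group size, a
  large \<open>N\<close> yields any desired rate from Gaussian moments alone.\<close>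

lemma P_tail:
  "\<bar>\<integral>z. indicator (- A) z * (gauss_dens z * P z) \<partial>lborel\<bar>
    \<le> real (2 * r) * 4 ^ r * (\<integral>z. gauss_dens z * (1 + norm z) ^ (6 * r + N) \<partial>(lborel :: 'd rvec measure)) / (\<rho> * sqrt \<mu>) ^ N"
proof -
  define K where "K = real (2 * r) * 4 ^ r / (\<rho> * sqrt \<mu>) ^ N"
  have "\<bar>\<integral>z. indicator (- A) z * (gauss_dens z * P z) \<partial>lborel\<bar>
      \<le> (\<integral>z. \<bar>indicator (- A) z * (gauss_dens z * P z)\<bar> \<partial>lborel)" by (rule integral_abs_bound)
  also have "\<dots> \<le> (\<integral>z. K * (gauss_dens z * (1 + norm z) ^ (6 * r + N)) \<partial>(lborel :: 'd rvec measure))"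
  proof (rule integral_mono)
    show "integrable lborel (\<lambda>z. \<bar>indicator (- A) z * (gauss_dens z * P z)\<bar>)"
      by (intro integrable_abs P_int_ind) auto
    show "integrable lborel (\<lambda>z :: 'd rvec. K * (gauss_dens z * (1 + norm z) ^ (6 * r + N)))"
      by (intro integrable_mult_right integrable_gauss_moment)
    fix z
    have K0: "0 \<le> K" using Zpos by (simp add: K_def)
    show "\<bar>indicator (- A) z * (gauss_dens z * P z)\<bar> \<le> K * (gauss_dens z * (1 + norm z) ^ (6 * r + N))"
    proof (cases "z \<in> A")
      case True
      then show ?thesis using K0 gauss_dens_pos[of z, THEN less_imp_le] by simp
    next
      case False
      then have "\<rho> * sqrt \<mu> \<le> 1 + norm z" using AI[of z] by linarith
      then have "(\<rho> * sqrt \<mu>) ^ N \<le> (1 + norm z) ^ N" using Zpos by (intro power_mono) auto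
      then have "1 \<le> (1 + norm z) ^ N / (\<rho> * sqrt \<mu>) ^ N" using Zpos by (simp add: pos_le_divide_eq)
      then have "real (2 * r) * 4 ^ r * (1 + norm z) ^ (6 * r) * 1
          \<le> real (2 * r) * 4 ^ r * (1 + norm z) ^ (6 * r) * ((1 + norm z) ^ N / (\<rho> * sqrt \<mu>) ^ N)"
        by (intro mult_left_mono) auto
      then have "\<bar>P z\<bar> \<le> K * (1 + norm z) ^ (6 * r + N)"
        using P_bound[of z] by (simp add: K_def power_add mult_ac)
      then have "gauss_dens z * \<bar>P z\<bar> \<le> gauss_dens z * (K * (1 + norm z) ^ (6 * r + N))"
        using gauss_dens_pos[of z, THEN less_imp_le] by (rule mult_left_mono)
      then show ?thesis using False gauss_dens_pos[of z, THEN less_imp_le]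
        by (simp add: abs_mult mult.left_commute)
    qed
  qed
  also have "\<dots> = K * (\<integral>z. gauss_dens z * (1 + norm z) ^ (6 * r + N) \<partial>(lborel :: 'd rvec measure))" by simp
  finally show ?thesis by (simp add: K_def)
qed

text \<open>Integral and sum are both compared with those of \<open>gauss_dens * P\<close>, for
  which the rule is exact. The nodes lie in \<open>A\<close> by assumption \<open>Z\<close>, so the
  only part without a counterpart is the integral of \<open>gauss_dens * P\<close> outside
  \<open>A\<close>.\<close>

lemma quadrature_error_near:
  "\<bar>(\<Sum>z\<in>Q. \<psi> z * \<omega> z) - (\<integral>z. indicator A z * \<psi> z \<partial>lborel)\<bar>
    \<le> 5 * 4 ^ r * a ^ (2 * r) * ((\<Sum>z\<in>Q. gauss_dens z * \<bar>\<omega> z\<bar>) + (\<integral>z. gauss_dens z \<partial>(lborel :: 'd rvec measure)))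
      + real (2 * r) * 4 ^ r * (\<integral>z. gauss_dens z * (1 + norm z) ^ (6 * r + N) \<partial>(lborel :: 'd rvec measure)) / (\<rho> * sqrt \<mu>) ^ N"
proof -
  define E where "E = 5 * 4 ^ r * a ^ (2 * r)"
  have E0: "0 \<le> E" using a0 by (simp add: E_def)
  have 1: "\<bar>\<Sum>z\<in>Q. (\<psi> z - gauss_dens z * P z) * \<omega> z\<bar> \<le> E * (\<Sum>z\<in>Q. gauss_dens z * \<bar>\<omega> z\<bar>)"
    unfolding sum_distrib_left
  proof (intro order_trans[OF sum_abs] sum_mono)
    fix z assume "z \<in> Q"
    then have "\<bar>\<psi> z - gauss_dens z * P z\<bar> \<le> gauss_dens z * E" unfolding E_def using Z(2) by (intro psi_P AI)
    then have "\<bar>\<psi> z - gauss_dens z * P z\<bar> * \<bar>\<omega> z\<bar> \<le> gauss_dens z * E * \<bar>\<omega> z\<bar>" by (rule mult_right_mono) simp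
    then show "\<bar>(\<psi> z - gauss_dens z * P z) * \<omega> z\<bar> \<le> E * (gauss_dens z * \<bar>\<omega> z\<bar>)"
      by (simp add: abs_mult mult_ac)
  qed
  have 2: "\<bar>\<integral>z. indicator A z * \<psi> z - indicator A z * (gauss_dens z * P z) \<partial>lborel\<bar> \<le> E * (\<integral>z. gauss_dens z \<partial>(lborel :: 'd rvec measure))"
  proof -
    have "\<bar>\<integral>z. indicator A z * \<psi> z - indicator A z * (gauss_dens z * P z) \<partial>lborel\<bar>
      \<le> (\<integral>z. \<bar>indicator A z * \<psi> z - indicator A z * (gauss_dens z * P z)\<bar> \<partial>lborel)" by (rule integral_abs_bound)
    also have "\<dots> \<le> (\<integral>z. E * gauss_dens z \<partial>(lborel :: 'd rvec measure))"
    proof (rule integral_mono)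
      show "integrable lborel (\<lambda>z. \<bar>indicator A z * \<psi> z - indicator A z * (gauss_dens z * P z)\<bar>)"
        by (intro integrable_abs Bochner_Integration.integrable_diff psi_int P_int_ind) auto
      show "integrable lborel (\<lambda>z :: 'd rvec. E * gauss_dens z)" using gauss_int by simp
      show "\<bar>indicator A z * \<psi> z - indicator A z * (gauss_dens z * P z)\<bar> \<le> E * gauss_dens z" for z
        using psi_P[of z, folded E_def] E0 gauss_dens_pos[of z, THEN less_imp_le]
        by (cases "z \<in> A") (auto simp: mult.commute)
    qed
    finally show ?thesis by simp
  qed
  have 3: "(\<integral>z. gauss_dens z * P z \<partial>lborel)
      = (\<integral>z. indicator A z * (gauss_dens z * P z) \<partial>lborel) + (\<integral>z. indicator (- A) z * (gauss_dens z * P z) \<partial>lborel)"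
  proof -
    have "(\<integral>z. gauss_dens z * P z \<partial>lborel)
      = (\<integral>z. indicator A z * (gauss_dens z * P z) + indicator (- A) z * (gauss_dens z * P z) \<partial>lborel)"
      by (intro Bochner_Integration.integral_cong) (auto simp: indicator_def)
    also have "\<dots> = (\<integral>z. indicator A z * (gauss_dens z * P z) \<partial>lborel) + (\<integral>z. indicator (- A) z * (gauss_dens z * P z) \<partial>lborel)"
      by (intro Bochner_Integration.integral_add P_int_ind) auto
    finally show ?thesis .
  qed
  have 4: "(\<integral>z. indicator A z * \<psi> z - indicator A z * (gauss_dens z * P z) \<partial>lborel)
      = (\<integral>z. indicator A z * \<psi> z \<partial>lborel) - (\<integral>z. indicator A z * (gauss_dens z * P z) \<partial>lborel)"
    by (intro Bochner_Integration.integral_diff psi_int P_int_ind) auto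
  have 5: "(\<Sum>z\<in>Q. (\<psi> z - gauss_dens z * P z) * \<omega> z) = (\<Sum>z\<in>Q. \<psi> z * \<omega> z) - (\<Sum>z\<in>Q. gauss_dens z * P z * \<omega> z)"
    by (simp add: left_diff_distrib sum_subtractf)
  show ?thesis
    using 1 2 3 P_tail[of N] P_exact unfolding 4 5 E_def[symmetric] distrib_left by linarith
qed

lemma near_integral: "(\<integral>u. indicator (cball m \<rho>) u * J u \<partial>lborel) = nrm * (\<integral>z. indicator A z * \<psi> z \<partial>lborel)"
proof -
  have "(\<integral>u. indicator (cball m \<rho>) u * J u \<partial>lborel)
      = det L * (\<integral>z. indicator (cball m \<rho>) (L *v z + m) * J (L *v z + m) \<partial>lborel)"
  proof (rule integral_lborel_lower_triangular[OF Lfacts(1,2)])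
    show "(\<lambda>u. indicator (cball m \<rho>) u * J u) \<in> borel_measurable borel"
      by (intro borel_measurable_times J_meas borel_measurable_indicator) simp
    show "0 \<le> indicator (cball m \<rho>) u * J u" for u by (rule mult_nonneg_nonneg[OF indicator_pos_le J_nonneg])
  qed
  also have "(\<integral>z. indicator (cball m \<rho>) (L *v z + m) * J (L *v z + m) \<partial>lborel)
      = (\<integral>z. (J m * cd) * (indicator A z * \<psi> z) \<partial>lborel)"
  proof (rule Bochner_Integration.integral_cong)
    fix z
    have "L *v z + m \<in> cball m \<rho> \<longleftrightarrow> z \<in> A" by (simp add: A_def dist_norm norm_minus_commute)
    then show "indicator (cball m \<rho>) (L *v z + m) * J (L *v z + m) = (J m * cd) * (indicator A z * \<psi> z)"
      using Jm cd1 by (simp add: \<psi>_def indicator_def)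
  qed simp
  finally show ?thesis by (simp add: nrm_def mult_ac)
qed

text \<open>Only the second-order expansion is used, with the Hessian bound at an intermediate
  point; the estimate therefore holds on the whole ball and not just within \<rho> of the
  mode.\<close>

lemma J_decay: "u \<in> ball u0 \<delta> \<Longrightarrow> J u \<le> J m * exp (- \<mu> * (norm (u - m))\<^sup>2 / 2)"
proof -
  assume u: "u \<in> ball u0 \<delta>"
  define v where "v = u - m"
  have seg: "m + s *\<^sub>R v \<in> ball u0 \<delta>" if "0 \<le> s" "s \<le> 1" for s
  proof -
    have "m + s *\<^sub>R v = (1 - s) *\<^sub>R m + s *\<^sub>R u" by (simp add: v_def algebra_simps)
    then show ?thesis using convexD[OF convex_ball mB u, of "1 - s" s] that by simp
  qed
  have C2: "Ck_on 2 (ball u0 \<delta>) f" using Ck_on_mono[OF C, of 2] r1 by (simp add: f_def)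
  have "\<exists>s. 0 < s \<and> s < 1 \<and> f (m + v) = (\<Sum>j<2. line_deriv j f m v / fact j) + line_deriv 2 f (m + s *\<^sub>R v) v / fact 2"
    by (rule Taylor_line[OF C2 open_ball seg]) auto
  then obtain s where s: "0 < s" "s < 1" "f (m + v) = (\<Sum>j<2. line_deriv j f m v / fact j) + line_deriv 2 f (m + s *\<^sub>R v) v / fact 2"
    by blast
  have "line_deriv 1 f m v = 0"
  proof (rule line_deriv_1_local_max[OF C2 _ open_ball mB])
    show "f y \<le> f m" if "y \<in> ball u0 \<delta>" for y using J_pos[OF that] J_max[of y] by (simp add: f_def)
  qed simp
  then have "f u = f m + line_deriv 2 f (m + s *\<^sub>R v) v / 2"
    using s(3) by (simp add: v_def numeral_2_eq_2)
  moreover have "\<mu> * (norm v)\<^sup>2 \<le> - line_deriv 2 f (m + s *\<^sub>R v) v"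
    using Hs[of "m + s *\<^sub>R v" v] seg[of s] s by (simp add: line_deriv_2 f_def)
  ultimately have "f u \<le> f m - \<mu> * (norm v)\<^sup>2 / 2" by linarith
  then have "exp (f u) \<le> exp (f m) * exp (- \<mu> * (norm v)\<^sup>2 / 2)" by (simp flip: exp_add)
  then show ?thesis using J_pos[OF u] Jm by (simp add: f_def v_def)
qed

lemma J_int_ind: "S \<in> sets borel \<Longrightarrow> integrable lborel (\<lambda>u. indicator S u * J u)"
  using integrable_mult_indicator[OF _ J_int, of S] by simp

text \<open>The region too far from the mode for the full Taylor expansion, but where the assumption
  \<open>tail\<close> does not apply yet.\<close>

lemma mid_integral:
  "(\<integral>u. indicator (ball u0 \<delta> - cball m \<rho>) u * J u \<partial>lborel)
    \<le> J m * (exp (- \<mu> * \<rho>\<^sup>2 / 2) * measure lborel (ball (0 :: 'd rvec) \<delta>))"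
proof -
  have "(\<integral>u. indicator (ball u0 \<delta> - cball m \<rho>) u * J u \<partial>lborel)
    \<le> (\<integral>u. indicator (ball u0 \<delta>) u * (J m * exp (- \<mu> * \<rho>\<^sup>2 / 2)) \<partial>lborel)"
  proof (rule integral_mono)
    show "integrable lborel (\<lambda>u. indicator (ball u0 \<delta> - cball m \<rho>) u * J u)" by (rule J_int_ind) auto
    show "integrable lborel (\<lambda>u. indicator (ball u0 \<delta>) u * (J m * exp (- \<mu> * \<rho>\<^sup>2 / 2)))"
      using emeasure_lborel_ball_finite[of u0 \<delta>]
      by (intro integrable_mult_left integrable_real_indicator) auto
    fix u
    show "indicator (ball u0 \<delta> - cball m \<rho>) u * J u \<le> indicator (ball u0 \<delta>) u * (J m * exp (- \<mu> * \<rho>\<^sup>2 / 2))"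
    proof (cases "u \<in> ball u0 \<delta> - cball m \<rho>")
      case True
      then have "\<rho> \<le> norm (u - m)" by (simp add: dist_norm norm_minus_commute)
      then have "\<rho>\<^sup>2 \<le> (norm (u - m))\<^sup>2" using rho by (intro power_mono) auto
      then have "exp (- \<mu> * (norm (u - m))\<^sup>2 / 2) \<le> exp (- \<mu> * \<rho>\<^sup>2 / 2)" using lam by simp
      then have "J m * exp (- \<mu> * (norm (u - m))\<^sup>2 / 2) \<le> J m * exp (- \<mu> * \<rho>\<^sup>2 / 2)"
        using Jm by (intro mult_left_mono) auto
      then show ?thesis using True J_decay[of u] by simp
    next
      case False
      then have "indicator (ball u0 \<delta> - cball m \<rho>) u = (0 :: real)" by simp
      then show ?thesis using Jm by simp
    qed
  qed
  also have "\<dots> = J m * exp (- \<mu> * \<rho>\<^sup>2 / 2) * measure lborel (ball u0 \<delta>)" by simp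
  also have "measure lborel (ball u0 \<delta>) = measure lborel (ball (0 :: 'd rvec) \<delta>)"
    using rho by (simp add: content_ball_conv_unit_ball[of \<delta> u0] content_ball_conv_unit_ball[of \<delta> 0])
  finally show ?thesis by (simp add: mult.assoc)
qed

text \<open>The space splits into \<open>cball m \<rho>\<close>, the rest of
  \<open>ball u0 \<delta>\<close> and the complement; the last two make up \<open>T\<close>. After
  division by \<open>nrm\<close> the marginal becomes \<open>y = T / nrm + SI\<close> and the
  quadrature value \<open>Sq\<close>, and their logarithms are compared at a level of at least
  \<open>c0 / 2\<close>.\<close>

lemma quadrature_error:
  fixes N :: nat and E :: real
  defines "c0 \<equiv> exp (- 1) * (\<integral>z. indicator (cball 0 1) z * gauss_dens z \<partial>(lborel :: 'd rvec measure))"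
  assumes E: "5 * 4 ^ r * a ^ (2 * r) * ((\<Sum>z\<in>Q. gauss_dens z * \<bar>\<omega> z\<bar>) + (\<integral>z. gauss_dens z \<partial>(lborel :: 'd rvec measure)))
      + real (2 * r) * 4 ^ r * (\<integral>z. gauss_dens z * (1 + norm z) ^ (6 * r + N) \<partial>(lborel :: 'd rvec measure)) / (\<rho> * sqrt \<mu>) ^ N
      + (\<tau> + exp (- \<mu> * \<rho>\<^sup>2 / 2) * measure lborel (ball (0 :: 'd rvec) \<delta>)) * (1 + fact CARD('d) * \<Lambda> ^ CARD('d)) \<le> E"
    and "E \<le> c0 / 2"
  shows "0 < det L * (\<Sum>z\<in>Q. J (L *v z + m) * \<omega> z)" "0 < (\<integral>u. J u \<partial>lborel)"
    "\<bar>ln (det L * (\<Sum>z\<in>Q. J (L *v z + m) * \<omega> z)) - ln (\<integral>u. J u \<partial>lborel)\<bar> \<le> 2 * E / c0"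
proof -
  define B where "B = ball u0 \<delta>"
  define SI where "SI = (\<integral>z. indicator A z * \<psi> z \<partial>lborel)"
  define Sq where "Sq = (\<Sum>z\<in>Q. \<psi> z * \<omega> z)"
  define T where "T = (\<integral>u. indicator (- B) u * J u \<partial>lborel) + (\<integral>u. indicator (B - cball m \<rho>) u * J u \<partial>lborel)"
  define V where "V = exp (- \<mu> * \<rho>\<^sup>2 / 2) * measure lborel (ball (0 :: 'd rvec) \<delta>)"
  have sub: "cball m \<rho> \<subseteq> B"
  proof
    fix u assume "u \<in> cball m \<rho>"
    then have "norm (u - m) < \<delta> / 2" using rho by (simp add: dist_norm norm_minus_commute)
    from nearB[OF this] show "u \<in> B" by (simp add: B_def)
  qed
  have mB: "B \<in> sets borel" by (simp add: B_def)
  have "(\<integral>u. J u \<partial>lborel) = (\<integral>u. (indicator (- B) u * J u + indicator (B - cball m \<rho>) u * J u) + indicator (cball m \<rho>) u * J u \<partial>lborel)"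
    using sub by (intro Bochner_Integration.integral_cong) (auto simp: indicator_def)
  also have "\<dots> = T + (\<integral>u. indicator (cball m \<rho>) u * J u \<partial>lborel)"
    unfolding T_def using mB
    by (subst Bochner_Integration.integral_add, (intro Bochner_Integration.integrable_add J_int_ind; simp)+)
      (subst Bochner_Integration.integral_add, (intro J_int_ind; simp)+, simp)
  finally have total: "(\<integral>u. J u \<partial>lborel) = T + nrm * SI" by (simp add: near_integral SI_def)
  have T0: "0 \<le> T" unfolding T_def using J_nonneg by (intro add_nonneg_nonneg integral_nonneg_AE) auto
  have T1: "T \<le> J m * (\<tau> + V)"
    using tail mid_integral unfolding T_def B_def V_def by (simp add: algebra_simps)
  \<comment> \<open>The sign of \<open>\<tau>\<close> is not assumed; that of the sum follows from
    \<open>T\<close> being nonnegative.\<close>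
  have tV: "0 \<le> \<tau> + V" using T0 T1 Jm by (metis mult_less_0_iff not_le order_trans)
  have Tn: "T / nrm \<le> (\<tau> + V) * (1 + fact CARD('d) * \<Lambda> ^ CARD('d))"
  proof -
    have "T / nrm \<le> J m * (\<tau> + V) / nrm" using T1 nrm_pos by (intro divide_right_mono) auto
    also have "\<dots> = (\<tau> + V) * (1 / det L) * (1 / cd)" using Jm by (simp add: nrm_def)
    also have "\<dots> \<le> (\<tau> + V) * (1 / det L) * 1"
    proof (rule mult_left_mono)
      show "0 \<le> (\<tau> + V) * (1 / det L)" using tV det_L by simp
    qed (use cd1 in simp)
    also have "\<dots> \<le> (\<tau> + V) * (1 + fact CARD('d) * \<Lambda> ^ CARD('d))"
      using mult_left_mono[OF inv_det_L tV] by simp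
    finally show ?thesis .
  qed
  have aq: "det L * (\<Sum>z\<in>Q. J (L *v z + m) * \<omega> z) = nrm * Sq"
  proof -
    have "J (L *v z + m) = J m * cd * \<psi> z" for z using Jm cd1 by (simp add: \<psi>_def)
    then show ?thesis by (simp add: nrm_def Sq_def sum_distrib_left mult_ac)
  qed
  define y where "y = T / nrm + SI"
  have y: "(\<integral>u. J u \<partial>lborel) = nrm * y" using nrm_pos by (simp add: total y_def distrib_left)
  have "c0 \<le> SI"
  proof -
    have "c0 = (\<integral>z. exp (- 1) * (indicator (cball 0 1) z * gauss_dens z) \<partial>(lborel :: 'd rvec measure))" by (simp add: c0_def)
    also have "\<dots> \<le> SI" unfolding SI_def
    proof (rule integral_mono)
      show "integrable lborel (\<lambda>z :: 'd rvec. exp (- 1) * (indicator (cball 0 1) z * gauss_dens z))"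
        using integrable_mult_indicator[OF _ gauss_int, of "cball 0 1"] by (intro integrable_mult_right) simp
      show "integrable lborel (\<lambda>z. indicator A z * \<psi> z)" by (rule psi_int)
      fix z :: "'d rvec"
      show "exp (- 1) * (indicator (cball 0 1) z * gauss_dens z) \<le> indicator A z * \<psi> z"
      proof (cases "norm z \<le> 1")
        case True
        then have "z \<in> A" using Z(1) by (intro AI) linarith
        then show ?thesis using True psi_ge[of z] by simp
      next
        case False
        then show ?thesis using psi_nonneg[of z] by (simp add: indicator_def)
      qed
    qed
    finally show ?thesis .
  qed
  then have cy: "c0 \<le> y" using T0 nrm_pos by (simp add: y_def add_increasing)
  have c0: "0 < c0" unfolding c0_def by (rule exp_neg_one_gauss_pos)
  have diff: "\<bar>Sq - y\<bar> \<le> E"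
    using quadrature_error_near[of N] Tn E T0 nrm_pos divide_nonneg_pos[OF T0 nrm_pos]
    unfolding Sq_def[symmetric] SI_def[symmetric] V_def[symmetric] y_def by linarith
  note ln = abs_ln_diff_le[OF cy c0 diff \<open>E \<le> c0 / 2\<close>]
  show "0 < det L * (\<Sum>z\<in>Q. J (L *v z + m) * \<omega> z)" unfolding aq using ln(1) nrm_pos by simp
  show "0 < (\<integral>u. J u \<partial>lborel)" unfolding y using cy c0 nrm_pos by simp
  show "\<bar>ln (det L * (\<Sum>z\<in>Q. J (L *v z + m) * \<omega> z)) - ln (\<integral>u. J u \<partial>lborel)\<bar> \<le> 2 * E / c0"
    unfolding aq y using ln nrm_pos cy c0 by (simp add: ln_mult)
qed

end

section \<open>Asymptotics\<close>

lemma powr_exp_neg_powr_tendsto_0: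
  fixes p c s :: real
  assumes "0 < c" "0 < s"
  shows "((\<lambda>x. x powr p * exp (- c * x powr s)) \<longlongrightarrow> 0) at_top"
  using assms by real_asymp

lemma powr_neg_tendsto_0: "p < 0 \<Longrightarrow> ((\<lambda>x :: real. x powr p) \<longlongrightarrow> 0) at_top"
  by (rule tendsto_neg_powr[OF _ filterlim_ident])

lemma eventually_mult_powr_le:
  fixes g :: "real \<Rightarrow> real"
  assumes "((\<lambda>x. g x * x powr (- p)) \<longlongrightarrow> 0) at_top" "0 < c"
  shows "\<forall>\<^sub>F x in at_top. g x \<le> c * x powr p"
proof -
  have "\<forall>\<^sub>F x in at_top. g x * x powr (- p) < c" using order_tendstoD(2)[OF assms] .
  then show ?thesis using eventually_gt_at_top[of 0]
  proof eventually_elim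
    case (elim x)
    then have "g x * x powr (- p) * x powr p \<le> c * x powr p" by (intro mult_right_mono) auto
    then show ?case using elim(2) by (simp add: mult.assoc flip: powr_add)
  qed
qed

text \<open>\<open>\<rho> x * sqrt (\<mu> x)\<close> has order
  \<open>x powr (\<epsilon> / 2)\<close> and tends to infinity.
  \<open>\<Lambda> x * \<rho> x ^ 3\<close> has order
  \<open>x powr (- 1 / 2 + 4 * \<epsilon>)\<close>, which dictates \<open>a\<close>; its constant is
  the sum of those of the two quantities it dominates. Then \<open>a x ^ (2 * r)\<close> has
  exponent \<open>- r + 8 * r * \<epsilon>\<close>, which must be below
  \<open>- r + \<epsilon>'\<close>, and \<open>N * \<epsilon> / 2 \<ge> r\<close> settles the
  polynomial tail.\<close>

lemma group_asymptotics:
  fixes K \<eta> b \<delta> c1 \<epsilon> \<epsilon>' CQ CM V F B c0 :: real and r d N :: nat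
  assumes pos: "0 < K" "0 < \<eta>" "0 < b" "0 < \<delta>" "0 < c1" "0 < c0"
    and eps: "0 < \<epsilon>" "\<epsilon> \<le> 1 / 32" "8 * real r * \<epsilon> < \<epsilon>'" "\<epsilon>' \<le> 1 / 2" "1 \<le> r" "real r \<le> real N * \<epsilon> / 2"
  defines "\<Lambda> \<equiv> \<lambda>x. x powr (1 + \<epsilon>) * K" and "\<mu> \<equiv> \<lambda>x. x powr (1 - \<epsilon>) * \<eta>"
    and "\<rho> \<equiv> \<lambda>x. x powr (- 1 / 2 + \<epsilon>)" and "a \<equiv> \<lambda>x. (K * real d ^ 3 + real d) * x powr (- 1 / 2 + 4 * \<epsilon>)"
    and "\<tau> \<equiv> \<lambda>x. exp (- (x powr (1 - \<epsilon>) * b)) / c1"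
  shows "\<forall>\<^sub>F x in at_top. 0 < \<rho> x \<and> \<rho> x < \<delta> / 2 \<and> \<Lambda> x * (real d * \<rho> x) ^ 3 \<le> a x \<and> real d * \<rho> x \<le> a x \<and> a x \<le> 1 / 8 \<and>
    \<Lambda> x * (real d / sqrt (\<mu> x)) ^ 3 \<le> 1 \<and> real d / sqrt (\<mu> x) \<le> 1 \<and> max 1 B \<le> \<rho> x * sqrt (\<mu> x) \<and>
    CQ * a x ^ (2 * r) + CM / (\<rho> x * sqrt (\<mu> x)) ^ N + (\<tau> x + exp (- \<mu> x * (\<rho> x)\<^sup>2 / 2) * V) * (1 + F * \<Lambda> x ^ d)
      \<le> c0 / 4 * x powr (- real r + \<epsilon>') \<and>
    c0 / 4 * x powr (- real r + \<epsilon>') \<le> c0 / 2"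
proof -
  have pow: "(x powr p) ^ n = x powr (p * real n)" if "0 < x" for x p :: real and n :: nat
    using that by (simp add: powr_power mult.commute)
  have smu: "sqrt (\<mu> x) = sqrt \<eta> * x powr ((1 - \<epsilon>) / 2)" if "0 < x" for x
    using that by (simp add: \<mu>_def real_sqrt_mult powr_half_sqrt_powr)
  have rm: "\<rho> x * sqrt (\<mu> x) = sqrt \<eta> * x powr (\<epsilon> / 2)" if "0 < x" for x
  proof -
    have "- 1 / 2 + \<epsilon> + (1 - \<epsilon>) / 2 = \<epsilon> / 2" by (simp add: field_simps)
    then have "x powr (- 1 / 2 + \<epsilon>) * x powr ((1 - \<epsilon>) / 2) = x powr (\<epsilon> / 2)" by (simp only: powr_add[symmetric])
    then show ?thesis using that by (simp add: \<rho>_def smu)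
  qed
  have lim: "((\<lambda>x. c * x powr p) \<longlongrightarrow> 0) at_top" if "p < 0" for c p :: real
    using tendsto_mult_right_zero[OF powr_neg_tendsto_0[OF that]] .
  have ev_le: "\<forall>\<^sub>F x in at_top. c * x powr p < e" if "p < 0" "0 < e" for c p e :: real
    using order_tendstoD(2)[OF lim[OF that(1)] that(2)] .
  have e0: "\<forall>\<^sub>F x :: real in at_top. 1 \<le> x" by (rule eventually_ge_at_top)
  have e1: "\<forall>\<^sub>F x in at_top. \<rho> x < \<delta> / 2"
    using ev_le[of "- 1 / 2 + \<epsilon>" "\<delta> / 2" 1] eps pos by (simp add: \<rho>_def)
  have e2: "\<forall>\<^sub>F x in at_top. a x < 1 / 8"
    unfolding a_def using eps by (intro ev_le) auto
  have e3: "\<forall>\<^sub>F x in at_top. \<Lambda> x * (real d / sqrt (\<mu> x)) ^ 3 < 1"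
  proof -
    have "\<forall>\<^sub>F x in at_top. (K * (real d / sqrt \<eta>) ^ 3) * x powr (- 1 / 2 + 5 / 2 * \<epsilon>) < 1"
      using eps by (intro ev_le) auto
    then show ?thesis using e0
    proof eventually_elim
      case (elim x)
      have x: "0 < x" using elim by simp
      have "\<Lambda> x * (real d / sqrt (\<mu> x)) ^ 3 = (K * (real d / sqrt \<eta>) ^ 3) * (x powr (1 + \<epsilon>) / (x powr ((1 - \<epsilon>) / 2)) ^ 3)"
        using x by (simp add: \<Lambda>_def smu power_divide power_mult_distrib)
      also have "x powr (1 + \<epsilon>) / (x powr ((1 - \<epsilon>) / 2)) ^ 3 = x powr (- 1 / 2 + 5 / 2 * \<epsilon>)"
        unfolding pow[OF x] powr_diff[symmetric] by (simp add: field_simps)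
      finally show ?case using elim by simp
    qed
  qed
  have e4: "\<forall>\<^sub>F x in at_top. real d / sqrt (\<mu> x) < 1"
  proof -
    have "\<forall>\<^sub>F x in at_top. (real d / sqrt \<eta>) * x powr (- ((1 - \<epsilon>) / 2)) < 1" using eps by (intro ev_le) auto
    then show ?thesis using e0
    proof eventually_elim
      case (elim x)
      then show ?case by (simp add: smu powr_minus field_simps)
    qed
  qed
  have e5: "\<forall>\<^sub>F x in at_top. max 1 B \<le> \<rho> x * sqrt (\<mu> x)"
  proof -
    have "filterlim (\<lambda>x. sqrt \<eta> * x powr (\<epsilon> / 2)) at_top at_top" using pos(2) eps(1) by real_asymp
    then have "\<forall>\<^sub>F x in at_top. max 1 B \<le> sqrt \<eta> * x powr (\<epsilon> / 2)" unfolding filterlim_at_top by blast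
    then show ?thesis using e0 by eventually_elim (simp add: rm)
  qed
  define p where "p = - real r + \<epsilon>'"
  \<comment> \<open>Each of the three error terms gets a share \<open>c0 / 16\<close> of the
    allowance \<open>c0 / 4\<close>.\<close>
  have e6: "\<forall>\<^sub>F x in at_top. CQ * a x ^ (2 * r) \<le> c0 / 16 * x powr p"
  proof (rule eventually_mult_powr_le)
    have "((\<lambda>x. (CQ * (K * real d ^ 3 + real d) ^ (2 * r)) * x powr (8 * real r * \<epsilon> - \<epsilon>')) \<longlongrightarrow> 0) at_top"
      using eps by (intro lim) auto
    moreover have "\<forall>\<^sub>F x in at_top. (CQ * (K * real d ^ 3 + real d) ^ (2 * r)) * x powr (8 * real r * \<epsilon> - \<epsilon>') = CQ * a x ^ (2 * r) * x powr (- p)"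
      using e0
    proof eventually_elim
      case (elim x)
      have x: "0 < x" using elim by simp
      have "8 * real r * \<epsilon> - \<epsilon>' = (- 1 / 2 + 4 * \<epsilon>) * real (2 * r) + - p" by (simp add: p_def field_simps)
      then have "x powr (8 * real r * \<epsilon> - \<epsilon>') = x powr ((- 1 / 2 + 4 * \<epsilon>) * real (2 * r)) * x powr (- p)"
        by (simp only: powr_add[symmetric])
      then show ?case unfolding a_def power_mult_distrib pow[OF x] by (simp only: mult_ac)
    qed
    ultimately show "((\<lambda>x. CQ * a x ^ (2 * r) * x powr (- p)) \<longlongrightarrow> 0) at_top"
      by (rule Lim_transform_eventually)
  qed (use pos in simp)
  have e7: "\<forall>\<^sub>F x in at_top. CM / (\<rho> x * sqrt (\<mu> x)) ^ N \<le> c0 / 16 * x powr p"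
  proof (rule eventually_mult_powr_le)
    have "((\<lambda>x. (CM / sqrt \<eta> ^ N) * x powr (- (\<epsilon> / 2 * real N) - p)) \<longlongrightarrow> 0) at_top"
    proof (intro lim)
      have "0 < \<epsilon>'" using eps(1,3,5) by (smt (verit) mult_nonneg_nonneg of_nat_0_le_iff)
      then show "- (\<epsilon> / 2 * real N) - p < 0" using eps(6) by (simp add: p_def mult.commute)
    qed
    moreover have "\<forall>\<^sub>F x in at_top. (CM / sqrt \<eta> ^ N) * x powr (- (\<epsilon> / 2 * real N) - p) = CM / (\<rho> x * sqrt (\<mu> x)) ^ N * x powr (- p)"
      using e0
    proof eventually_elim
      case (elim x)
      have x: "0 < x" using elim by simp
      have "x powr (- (\<epsilon> / 2 * real N) - p) = x powr (- p) / x powr (\<epsilon> / 2 * real N)"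
      proof -
        have "- (\<epsilon> / 2 * real N) - p = - p - \<epsilon> / 2 * real N" by simp
        then show ?thesis by (simp only: powr_diff)
      qed
      then show ?case unfolding rm[OF x] power_mult_distrib pow[OF x] by simp
    qed
    ultimately show "((\<lambda>x. CM / (\<rho> x * sqrt (\<mu> x)) ^ N * x powr (- p)) \<longlongrightarrow> 0) at_top"
      by (rule Lim_transform_eventually)
  qed (use pos in simp)
  have e8: "\<forall>\<^sub>F x in at_top. (\<tau> x + exp (- \<mu> x * (\<rho> x)\<^sup>2 / 2) * V) * (1 + F * \<Lambda> x ^ d) \<le> c0 / 16 * x powr p"
  proof (rule eventually_mult_powr_le)
    \<comment> \<open>The decay is \<open>exp (- b * x powr (1 - \<epsilon>))\<close> far away and
      \<open>exp (- (\<eta> / 2) * x powr \<epsilon>)\<close> in between; both beat the powers of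
      \<open>x\<close> from \<open>\<Lambda> x ^ d\<close> and from the target rate.\<close>
    define q where "q = (1 + \<epsilon>) * real d - p"
    have ee: "0 < 1 - \<epsilon>" "0 < \<eta> / 2" using eps pos by auto
    have "((\<lambda>x. (1 / c1) * (x powr (- p) * exp (- b * x powr (1 - \<epsilon>))) + (F * K ^ d / c1) * (x powr q * exp (- b * x powr (1 - \<epsilon>)))
        + (V * (x powr (- p) * exp (- (\<eta> / 2) * x powr \<epsilon>)) + (V * (F * K ^ d)) * (x powr q * exp (- (\<eta> / 2) * x powr \<epsilon>)))) \<longlongrightarrow> 0) at_top"
      by (intro tendsto_add_zero tendsto_mult_right_zero powr_exp_neg_powr_tendsto_0 pos ee eps)
    moreover have "\<forall>\<^sub>F x in at_top. (1 / c1) * (x powr (- p) * exp (- b * x powr (1 - \<epsilon>))) + (F * K ^ d / c1) * (x powr q * exp (- b * x powr (1 - \<epsilon>)))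
        + (V * (x powr (- p) * exp (- (\<eta> / 2) * x powr \<epsilon>)) + (V * (F * K ^ d)) * (x powr q * exp (- (\<eta> / 2) * x powr \<epsilon>)))
      = (\<tau> x + exp (- \<mu> x * (\<rho> x)\<^sup>2 / 2) * V) * (1 + F * \<Lambda> x ^ d) * x powr (- p)"
      using e0
    proof eventually_elim
      case (elim x)
      have x: "0 < x" using elim by simp
      have 1: "\<mu> x * (\<rho> x)\<^sup>2 = \<eta> * x powr \<epsilon>"
      proof -
        have "1 - \<epsilon> + (- 1 / 2 + \<epsilon>) * real 2 = \<epsilon>" by simp
        then have "x powr (1 - \<epsilon>) * x powr ((- 1 / 2 + \<epsilon>) * real 2) = x powr \<epsilon>" by (simp only: powr_add[symmetric])
        then show ?thesis unfolding \<mu>_def \<rho>_def pow[OF x] by (simp only: mult_ac)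
      qed
      have 2: "\<Lambda> x ^ d * x powr (- p) = K ^ d * x powr q"
      proof -
        have "x powr q = x powr ((1 + \<epsilon>) * real d) * x powr (- p)" by (simp add: q_def flip: powr_add)
        then show ?thesis unfolding \<Lambda>_def power_mult_distrib pow[OF x] by (simp only: mult_ac)
      qed
      have "(\<tau> x + exp (- \<mu> x * (\<rho> x)\<^sup>2 / 2) * V) * (1 + F * \<Lambda> x ^ d) * x powr (- p)
        = (\<tau> x + exp (- (\<mu> x * (\<rho> x)\<^sup>2) / 2) * V) * (x powr (- p) + F * (\<Lambda> x ^ d * x powr (- p)))"
        by (simp add: algebra_simps)
      then show ?case unfolding 1 2 by (simp add: \<tau>_def algebra_simps add_divide_distrib)
    qed
    ultimately show "((\<lambda>x. (\<tau> x + exp (- \<mu> x * (\<rho> x)\<^sup>2 / 2) * V) * (1 + F * \<Lambda> x ^ d) * x powr (- p)) \<longlongrightarrow> 0) at_top"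
      by (rule Lim_transform_eventually)
  qed (use pos in simp)
  from e0 e1 e2 e3 e4 e5 e6 e7 e8 show ?thesis
  proof eventually_elim
    case (elim x)
    have x: "0 < x" using elim by simp
    have 1: "\<Lambda> x * (real d * \<rho> x) ^ 3 \<le> a x"
    proof -
      have "\<Lambda> x * (real d * \<rho> x) ^ 3 = K * real d ^ 3 * (x powr (1 + \<epsilon>) * x powr ((- 1 / 2 + \<epsilon>) * 3))"
        using x by (simp add: \<Lambda>_def \<rho>_def power_mult_distrib pow)
      also have "x powr (1 + \<epsilon>) * x powr ((- 1 / 2 + \<epsilon>) * 3) = x powr (- 1 / 2 + 4 * \<epsilon>)"
        unfolding powr_add[symmetric] by (simp add: field_simps)
      also have "K * real d ^ 3 * x powr (- 1 / 2 + 4 * \<epsilon>) \<le> a x"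
        unfolding a_def by (intro mult_right_mono) auto
      finally show ?thesis .
    qed
    have 2: "real d * \<rho> x \<le> a x"
    proof -
      have "real d * \<rho> x \<le> real d * x powr (- 1 / 2 + 4 * \<epsilon>)"
        unfolding \<rho>_def using elim(1) eps(1) by (intro mult_left_mono powr_mono) auto
      also have "\<dots> \<le> a x" unfolding a_def using pos by (intro mult_right_mono) auto
      finally show ?thesis .
    qed
    have "x powr (- real r + \<epsilon>') \<le> x powr 0" using elim(1) eps by (intro powr_mono) auto
    then have 3: "c0 / 4 * x powr (- real r + \<epsilon>') \<le> c0 / 2" using x pos(6) by (simp add: field_simps)
    have 4: "0 < \<rho> x" using x by (simp add: \<rho>_def)
    have 5: "0 \<le> c0 * x powr p" using pos(6) by simp
    show ?case
      using elim 1 2 3 4 5 unfolding p_def[symmetric] by (intro conjI) linarith+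
  qed
qed

section \<open>Events of high probability\<close>

lemma inner_prob_bounds:
  assumes "prob_space M"
  shows "0 \<le> inner_prob M A" "inner_prob M A \<le> 1"
proof -
  interpret prob_space M by fact
  have "outer_measure_of M (space M - A) \<le> emeasure M (space M)"
    using outer_measure_of_mono[of "space M - A" "space M" M] by simp
  then have "enn2real (outer_measure_of M (space M - A)) \<le> 1" by (simp add: emeasure_space_1 enn2real_leI)
  then show "0 \<le> inner_prob M A" "inner_prob M A \<le> 1" by (simp_all add: inner_prob_def)
qed

lemma inner_prob_mono:
  assumes "prob_space M" "A \<subseteq> B"
  shows "inner_prob M A \<le> inner_prob M B"
proof -
  interpret prob_space M by fact
  have "outer_measure_of M (space M - A) \<le> emeasure M (space M)"
    using outer_measure_of_mono[of "space M - A" "space M" M] by simp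
  then have "outer_measure_of M (space M - A) < top" by (simp add: emeasure_space_1 le_less_trans)
  then show ?thesis
    using outer_measure_of_mono[of "space M - B" "space M - A" M] assms(2)
    by (auto simp: inner_prob_def intro!: enn2real_mono)
qed

text \<open>The complements have measurable covers of the same outer measure, and subadditivity is
  applied to these covers.\<close>

lemma inner_prob_Int:
  assumes "prob_space M"
  shows "inner_prob M A + inner_prob M B - 1 \<le> inner_prob M (A \<inter> B)"
proof -
  interpret prob_space M by fact
  obtain E where E: "E \<in> sets M" "space M - A \<subseteq> E" "outer_measure_of M (space M - A) = emeasure M E"
    using outer_measure_of_attain[of "space M - A" M] by auto
  obtain F where F: "F \<in> sets M" "space M - B \<subseteq> F" "outer_measure_of M (space M - B) = emeasure M F"
    using outer_measure_of_attain[of "space M - B" M] by auto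
  have "outer_measure_of M (space M - A \<inter> B) \<le> emeasure M (E \<union> F)"
    using outer_measure_of_mono[of "space M - A \<inter> B" "E \<union> F" M] E F by auto
  also have "\<dots> \<le> emeasure M E + emeasure M F" by (rule emeasure_subadditive[OF E(1) F(1)])
  also have "\<dots> = ennreal (prob E + prob F)" by (simp add: emeasure_eq_measure)
  finally have "enn2real (outer_measure_of M (space M - A \<inter> B)) \<le> prob E + prob F" by (intro enn2real_leI) auto
  then show ?thesis using E(3) F(3) by (simp add: inner_prob_def emeasure_eq_measure)
qed

lemma whp_mono:
  assumes P: "\<And>s. prob_space (law (D s))" and A: "whp D A"
    and AB: "\<forall>\<^sub>F s in sequentially. \<forall>y\<in>space (law (D s)). A s y \<longrightarrow> B s y"
  shows "whp D B"
  unfolding whp_def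
proof (rule tendsto_sandwich)
  show "\<forall>\<^sub>F s in sequentially. inner_prob (law (D s)) {y \<in> space (law (D s)). A s y}
      \<le> inner_prob (law (D s)) {y \<in> space (law (D s)). B s y}"
    using AB by eventually_elim (auto intro!: inner_prob_mono P)
  show "\<forall>\<^sub>F s in sequentially. inner_prob (law (D s)) {y \<in> space (law (D s)). B s y} \<le> 1"
    using inner_prob_bounds(2)[OF P] by simp
qed (use A in \<open>auto simp: whp_def\<close>)

lemma whp_conj:
  assumes P: "\<And>s. prob_space (law (D s))" and A: "whp D A" and B: "whp D B"
  shows "whp D (\<lambda>s y. A s y \<and> B s y)"
  unfolding whp_def
proof (rule tendsto_sandwich)
  let ?p = "\<lambda>A s. inner_prob (law (D s)) {y \<in> space (law (D s)). A s y}"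
  show "(\<lambda>s. ?p A s + ?p B s - 1) \<longlonglongrightarrow> 1"
    using tendsto_diff[OF tendsto_add[OF A[unfolded whp_def] B[unfolded whp_def]] tendsto_const[of 1]] by simp
  have "{y \<in> space (law (D s)). A s y} \<inter> {y \<in> space (law (D s)). B s y} = {y \<in> space (law (D s)). A s y \<and> B s y}" for s
    by auto
  then have "?p A s + ?p B s - 1 \<le> ?p (\<lambda>s y. A s y \<and> B s y) s" for s
    using inner_prob_Int[OF P, of s "{y \<in> space (law (D s)). A s y}" "{y \<in> space (law (D s)). B s y}"] by simp
  then show "\<forall>\<^sub>F s in sequentially. ?p A s + ?p B s - 1 \<le> ?p (\<lambda>s y. A s y \<and> B s y) s" by simp
  show "\<forall>\<^sub>F s in sequentially. ?p (\<lambda>s y. A s y \<and> B s y) s \<le> 1"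
    using inner_prob_bounds(2)[OF P] by simp
qed simp

text \<open>\<open>cond_Deriv\<close> gives high probability for each multi-index separately;
  finitely many multi-indices have order at most \<open>t\<close>, so their events hold
  jointly.\<close>

lemma whp_ball:
  assumes P: "\<And>s. prob_space (law (D s))" and "finite I" and A: "\<And>a. a \<in> I \<Longrightarrow> whp D (A a)"
  shows "whp D (\<lambda>s y. \<forall>a\<in>I. A a s y)"
  using assms(2) A
proof (induction I rule: finite_induct)
  case empty
  have "inner_prob (law (D s)) (space (law (D s))) = 1" for s by (simp add: inner_prob_def)
  then show ?case by (simp add: whp_def)
next
  case (insert a I)
  then have "whp D (\<lambda>s y. A a s y \<and> (\<forall>a\<in>I. A a s y))" by (intro whp_conj P) auto
  then show ?case by simp
qed

section \<open>The mixed model\<close>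

lemma eln_le_iff: "0 < x \<Longrightarrow> eln x \<le> eln y \<longleftrightarrow> x \<le> y"
  by (auto simp: eln_def)

lemma eln_diff_le:
  assumes "0 < y" "0 \<le> x" "eln x - eln y \<le> ereal (- c)"
  shows "x \<le> y * exp (- c)"
proof (cases "x = 0")
  case False
  then have "ln x - ln y \<le> - c" using assms by (simp add: eln_def)
  then have "exp (ln x) \<le> exp (ln y + - c)" by simp
  then show ?thesis unfolding exp_add using assms False by simp
qed (use assms in simp)

lemma lik_measurable:
  assumes M: "is_mixed_model M" and D: "is_dataset M q D" and y: "y \<in> space (law D)"
    and i: "i < groups D" and \<theta>: "\<theta> \<in> params M"
  shows "(\<lambda>u. lik M D y i \<theta> u) \<in> borel_measurable borel" "0 \<le> lik M D y i \<theta> u"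
proof -
  obtain \<beta> \<phi> \<sigma> where \<theta>': "\<theta> = (\<beta>, \<phi>, \<sigma>)" by (cases \<theta>)
  have "space (law D) = space (\<Pi>\<^sub>M i\<in>{..<groups D}. \<Pi>\<^sub>M j\<in>{..<gsize D i}. resp_space M)"
    using D by (intro sets_eq_imp_space_eq) (simp add: is_dataset_def)
  then have yij: "y i j \<in> space (resp_space M)" if "j < gsize D i" for j
    using y i that by (auto simp: space_PiM PiE_def Pi_iff)
  have m: "\<And>x. (\<lambda>(u, y). cond_dens M x u \<beta> \<phi> y) \<in> borel_measurable (borel \<Otimes>\<^sub>M resp_space M)"
    and nn: "\<And>x u y. y \<in> space (resp_space M) \<Longrightarrow> 0 \<le> cond_dens M x u \<beta> \<phi> y"
    using M \<theta> unfolding is_mixed_model_def \<theta>' by fast+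
  have "(\<lambda>u. cond_dens M (covar D i j) u \<beta> \<phi> (y i j)) \<in> borel_measurable borel" if "j < gsize D i" for j
    using measurable_compose[OF measurable_Pair2'[OF yij[OF that]] m] by simp
  then show "(\<lambda>u. lik M D y i \<theta> u) \<in> borel_measurable borel"
    unfolding lik_def \<theta>' by (auto intro!: borel_measurable_prod)
  show "0 \<le> lik M D y i \<theta> u"
    unfolding lik_def \<theta>' using nn yij by (auto intro!: prod_nonneg)
qed

lemma re_dens_facts:
  assumes M: "is_mixed_model M" and \<theta>: "\<theta> \<in> params M"
  shows "re_dens M (snd (snd \<theta>)) \<in> borel_measurable borel" "0 \<le> re_dens M (snd (snd \<theta>)) u"
    "integrable lborel (re_dens M (snd (snd \<theta>)))" "(\<integral>u. re_dens M (snd (snd \<theta>)) u \<partial>lborel) = 1"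
proof -
  obtain \<beta> \<phi> \<sigma> where \<theta>': "\<theta> = (\<beta>, \<phi>, \<sigma>)" by (cases \<theta>)
  have *: "re_dens M \<sigma> \<in> borel_measurable borel" "\<And>u. 0 \<le> re_dens M \<sigma> u" "(\<integral>\<^sup>+u. ennreal (re_dens M \<sigma> u) \<partial>lborel) = 1"
    using M \<theta> unfolding is_mixed_model_def \<theta>' by fast+
  show "re_dens M (snd (snd \<theta>)) \<in> borel_measurable borel" "0 \<le> re_dens M (snd (snd \<theta>)) u"
    using * by (simp_all add: \<theta>')
  show "integrable lborel (re_dens M (snd (snd \<theta>)))"
    using * by (intro integrableI_nonneg) (auto simp: \<theta>')
  show "(\<integral>u. re_dens M (snd (snd \<theta>)) u \<partial>lborel) = 1"
    using * by (simp add: \<theta>' integral_eq_nn_integral)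
qed

text \<open>
  Outside the ball the likelihood is exponentially small compared with its value at the centre, and
  the random effects density has total mass 1.
\<close>

lemma joint_tail:
  assumes M: "is_mixed_model M" and D: "is_dataset M q D" and y: "y \<in> space (law D)"
    and i: "i < groups D" and \<theta>: "\<theta> \<in> params M"
    and pos: "\<And>u. u \<in> ball u0 \<delta> \<Longrightarrow> 0 < joint M D y i \<theta> u" and \<delta>: "0 < \<delta>"
    and far: "\<And>u. u \<in> - ball u0 \<delta> \<Longrightarrow> eln (lik M D y i \<theta> u) - eln (lik M D y i \<theta> u0) \<le> ereal (- B)"
    and c1: "0 < c1" "c1 \<le> re_dens M (snd (snd \<theta>)) u0" and max: "\<And>u. joint M D y i \<theta> u \<le> joint M D y i \<theta> m"
  shows "integrable lborel (joint M D y i \<theta>)"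
    "(\<integral>u. indicator (- ball u0 \<delta>) u * joint M D y i \<theta> u \<partial>lborel) \<le> exp (- B) / c1 * joint M D y i \<theta> m"
proof -
  define g where "g = re_dens M (snd (snd \<theta>))"
  note g = re_dens_facts[OF M \<theta>, folded g_def]
  define l where "l = lik M D y i \<theta>"
  have l: "l \<in> borel_measurable borel" "\<And>u. 0 \<le> l u" using lik_measurable[OF M D y i \<theta>] by (simp_all add: l_def)
  define J where "J = joint M D y i \<theta>"
  have J: "J u = l u * g u" for u by (simp add: J_def joint_def l_def g_def)
  have Jnn: "0 \<le> J u" for u using l g by (simp add: J)
  have "0 < J u0" unfolding J_def using \<delta> by (intro pos) simp
  then have l0: "0 < l u0" using l(2)[of u0] g(2)[of u0] by (simp add: J zero_less_mult_iff)
  have out: "J u \<le> l u0 * exp (- B) * g u" if "u \<in> - ball u0 \<delta>" for u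
    unfolding J using eln_diff_le[OF l0 l(2) far[OF that, folded l_def]] g(2) by (intro mult_right_mono) auto
  have Jm: "J \<in> borel_measurable borel" using l g unfolding J[abs_def] by simp
  have b: "integrable lborel (\<lambda>u. indicator (ball u0 \<delta>) u * J m)"
    using emeasure_lborel_ball_finite[of u0 \<delta>] by (intro integrable_mult_left integrable_real_indicator) auto
  have t: "integrable lborel (\<lambda>u. l u0 * exp (- B) * g u)" using g(3) by simp
  have tn: "0 \<le> l u0 * exp (- B) * g u" for u using l0 g(2) by simp
  show JI: "integrable lborel (joint M D y i \<theta>)"
    unfolding J_def[symmetric]
  proof (rule Bochner_Integration.integrable_bound)
    show "integrable lborel (\<lambda>u. indicator (ball u0 \<delta>) u * J m + l u0 * exp (- B) * g u)"
      using b t by (rule Bochner_Integration.integrable_add)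
    show "AE u in lborel. norm (J u) \<le> norm (indicator (ball u0 \<delta>) u * J m + l u0 * exp (- B) * g u)"
    proof (rule AE_I2)
      fix u
      show "norm (J u) \<le> norm (indicator (ball u0 \<delta>) u * J m + l u0 * exp (- B) * g u)"
        using out[of u] Jnn[of u] Jnn[of m] tn[of u] max[of u, folded J_def]
        by (cases "u \<in> ball u0 \<delta>") auto
    qed
  qed (use Jm in simp)
  have "(\<integral>u. indicator (- ball u0 \<delta>) u * J u \<partial>lborel) \<le> (\<integral>u. l u0 * exp (- B) * g u \<partial>lborel)"
  proof (rule integral_mono)
    show "integrable lborel (\<lambda>u. indicator (- ball u0 \<delta>) u * J u)"
      using integrable_mult_indicator[OF _ JI, of "- ball u0 \<delta>"] by (simp add: J_def)
    show "indicator (- ball u0 \<delta>) u * J u \<le> l u0 * exp (- B) * g u" for u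
      using out[of u] tn[of u] by (cases "u \<in> ball u0 \<delta>") auto
  qed (rule t)
  also have "\<dots> = exp (- B) * l u0" using g(4) by simp
  \<comment> \<open>The tail is measured against the likelihood at \<open>u0\<close>; the lower
    bound \<open>c1\<close> of the density at \<open>u0\<close> and maximality of \<open>m\<close>
    convert this into \<open>J m\<close>.\<close>
  also have "\<dots> \<le> exp (- B) * (J m / c1)"
  proof -
    have "l u0 * c1 \<le> l u0 * g u0" using c1 l0 by (intro mult_left_mono) (auto simp: g_def)
    also have "\<dots> \<le> J m" using max[of u0, folded J_def] by (simp add: J)
    finally show ?thesis using c1 by (intro mult_left_mono) (auto simp: pos_le_divide_eq)
  qed
  finally show "(\<integral>u. indicator (- ball u0 \<delta>) u * joint M D y i \<theta> u \<partial>lborel) \<le> exp (- B) / c1 * joint M D y i \<theta> m"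
    by (simp add: J_def)
qed

text \<open>Every group has at least \<open>n_min\<close> units, so a property of all large sizes
  holds for all groups simultaneously, however many there are.\<close>

lemma eventually_gsize:
  assumes "eventually P at_top" "filterlim (\<lambda>s. n_min (D s)) at_top sequentially"
  shows "\<forall>\<^sub>F s in sequentially. \<forall>i<groups (D s). P (real (gsize (D s) i))"
proof -
  obtain X where X: "\<And>x. X \<le> x \<Longrightarrow> P x" using assms(1) unfolding eventually_at_top_linorder by blast
  have "filterlim (\<lambda>s. real (n_min (D s))) at_top sequentially"
    by (rule filterlim_compose[OF filterlim_real_sequentially assms(2)])
  then have "\<forall>\<^sub>F s in sequentially. X \<le> real (n_min (D s))" by (simp add: filterlim_at_top)
  then show ?thesis
  proof eventually_elim
    case (elim s)
    show ?case
    proof (intro allI impI X)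
      fix i assume "i < groups (D s)"
      then have "n_min (D s) \<le> gsize (D s) i" unfolding n_min_def by (intro Min_le) auto
      then show "X \<le> real (gsize (D s) i)" using elim by simp
    qed
  qed
qed

text \<open>The bound of the locale, with the hypotheses in the form in which the regularity
  conditions deliver them.\<close>

lemma group_error:
  fixes M :: "('x, 'y, 'd::{finite,linorder}, 'b::euclidean_space, 'f::euclidean_space,
               's::euclidean_space) mixed_model"
    and Q :: "('d rvec) set" and r k N t :: nat
  defines "c0 \<equiv> exp (- 1) * (\<integral>z. indicator (cball 0 1) z * gauss_dens z \<partial>(lborel :: 'd rvec measure))"
  assumes M: "is_mixed_model M" and D: "is_dataset M q D" and y: "y \<in> space (law D)"
    and i: "i < groups D" and \<theta>: "\<theta> \<in> params M"
    and k: "1 \<le> k" "r = (k + 2) div 3" and Q: "finite Q" "quad_exact k Q \<omega>" "k mod 3 = 1 \<longrightarrow> quad_symmetric Q \<omega>"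
    and mode: "\<exists>u. is_arg_max (\<lambda>u. eln (joint M D y i \<theta> u)) (\<lambda>u. True) u" "u_hat M D y i \<theta> \<in> ball u0 (\<delta> / 2)"
    and pos: "\<forall>u\<in>ball u0 \<delta>. 0 < joint M D y i \<theta> u"
    and C: "Ck_on t (ball u0 \<delta>) (\<lambda>u. ln (joint M D y i \<theta> u))" "2 * r + 2 \<le> t"
    and deriv: "\<forall>a u. (\<Sum>j\<in>UNIV. a j) \<le> t \<longrightarrow> u \<in> ball u0 \<delta> \<longrightarrow> \<bar>multi_deriv a (\<lambda>u. ln (joint M D y i \<theta> u)) u\<bar> \<le> \<Lambda>"
    and hess: "\<forall>u\<in>ball u0 \<delta>. \<mu> \<le> ord_eigenval CARD('d) (\<lambda>v. - hess (\<lambda>u. ln (joint M D y i \<theta> u)) u v)"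
    and far: "\<forall>u\<in>- ball u0 \<delta>. eln (lik M D y i \<theta> u) - eln (lik M D y i \<theta> u0) \<le> ereal (- B)"
    and c1: "0 < c1" "c1 \<le> re_dens M (snd (snd \<theta>)) u0"
    and num: "0 < \<mu>" "0 < \<rho>" "\<rho> < \<delta> / 2" "\<Lambda> * (real CARD('d) * \<rho>) ^ 3 \<le> a" "real CARD('d) * \<rho> \<le> a" "a \<le> 1 / 8"
      "\<Lambda> * (real CARD('d) / sqrt \<mu>) ^ 3 \<le> 1" "real CARD('d) / sqrt \<mu> \<le> 1" "max 1 (Max (norm ` Q)) \<le> \<rho> * sqrt \<mu>"
    and E: "5 * 4 ^ r * ((\<Sum>z\<in>Q. gauss_dens z * \<bar>\<omega> z\<bar>) + (\<integral>z. gauss_dens z \<partial>(lborel :: 'd rvec measure))) * a ^ (2 * r)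
      + real (2 * r) * 4 ^ r * (\<integral>z. gauss_dens z * (1 + norm z) ^ (6 * r + N) \<partial>(lborel :: 'd rvec measure)) / (\<rho> * sqrt \<mu>) ^ N
      + (exp (- B) / c1 + exp (- \<mu> * \<rho>\<^sup>2 / 2) * measure lborel (ball (0 :: 'd rvec) \<delta>)) * (1 + fact CARD('d) * \<Lambda> ^ CARD('d)) \<le> E"
      "E \<le> c0 / 2"
  shows "0 < aq_group M D y Q \<omega> i \<theta>" "0 < marginal_group M D y i \<theta>"
    "\<bar>ln (aq_group M D y Q \<omega> i \<theta>) - ln (marginal_group M D y i \<theta>)\<bar> \<le> 2 * E / c0"
proof -
  define J where "J = joint M D y i \<theta>"
  define m where "m = u_hat M D y i \<theta>"
  define h where "h = (\<lambda>u. ln (J u))"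
  have \<delta>: "0 < \<delta>" using num(2,3) by linarith
  have mB: "m \<in> ball u0 \<delta>" using mode(2) \<delta> by (simp add: m_def)
  then have Jm: "0 < J m" using pos by (simp add: J_def)
  have "is_arg_max (\<lambda>u. eln (J u)) (\<lambda>u. True) m"
    unfolding m_def u_hat_def arg_max_def J_def using mode(1) by (rule someI_ex)
  then have "\<not> eln (J m) < eln (J u)" for u by (simp add: is_arg_max_def)
  then have Jmax: "J u \<le> J m" for u
    using Jm by (metis eln_le_iff linear not_less order.strict_trans2)
  note tail = joint_tail[OF M D y i \<theta> bspec[OF pos] \<delta> bspec[OF far] c1 Jmax[unfolded J_def]]
  have Cf: "Ck_on t (ball u0 \<delta>) h" using C(1) by (simp add: h_def J_def)
  interpret laplace_group J m u0 \<delta> \<Lambda> \<mu> \<rho> "exp (- B) / c1" a k r Q \<omega>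
  proof
    show "integrable lborel J" using tail(1) by (simp add: J_def)
    show "0 \<le> J u" for u
      unfolding J_def joint_def
      by (intro mult_nonneg_nonneg lik_measurable(2)[OF M D y i \<theta>] re_dens_facts(2)[OF M \<theta>])
    show "Ck_on (2 * r + 2) (ball u0 \<delta>) (\<lambda>u. ln (J u))" using Ck_on_mono[OF Cf C(2)] by (simp add: h_def)
    show "\<bar>iter_deriv bs (\<lambda>u. ln (J u)) u\<bar> \<le> \<Lambda>"
      if bs: "set bs \<subseteq> Basis" "length bs \<le> 2 * r + 2" and u: "u \<in> ball u0 \<delta>" for bs u
    proof -
      have "length bs \<le> t" using bs(2) C(2) by simp
      then obtain a where "(\<Sum>j\<in>UNIV. a j) = length bs" "iter_deriv bs h u = multi_deriv a h u"
        using iter_deriv_eq_multi_deriv[OF Cf open_ball u bs(1)] by blast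
      then show ?thesis using deriv[rule_format, OF _ u, of a] \<open>length bs \<le> t\<close> by (simp add: h_def J_def)
    qed
    show "\<mu> * (norm v)\<^sup>2 \<le> - (v \<bullet> hess (\<lambda>u. ln (J u)) u v)" if u: "u \<in> ball u0 \<delta>" for u v
    proof -
      have C2: "Ck_on 2 (ball u0 \<delta>) h" using Ck_on_mono[OF Cf] C(2) by simp
      have "linear (\<lambda>v. - hess h u v)" using linear_hess by (rule linear_compose_neg)
      moreover have "(- hess h u v) \<bullet> w = v \<bullet> (- hess h u w)" for v w
        using hess_self_adjoint[OF C2 open_ball u, of v w] by simp
      moreover have "\<mu> \<le> ord_eigenval DIM('d rvec) (\<lambda>v. - hess h u v)"
        using hess u by (simp add: h_def J_def)
      ultimately have "\<mu> * (norm v)\<^sup>2 \<le> v \<bullet> (- hess h u v)" by (rule ord_eigenval_DIM_lower_bound)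
      then show ?thesis by (simp add: h_def)
    qed
    show "norm z \<le> \<rho> * sqrt \<mu>" if "z \<in> Q" for z
    proof -
      have "norm z \<le> Max (norm ` Q)" using that Q(1) by (intro Max_ge) auto
      then show ?thesis using num(9) by simp
    qed
    show "(\<integral>u. indicator (- ball u0 \<delta>) u * J u \<partial>lborel) \<le> exp (- B) / c1 * J m"
      using tail(2) by (simp add: J_def)
  qed (use k Q Jmax pos mode(2) num in \<open>auto simp: J_def m_def\<close>)
  have aq: "aq_group M D y Q \<omega> i \<theta> = det L * (\<Sum>z\<in>Q. J (L *v z + m) * \<omega> z)"
  proof -
    have "L_mat M D y i \<theta> = L"
      unfolding L_mat_def H_mat_def L_def H_def f_def by (simp add: J_def m_def)
    then show ?thesis by (simp add: aq_group_def J_def m_def)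
  qed
  have mg: "marginal_group M D y i \<theta> = (\<integral>u. J u \<partial>lborel)"
    by (simp add: marginal_group_def J_def)
  note qe = quadrature_error[of N E, folded c0_def, OF _ E(2)]
  show "0 < aq_group M D y Q \<omega> i \<theta>" "0 < marginal_group M D y i \<theta>"
    "\<bar>ln (aq_group M D y Q \<omega> i \<theta>) - ln (marginal_group M D y i \<theta>)\<bar> \<le> 2 * E / c0"
    unfolding aq mg using E(1) by (intro qe; simp add: mult_ac)+
qed

text \<open>All factors are positive, so \<open>eln\<close> is an ordinary logarithm and turns the
  products into sums over the groups.\<close>

lemma abs_eln_prod_diff_le:
  fixes n :: nat
  assumes "\<And>i. i < n \<Longrightarrow> 0 < (x i :: real)" "\<And>i. i < n \<Longrightarrow> 0 < y i" "\<And>i. i < n \<Longrightarrow> \<bar>ln (x i) - ln (y i)\<bar> \<le> e i"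
  shows "\<bar>eln (\<Prod>i<n. x i) - eln (\<Prod>i<n. y i)\<bar> \<le> ereal (\<Sum>i<n. e i)"
proof -
  have p: "0 < (\<Prod>i<n. x i)" "0 < (\<Prod>i<n. y i)" using assms by (auto intro!: prod_pos)
  have l: "ln (\<Prod>i<n. x i) = (\<Sum>i<n. ln (x i))" "ln (\<Prod>i<n. y i) = (\<Sum>i<n. ln (y i))"
    by (intro ln_prod; use assms in force)+
  have "\<bar>(\<Sum>i<n. ln (x i)) - (\<Sum>i<n. ln (y i))\<bar> \<le> (\<Sum>i<n. e i)"
    unfolding sum_subtractf[symmetric] using assms(3) by (intro order_trans[OF sum_abs] sum_mono) auto
  then show ?thesis using p l by (simp add: eln_def)
qed

theorem lemma1:
  fixes M :: "('x, 'y, 'd::{finite,linorder}, 'b::euclidean_space, 'f::euclidean_space,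
               's::euclidean_space) mixed_model"
    and D :: "nat \<Rightarrow> ('x, 'y) dataset"
    and q \<alpha> \<delta> :: real
    and k :: nat
    and \<theta>s :: "'b \<times> 'f \<times> 's"
    and us :: "nat \<Rightarrow> nat \<Rightarrow> 'd rvec"
    and Q :: "('d rvec) set"
    and \<omega> :: "'d rvec \<Rightarrow> real"
  assumes "1 \<le> k"
    and "is_mixed_model M"
    and "0 < q"
    and "\<And>s. is_dataset M q (D s)"
    and "filterlim (\<lambda>s. n_min (D s)) at_top sequentially"
    and "finite Q"
    and "quad_exact k Q \<omega>"
    and "k mod 3 = 1 \<longrightarrow> quad_symmetric Q \<omega>"
    and "0 < \<delta>"
    and "0 < \<alpha>" and "\<alpha> < 1 / 4"
    and "\<theta>s \<in> params M"
    and "ball \<theta>s \<delta> \<subseteq> params M"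
    and "cond_Deriv M D \<delta> \<theta>s us (2 * ((k + 2) div 3) + 2)"
    and "cond_Hess M D \<delta> \<theta>s us"
    and "cond_Hess_u M D \<delta> \<theta>s us"
    and "cond_Far M D \<alpha> \<delta> \<theta>s us"
    and "cond_FarOut M D \<delta> \<theta>s us"
    and "cond_Cons M D \<alpha> \<theta>s us"
    and "cond_Prior M D \<alpha> \<delta> \<theta>s us"
    and "modes_exist M D \<alpha> \<delta> \<theta>s us"
  shows "\<exists>C>0. \<forall>\<epsilon>>0.
    whp D (\<lambda>s y.
      (SUP \<theta>\<in>ball \<theta>s (zeta \<alpha> (D s)).
         \<bar>eln (aq M (D s) y Q \<omega> \<theta>) - eln (marginal M (D s) y \<theta>)\<bar>)
        < ereal (C * (\<Sum>i<groups (D s).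
                        real (gsize (D s) i) powr (- real_of_int \<lfloor>(real k + 2) / 3\<rfloor> + \<epsilon>))))"
\<comment> \<open>The constant 1 works: once groups are large, each contributes at most half of its
  term, because the conditions are used with an \<epsilon> so small that a power of the group size
  is left to absorb their constants.\<close>
proof (intro exI[of _ "1 :: real"] conjI allI impI)
  fix \<epsilon>\<^sub>0 :: real assume \<epsilon>0: "0 < \<epsilon>\<^sub>0"
  have P: "prob_space (law (D s))" for s using assms(4)[of s] by (simp add: is_dataset_def)
  define r where "r = (k + 2) div 3"
  have r: "1 \<le> r" using assms(1) by (simp add: r_def)
  have fl: "real_of_int \<lfloor>(real k + 2) / 3\<rfloor> = real r"
  proof -
    have "(real k + 2) / 3 = real (k + 2) / real 3" by simp
    then show ?thesis unfolding r_def by (simp only: floor_divide_of_nat_eq of_int_of_nat_eq)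
  qed
  \<comment> \<open>The cap 1 / 2 keeps the exponent \<open>- r + \<epsilon>'\<close> negative,
    which gives \<open>E \<le> c0 / 2\<close>; passing to the larger given exponent only enlarges
    the bound.\<close>
  define \<epsilon>' where "\<epsilon>' = min \<epsilon>\<^sub>0 (1 / 2)"
  \<comment> \<open>Makes \<open>8 * r * \<epsilon>\<close> equal to
    \<open>\<epsilon>' / 2\<close>.\<close>
  define \<epsilon> where "\<epsilon> = \<epsilon>' / (16 * real r)"
  have \<epsilon>': "0 < \<epsilon>'" "\<epsilon>' \<le> 1 / 2" "\<epsilon>' \<le> \<epsilon>\<^sub>0" using \<epsilon>0 by (auto simp: \<epsilon>'_def)
  have \<epsilon>: "0 < \<epsilon>" "\<epsilon> \<le> 1 / 32" "8 * real r * \<epsilon> < \<epsilon>'"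
  proof -
    show "0 < \<epsilon>" using \<epsilon>'(1) r by (simp add: \<epsilon>_def)
    have "\<epsilon> \<le> (1 / 2) / 16" unfolding \<epsilon>_def using \<epsilon>' r by (intro frac_le) auto
    then show "\<epsilon> \<le> 1 / 32" by simp
    show "8 * real r * \<epsilon> < \<epsilon>'" using \<epsilon>'(1) r by (simp add: \<epsilon>_def)
  qed
  obtain N :: nat where "2 * real r / \<epsilon> \<le> real N" using real_arch_simple by blast
  then have N: "real r \<le> real N * \<epsilon> / 2" using \<epsilon>(1) by (simp add: field_simps)
  obtain t K where t: "2 * r + 2 \<le> t" and K: "0 < K" and dv:
    "\<And>a. (\<Sum>j\<in>UNIV. a j) \<le> t \<Longrightarrow> whp D (\<lambda>s y. \<forall>i<groups (D s).
        (\<forall>\<theta>\<in>ball \<theta>s \<delta>. (\<forall>u\<in>ball (us s i) \<delta>. 0 < joint M (D s) y i \<theta> u) \<and>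
            Ck_on t (ball (us s i) \<delta>) (\<lambda>u. ln (joint M (D s) y i \<theta> u))) \<and>
        (SUP \<theta>\<in>ball \<theta>s \<delta>. SUP u\<in>ball (us s i) \<delta>.
            ereal \<bar>multi_deriv a (\<lambda>u. ln (joint M (D s) y i \<theta> u)) u\<bar>)
          < ereal (real (gsize (D s) i) powr (1 + \<epsilon>) * K))"
    using assms(14) \<epsilon>(1) unfolding cond_Deriv_def r_def by blast
  obtain \<eta> where \<eta>: "0 < \<eta>" and hs: "whp D (\<lambda>s y. \<forall>i<groups (D s). \<forall>\<theta>\<in>ball \<theta>s \<delta>. \<forall>u\<in>ball (us s i) \<delta>.
         real (gsize (D s) i) powr (1 - \<epsilon>) * \<eta>
           \<le> ord_eigenval CARD('d) (\<lambda>v. - hess (\<lambda>u. ln (joint M (D s) y i \<theta> u)) u v))"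
    using assms(16) \<epsilon>(1) unfolding cond_Hess_u_def by blast
  obtain b where b: "0 < b" and fr: "whp D (\<lambda>s y. \<forall>i<groups (D s). \<forall>\<theta>\<in>ball \<theta>s (zeta \<alpha> (D s)). \<forall>u\<in>- ball (us s i) \<delta>.
         eln (lik M (D s) y i \<theta> u) - eln (lik M (D s) y i \<theta> (us s i))
           \<le> ereal (- (real (gsize (D s) i) powr (1 - \<epsilon>) * b)))"
    using assms(17) \<epsilon>(1) unfolding cond_Far_def by blast
  obtain c\<^sub>1 where c1: "0 < c\<^sub>1" and pr: "\<forall>\<^sub>F s in sequentially. \<forall>i<groups (D s).
          \<forall>\<theta>\<in>ball \<theta>s (zeta \<alpha> (D s)). \<forall>u\<in>ball (us s i) \<delta>. c\<^sub>1 \<le> re_dens M (snd (snd \<theta>)) u"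
  proof -
    from assms(20) obtain c\<^sub>1 c\<^sub>2 where c: "0 < c\<^sub>1" "\<forall>\<^sub>F s in sequentially. \<forall>i<groups (D s).
            \<forall>\<theta>\<in>ball \<theta>s (zeta \<alpha> (D s)). \<forall>u\<in>ball (us s i) \<delta>.
              c\<^sub>1 \<le> re_dens M (snd (snd \<theta>)) u \<and> re_dens M (snd (snd \<theta>)) u \<le> c\<^sub>2"
      unfolding cond_Prior_def by blast
    from c(2) have "\<forall>\<^sub>F s in sequentially. \<forall>i<groups (D s).
          \<forall>\<theta>\<in>ball \<theta>s (zeta \<alpha> (D s)). \<forall>u\<in>ball (us s i) \<delta>. c\<^sub>1 \<le> re_dens M (snd (snd \<theta>)) u"
      by (rule eventually_mono) blast
    with c(1) show thesis by (rule that)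
  qed
  define c0 where "c0 = exp (- 1) * (\<integral>z. indicator (cball 0 1) z * gauss_dens z \<partial>(lborel :: 'd rvec measure))"
  have c0: "0 < c0" unfolding c0_def by (rule exp_neg_one_gauss_pos)
  note asym = group_asymptotics[OF K \<eta> b assms(9) c1 c0 \<epsilon> \<epsilon>'(2) r N, where d = "CARD('d)" and B = "Max (norm ` Q)"
    and CQ = "5 * 4 ^ r * ((\<Sum>z\<in>Q. gauss_dens z * \<bar>\<omega> z\<bar>) + (\<integral>z. gauss_dens z \<partial>(lborel :: 'd rvec measure)))"
    and CM = "real (2 * r) * 4 ^ r * (\<integral>z. gauss_dens z * (1 + norm z) ^ (6 * r + N) \<partial>(lborel :: 'd rvec measure))"
    and V = "measure lborel (ball (0 :: 'd rvec) \<delta>)" and F = "fact CARD('d)"]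
  let ?I = "{a :: 'd \<Rightarrow> nat. (\<Sum>j\<in>UNIV. a j) \<le> t}"
  have "whp D (\<lambda>s y. \<forall>a\<in>?I. \<forall>i<groups (D s).
        (\<forall>\<theta>\<in>ball \<theta>s \<delta>. (\<forall>u\<in>ball (us s i) \<delta>. 0 < joint M (D s) y i \<theta> u) \<and>
            Ck_on t (ball (us s i) \<delta>) (\<lambda>u. ln (joint M (D s) y i \<theta> u))) \<and>
        (SUP \<theta>\<in>ball \<theta>s \<delta>. SUP u\<in>ball (us s i) \<delta>.
            ereal \<bar>multi_deriv a (\<lambda>u. ln (joint M (D s) y i \<theta> u)) u\<bar>)
          < ereal (real (gsize (D s) i) powr (1 + \<epsilon>) * K))" (is "whp D ?dv")
    by (intro whp_ball P finite_multi_index dv) auto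
  \<comment> \<open>Each of the four events is already uniform in the group and in \<theta>; on
    their intersection the rest of the argument is deterministic.\<close>
  note whp_conj[OF P whp_conj[OF P this hs] whp_conj[OF P fr assms(21)[unfolded modes_exist_def]]]
  then show "whp D (\<lambda>s y.
      (SUP \<theta>\<in>ball \<theta>s (zeta \<alpha> (D s)).
         \<bar>eln (aq M (D s) y Q \<omega> \<theta>) - eln (marginal M (D s) y \<theta>)\<bar>)
        < ereal (1 * (\<Sum>i<groups (D s).
                        real (gsize (D s) i) powr (- real_of_int \<lfloor>(real k + 2) / 3\<rfloor> + \<epsilon>\<^sub>0))))" (is "whp D ?B")
  proof (rule whp_mono[OF P])
    have nlim: "filterlim (\<lambda>s. real (n_min (D s))) at_top sequentially"
      by (rule filterlim_compose[OF filterlim_real_sequentially assms(5)])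
    have "((\<lambda>s. zeta \<alpha> (D s)) \<longlonglongrightarrow> 0)"
      unfolding zeta_def using assms(10) by (intro tendsto_neg_powr nlim) auto
    \<comment> \<open>From then on the shrinking ball lies in
      \<open>ball \<theta>s \<delta>\<close>, where the derivatives and the Hessian are
      controlled.\<close>
    then have z: "\<forall>\<^sub>F s in sequentially. zeta \<alpha> (D s) < \<delta>" using assms(9) by (rule order_tendstoD)
    from z eventually_gsize[OF asym assms(5)] pr
    show "\<forall>\<^sub>F s in sequentially. \<forall>y\<in>space (law (D s)).
      (?dv s y \<and> (\<forall>i<groups (D s). \<forall>\<theta>\<in>ball \<theta>s \<delta>. \<forall>u\<in>ball (us s i) \<delta>.
         real (gsize (D s) i) powr (1 - \<epsilon>) * \<eta>
           \<le> ord_eigenval CARD('d) (\<lambda>v. - hess (\<lambda>u. ln (joint M (D s) y i \<theta> u)) u v))) \<and>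
      (\<forall>i<groups (D s). \<forall>\<theta>\<in>ball \<theta>s (zeta \<alpha> (D s)). \<forall>u\<in>- ball (us s i) \<delta>.
         eln (lik M (D s) y i \<theta> u) - eln (lik M (D s) y i \<theta> (us s i))
           \<le> ereal (- (real (gsize (D s) i) powr (1 - \<epsilon>) * b))) \<and>
      (\<forall>i<groups (D s). \<forall>\<theta>\<in>ball \<theta>s (zeta \<alpha> (D s)).
         (\<exists>u. is_arg_max (\<lambda>u. eln (joint M (D s) y i \<theta> u)) (\<lambda>u. True) u) \<and>
         u_hat M (D s) y i \<theta> \<in> ball (us s i) (\<delta> / 2)) \<longrightarrow>
      ?B s y"
    proof eventually_elim
      case (elim s)
      show ?case
      proof (intro ballI impI, elim conjE)
        fix y assume y: "y \<in> space (law (D s))" and ev1: "?dv s y"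
          and ev2: "\<forall>i<groups (D s). \<forall>\<theta>\<in>ball \<theta>s \<delta>. \<forall>u\<in>ball (us s i) \<delta>.
            real (gsize (D s) i) powr (1 - \<epsilon>) * \<eta>
              \<le> ord_eigenval CARD('d) (\<lambda>v. - hess (\<lambda>u. ln (joint M (D s) y i \<theta> u)) u v)"
          and ev3: "\<forall>i<groups (D s). \<forall>\<theta>\<in>ball \<theta>s (zeta \<alpha> (D s)). \<forall>u\<in>- ball (us s i) \<delta>.
            eln (lik M (D s) y i \<theta> u) - eln (lik M (D s) y i \<theta> (us s i))
              \<le> ereal (- (real (gsize (D s) i) powr (1 - \<epsilon>) * b))"
          and ev4: "\<forall>i<groups (D s). \<forall>\<theta>\<in>ball \<theta>s (zeta \<alpha> (D s)).
            (\<exists>u. is_arg_max (\<lambda>u. eln (joint M (D s) y i \<theta> u)) (\<lambda>u. True) u) \<and>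
            u_hat M (D s) y i \<theta> \<in> ball (us s i) (\<delta> / 2)"
        define x where "x i = real (gsize (D s) i)" for i
        have x1: "1 \<le> x i" if "i < groups (D s)" for i
          using assms(4)[of s] that by (auto simp: is_dataset_def x_def)
        have err: "0 < aq_group M (D s) y Q \<omega> i \<theta> \<and> 0 < marginal_group M (D s) y i \<theta> \<and>
            \<bar>ln (aq_group M (D s) y Q \<omega> i \<theta>) - ln (marginal_group M (D s) y i \<theta>)\<bar> \<le> 1 / 2 * x i powr (- real r + \<epsilon>\<^sub>0)"
          if i: "i < groups (D s)" and \<theta>: "\<theta> \<in> ball \<theta>s (zeta \<alpha> (D s))" for i \<theta>
        proof -
          have \<theta>\<delta>: "\<theta> \<in> ball \<theta>s \<delta>" using \<theta> elim(1) by auto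
          then have \<theta>p: "\<theta> \<in> params M" using assms(13) by auto
          have mode: "\<exists>u. is_arg_max (\<lambda>u. eln (joint M (D s) y i \<theta> u)) (\<lambda>u. True) u"
            "u_hat M (D s) y i \<theta> \<in> ball (us s i) (\<delta> / 2)" using ev4 i \<theta> by blast+
          \<comment> \<open>Positivity and smoothness are part of the event of every multi-index;
            the zero multi-index serves to extract them.\<close>
          have zero: "(\<lambda>_. 0) \<in> ?I" by simp
          have reg: "\<forall>u\<in>ball (us s i) \<delta>. 0 < joint M (D s) y i \<theta> u"
            "Ck_on t (ball (us s i) \<delta>) (\<lambda>u. ln (joint M (D s) y i \<theta> u))"
            using ev1[rule_format, OF zero i] \<theta>\<delta> by blast+
          have dbound: "\<bar>multi_deriv a (\<lambda>u. ln (joint M (D s) y i \<theta> u)) u\<bar> \<le> x i powr (1 + \<epsilon>) * K"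
            if a: "(\<Sum>j\<in>UNIV. a j) \<le> t" and u: "u \<in> ball (us s i) \<delta>" for a u
          proof -
            have "ereal \<bar>multi_deriv a (\<lambda>u. ln (joint M (D s) y i \<theta> u)) u\<bar>
              \<le> (SUP \<theta>\<in>ball \<theta>s \<delta>. SUP u\<in>ball (us s i) \<delta>. ereal \<bar>multi_deriv a (\<lambda>u. ln (joint M (D s) y i \<theta> u)) u\<bar>)"
              by (rule SUP_upper2[OF \<theta>\<delta>], rule SUP_upper[OF u])
            also have "\<dots> < ereal (x i powr (1 + \<epsilon>) * K)"
              using ev1[rule_format, of a i] a i unfolding x_def by blast
            finally show ?thesis by simp
          qed
          then have dbound': "\<forall>a u. (\<Sum>j\<in>UNIV. a j) \<le> t \<longrightarrow> u \<in> ball (us s i) \<delta> \<longrightarrow>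
              \<bar>multi_deriv a (\<lambda>u. ln (joint M (D s) y i \<theta> u)) u\<bar> \<le> x i powr (1 + \<epsilon>) * K" by blast
          have hb: "\<forall>u\<in>ball (us s i) \<delta>. x i powr (1 - \<epsilon>) * \<eta>
              \<le> ord_eigenval CARD('d) (\<lambda>v. - hess (\<lambda>u. ln (joint M (D s) y i \<theta> u)) u v)"
            using ev2 i \<theta>\<delta> unfolding x_def by blast
          have fb: "\<forall>u\<in>- ball (us s i) \<delta>. eln (lik M (D s) y i \<theta> u) - eln (lik M (D s) y i \<theta> (us s i))
              \<le> ereal (- (x i powr (1 - \<epsilon>) * b))" using ev3 i \<theta> unfolding x_def by blast
          have cb: "c\<^sub>1 \<le> re_dens M (snd (snd \<theta>)) (us s i)"
            using elim(3) i \<theta> assms(9) by (metis centre_in_ball)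
          have mu: "0 < x i powr (1 - \<epsilon>) * \<eta>" using x1[OF i] \<eta> by simp
          note X1 = elim(2)[rule_format, OF i, folded x_def]
          note X2 = X1[THEN conjunct2]
          note X3 = X2[THEN conjunct2]
          note X4 = X3[THEN conjunct2]
          note X5 = X4[THEN conjunct2]
          note X6 = X5[THEN conjunct2]
          note X7 = X6[THEN conjunct2]
          note X8 = X7[THEN conjunct2]
          note X9 = X8[THEN conjunct2]
          note X10 = X9[THEN conjunct2]
          note E = group_error[OF assms(2) assms(4)[of s] y i \<theta>p assms(1) r_def assms(6-8) mode reg t dbound' hb fb c1 cb mu
              X1[THEN conjunct1] X2[THEN conjunct1] X3[THEN conjunct1] X4[THEN conjunct1] X5[THEN conjunct1]
              X6[THEN conjunct1] X7[THEN conjunct1] X8[THEN conjunct1] X9[THEN conjunct1],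
              folded c0_def, OF X10]
          have "2 * (c0 / 4 * x i powr (- real r + \<epsilon>')) / c0 = 1 / 2 * x i powr (- real r + \<epsilon>')" using c0 by simp
          also have "\<dots> \<le> 1 / 2 * x i powr (- real r + \<epsilon>\<^sub>0)"
            using x1[OF i] \<epsilon>'(3) by (intro mult_left_mono powr_mono) auto
          finally show ?thesis using E by simp
        qed
        define S where "S = (\<Sum>i<groups (D s). x i powr (- real r + \<epsilon>\<^sub>0))"
        \<comment> \<open>Source of the strict inequality: the supremum is at most
          \<open>S / 2\<close>, and \<open>S\<close> is positive because there is at least one
          group.\<close>
        have "0 < S"
        proof -
          have "1 \<le> groups (D s)" using assms(4)[of s] by (simp add: is_dataset_def)
          moreover have "0 < x i powr (- real r + \<epsilon>\<^sub>0)" if "i < groups (D s)" for i using x1[OF that] by simp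
          ultimately show ?thesis unfolding S_def by (intro sum_pos) (auto simp: lessThan_empty_iff)
        qed
        have "(SUP \<theta>\<in>ball \<theta>s (zeta \<alpha> (D s)). \<bar>eln (aq M (D s) y Q \<omega> \<theta>) - eln (marginal M (D s) y \<theta>)\<bar>)
            \<le> ereal (\<Sum>i<groups (D s). 1 / 2 * x i powr (- real r + \<epsilon>\<^sub>0))"
        proof (rule SUP_least)
          fix \<theta> assume "\<theta> \<in> ball \<theta>s (zeta \<alpha> (D s))"
          then show "\<bar>eln (aq M (D s) y Q \<omega> \<theta>) - eln (marginal M (D s) y \<theta>)\<bar>
              \<le> ereal (\<Sum>i<groups (D s). 1 / 2 * x i powr (- real r + \<epsilon>\<^sub>0))"
            unfolding aq_def marginal_def using err by (intro abs_eln_prod_diff_le) blast+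
        qed
        also have "\<dots> < ereal S" using \<open>0 < S\<close> by (simp add: S_def flip: sum_divide_distrib)
        finally show "?B s y"
          by (simp add: S_def x_def fl)
      qed
    qed
  qed
qed simp

end
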